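(* Let $\Omega_1\subset\mathbb{R}$ be a real domain and let $f_0\in\mathcal{A}(\Omega_1)\otimes\mathbb{R}_m$. Then $$\mathrm{GCK}[f_0](x_0,\underline{x})=\frac{1}{\sigma_m}\left(\int_{\mathbb{S}^{m-1}}\exp\left(\langle\underline{\omega},\underline{x}\rangle\,\underline{\omega}\,\partial_{x_0}\right)dS_{\underline{\omega}}\right)f_0(x_0)=\frac{1}{\sigma_m}\int_{\mathbb{S}^{m-1}}f\left(x_0+\langle\underline{x},\underline{\omega}\rangle\,\underline{\omega}\right)dS_{\underline{\omega}},$$ where $f=S[f_0]$ is the slice monogenic extension of $f_0$ to an axially symmetric slice neighbourhood $\Omega\subset\mathbb{R}^{m+1}$ of $\Omega_1$. Therefore $\mathrm{GCK}=\check{R}\circ S$, where $\check{R}$ is the dual Radon transform. The three maps $$\mathrm{GCK}:\mathcal{A}(\Omega_1)\otimes\mathbb{R}_m\to\mathcal{AM}(\Omega),\qquad S:\mathcal{A}(\Omega_1)\otimes\mathbb{R}_m\to\mathcal{SM}(\Omega),\qquad \check{R}:\mathcal{SM}(\Omega)\to\mathcal{AM}(\Omega)$$ are right-module isomorphisms. In particular, $\check{R}=\mathrm{GCK}\circ S^{-1}$ and $\check{R}^{-1}=S\circ\mathrm{GCK}^{-1}$.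
   Context: $\mathbb{R}_m$ is the real Clifford algebra with generators $e_1,\dots,e_m$, $e_je_\ell+e_\ell e_j=-2\delta_{j\ell}$. Points of $\mathbb{R}^{m+1}$ are identified with paravectors $x=x_0+\underline{x}$, $\underline{x}=\sum_{j=1}^m x_je_j$; $\langle\cdot,\cdot\rangle$ is the Euclidean inner product in $\mathbb{R}^m$; $\mathbb{S}^{m-1}$ is the unit sphere of vectors in $\mathbb{R}^m$ with surface measure $dS_{\underline{\omega}}$ and area $\sigma_m=\frac{2\pi^{m/2}}{\Gamma(m/2)}$. Axially symmetric slice domain: $\Omega=\Omega_2\times\mathbb{S}^{m-1}=\{u+v\underline{\omega}:(u,v)\in\Omega_2,\underline{\omega}\in\mathbb{S}^{m-1}\}$ with $\Omega_2\subset\mathbb{C}$ a connected open set symmetric with respect to the real axis; here $\Omega_1=\Omega_2\cap\mathbb{R}$. $\mathcal{A}(\Omega_1)$ denotes the $\mathbb{R}$-valued real-analytic functions on $\Omega_1$ (with unique holomorphic extension to $\Omega_2$). $\mathcal{SM}(\Omega)$ is the right $\mathbb{R}_m$-module of slice monogenic functions: $f:\Omega\to\mathbb{R}_m$ with $(\partial_u+\underline{\omega}\,\partial_v)f(u+v\underline{\omega})=0$ on $\Omega\cap\{u+v\underline{\omega}:u,v\in\mathbb{R}\}$ for every $\underline{\omega}\in\mathbb{S}^{m-1}$. $\mathcal{AM}(\Omega)$ is the right $\mathbb{R}_m$-module of axially monogenic functions: real-analytic $F:\Omega\to\mathbb{R}_m$ with $(\partial_{x_0}+\sum_je_j\partial_{x_j})F=0$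 and $F=A(x_0,|\underline{x}|)+\frac{\underline{x}}{|\underline{x}|}B(x_0,|\underline{x}|)$, $A$ even and $B$ odd in the second variable. $S[f_0](x)=\sum_{j\ge0}\frac{\underline{x}^j}{j!}f_0^{(j)}(x_0)$ is the slice extension (inverse: restriction to $\underline{x}=0$). $\exp(\langle\underline{\omega},\underline{x}\rangle\,\underline{\omega}\,\partial_{x_0})f_0(x_0)=\sum_{j\ge0}\frac{\langle\underline{\omega},\underline{x}\rangle^j\underline{\omega}^j}{j!}f_0^{(j)}(x_0)$. $\mathrm{GCK}[f_0]$ is the unique axially monogenic function of the form $\sum_{j\ge0}\underline{x}^jf_j(x_0)$ ($f_j$ analytic) whose restriction to $\underline{x}=0$ is $f_0(x_0)$. The dual Radon transform is $\check{R}[f](x_0,\underline{x})=\frac{1}{\sigma_m}\int_{\mathbb{S}^{m-1}}f(x_0,\langle\underline{x},\underline{\omega}\rangle\underline{\omega})\,dS_{\underline{\omega}}$. Convention: $\Omega$ is an axially symmetric slice neighbourhood of $\Omega_1$ on which the extensions in question are defined (it may depend on $f_0$), and functions on such neighbourhoods are identified when they agree near $\Omega_1$. *)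

theory Defs
  imports "HOL-Analysis.Analysis" "HOL-Algebra.Group"
begin

text \<open>
  The generators are indexed by a finite linearly ordered type \<open>'n\<close>, so \<open>m = CARD('n)\<close>.
  An element is its family of coordinates with respect to the basis
  \<open>e\<^sub>A = e\<^sub>j\<^sub>1 \<cdots> e\<^sub>j\<^sub>k\<close>, \<open>A = {j\<^sub>1 < \<dots> < j\<^sub>k}\<close>.
\<close>

typedef 'n clifford = "UNIV :: (real ^ ('n::{finite,linorder}) set) set"
  morphisms coords Clifford ..

lemmas Clifford_simps [simp] = Clifford_inverse [OF UNIV_I] coords_inverse

abbreviation coef :: "'n::{finite,linorder} clifford \<Rightarrow> 'n set \<Rightarrow> real"
  where "coef x A \<equiv> coords x $ A"

lemma clifford_eqI: "(\<And>A. coef x A = coef y A) \<Longrightarrow> x = y"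
  by (metis coords_inject vec_eq_iff)

text \<open>
  \<open>e\<^sub>A e\<^sub>B = blade_sign A B e\<^sub>C\<close> with \<open>C\<close> the symmetric difference of \<open>A\<close> and \<open>B\<close>: one factor \<open>-1\<close>
  for each inversion \<open>b < a\<close> and one for each common generator \<open>b = a\<close>.
\<close>

definition blade_sign :: "'n::{finite,linorder} set \<Rightarrow> 'n set \<Rightarrow> real"
  where "blade_sign A B = (-1) ^ card {(a, b). a \<in> A \<and> b \<in> B \<and> b \<le> a}"

instantiation clifford :: ("{finite,linorder}") real_vector
begin

definition "0 = Clifford 0"
definition "x + y = Clifford (coords x + coords y)"
definition "x - y = Clifford (coords x - coords y)"
definition "- x = Clifford (- coords x)"
definition "r *\<^sub>R x = Clifford (r *\<^sub>R coords x)"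

lemma coords_linear [simp]:
  "coords 0 = 0" "coords (x + y) = coords x + coords y" "coords (x - y) = coords x - coords y"
  "coords (- x) = - coords x" "coords (r *\<^sub>R x) = r *\<^sub>R coords x"
  by (simp_all add: zero_clifford_def plus_clifford_def minus_clifford_def uminus_clifford_def
      scaleR_clifford_def)

instance
  by standard (rule clifford_eqI; simp add: algebra_simps)+

end

instantiation clifford :: ("{finite,linorder}") euclidean_space
begin

definition "inner x y = inner (coords x) (coords y)"
definition "norm x = norm (coords x)"
definition "dist x y = norm (x - y)" for x y :: "'a clifford"
definition "sgn x = x /\<^sub>R norm x" for x :: "'a clifford"
definition "uniformity = (INF e\<in>{0 <..}. principal {(x, y). dist (x::'a clifford) y < e})"
definition "open (U :: 'a clifford set) \<longleftrightarrow>
  (\<forall>x\<in>U. eventually (\<lambda>(x', y). x' = x \<longrightarrow> y \<in> U) uniformity)"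
definition "Basis = Clifford ` Basis"

instance
proof
  fix x y z :: "'a clifford" and r s :: real
  show "inner x y = inner y x" "inner (x + y) z = inner x z + inner y z"
    "inner (r *\<^sub>R x) y = r * inner x y" "0 \<le> inner x x" "norm x = sqrt (inner x x)"
    by (simp_all add: inner_clifford_def norm_clifford_def inner_add_left norm_eq_sqrt_inner
        inner_commute[of "coords x" "coords y"])
  show "inner x x = 0 \<longleftrightarrow> x = 0"
    by (metis coords_inject coords_linear(1) inner_clifford_def inner_eq_zero_iff)
  show "finite (Basis :: 'a clifford set)" "(Basis :: 'a clifford set) \<noteq> {}"
    by (simp_all add: Basis_clifford_def)
  show "(\<forall>u\<in>Basis. inner x u = 0) \<longleftrightarrow> x = 0"
  proof -
    have "(\<forall>u\<in>Basis. inner x u = 0) \<longleftrightarrow> (\<forall>u\<in>Basis. inner (coords x) u = 0)"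
      by (simp add: Basis_clifford_def inner_clifford_def)
    also have "\<dots> \<longleftrightarrow> x = 0"
      by (metis coords_inject coords_linear(1) euclidean_all_zero_iff)
    finally show ?thesis .
  qed
  show "inner u v = (if u = v then 1 else 0)" if "u \<in> Basis" "v \<in> Basis" for u v :: "'a clifford"
    using that by (auto simp: Basis_clifford_def inner_clifford_def inner_Basis Clifford_inject)
qed (simp_all add: dist_clifford_def sgn_clifford_def uniformity_clifford_def open_clifford_def)

end

instantiation clifford :: ("{finite,linorder}") real_algebra_1
begin

definition "1 = Clifford (\<chi> A. if A = {} then 1 else 0)"
definition "x * y = Clifford (\<chi> C. \<Sum>A\<in>UNIV. \<Sum>B\<in>UNIV.
  if sym_diff A B = C then blade_sign A B * coef x A * coef y B else 0)"

lemma coef_mult: "coef (x * y) C = (\<Sum>A\<in>UNIV. blade_sign A (sym_diff A C) * coef x A * coef y (sym_diff A C))"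
proof -
  have *: "sym_diff A B = C \<longleftrightarrow> B = sym_diff A C" for A B C :: "'a set" by auto
  show ?thesis unfolding times_clifford_def * by simp
qed

lemma coef_one: "coef 1 A = (if A = {} then 1 else 0)"
  by (simp add: one_clifford_def)

lemma blade_sign_prod:
  "blade_sign A B = (\<Prod>a\<in>UNIV. \<Prod>b\<in>UNIV. if a \<in> A \<and> b \<in> B \<and> b \<le> a then -1 else 1)"
proof -
  have "(\<Prod>a\<in>UNIV. \<Prod>b\<in>UNIV. if a \<in> A \<and> b \<in> B \<and> b \<le> a then -1 else 1 :: real) =
    (\<Prod>p\<in>UNIV. if p \<in> {(a, b). a \<in> A \<and> b \<in> B \<and> b \<le> a} then -1 else 1)"
    by (simp add: prod.cartesian_product UNIV_Times_UNIV[symmetric] case_prod_unfold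
        del: UNIV_Times_UNIV)
  also have "\<dots> = blade_sign A B"
    by (subst prod.If_cases) (simp_all add: blade_sign_def)
  finally show ?thesis by simp
qed

lemma blade_sign_sym_diff:
  "blade_sign (sym_diff A B) C = blade_sign A C * blade_sign B C"
  "blade_sign A (sym_diff B C) = blade_sign A B * blade_sign A C"
  unfolding blade_sign_prod prod.distrib[symmetric] by (intro prod.cong; auto)+

lemma blade_sign_empty [simp]: "blade_sign {} A = 1" "blade_sign A {} = 1"
  by (simp_all add: blade_sign_def)

instance
proof
  fix x y z :: "'a clifford" and r :: real
  show "x * y * z = x * (y * z)"
  proof (rule clifford_eqI)
    fix D :: "'a set"
    have bij: "bij (\<lambda>C. sym_diff A C)" for A :: "'a set"
      by (rule o_bij[of "\<lambda>C. sym_diff A C"]) (auto simp: fun_eq_iff)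
    have "coef (x * y * z) D = (\<Sum>C\<in>UNIV. \<Sum>A\<in>UNIV.
      blade_sign C (sym_diff C D) * (blade_sign A (sym_diff A C) * coef x A * coef y (sym_diff A C)) * coef z (sym_diff C D))"
      by (simp add: coef_mult sum_distrib_left sum_distrib_right)
    also have "\<dots> = (\<Sum>A\<in>UNIV. \<Sum>C\<in>UNIV.
      blade_sign C (sym_diff C D) * (blade_sign A (sym_diff A C) * coef x A * coef y (sym_diff A C)) * coef z (sym_diff C D))"
      by (rule sum.swap)
    also have "\<dots> = (\<Sum>A\<in>UNIV. \<Sum>B\<in>UNIV. blade_sign A (sym_diff A D) * coef x A *
      (blade_sign B (sym_diff B (sym_diff A D)) * coef y B * coef z (sym_diff B (sym_diff A D))))"
    proof (rule sum.cong[OF refl])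
      fix A :: "'a set"
      let ?f = "\<lambda>C. blade_sign C (sym_diff C D) * (blade_sign A (sym_diff A C) * coef x A * coef y (sym_diff A C)) * coef z (sym_diff C D)"
      have "sum ?f UNIV = (\<Sum>B\<in>UNIV. ?f (sym_diff A B))"
        using sum.reindex_bij_betw[OF bij[of A], of ?f] by simp
      also have "\<dots> = (\<Sum>B\<in>UNIV. blade_sign A (sym_diff A D) * coef x A *
      (blade_sign B (sym_diff B (sym_diff A D)) * coef y B * coef z (sym_diff B (sym_diff A D))))"
      proof (rule sum.cong[OF refl])
        fix B :: "'a set"
        have 1: "sym_diff A (sym_diff A B) = B"
          "sym_diff (sym_diff A B) D = sym_diff B (sym_diff A D)" by auto
        have "blade_sign A B * blade_sign A B = 1"
          by (simp add: blade_sign_def flip: power_add mult_2)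
        then show "?f (sym_diff A B) = blade_sign A (sym_diff A D) * coef x A *
          (blade_sign B (sym_diff B (sym_diff A D)) * coef y B * coef z (sym_diff B (sym_diff A D)))"
          unfolding 1 by (simp add: blade_sign_sym_diff algebra_simps)
      qed
      finally show "sum ?f UNIV = \<dots>" .
    qed
    also have "\<dots> = coef (x * (y * z)) D"
      by (simp add: coef_mult sum_distrib_left)
    finally show "coef (x * y * z) D = coef (x * (y * z)) D" .
  qed
  show "1 * x = x"
    by (rule clifford_eqI)
      (simp add: coef_mult coef_one if_distrib[of "\<lambda>u. u * _"] if_distrib[of "\<lambda>u. _ * u"] cong: if_cong)
  show "x * 1 = x"
  proof (rule clifford_eqI)
    fix C :: "'a set"
    have *: "sym_diff A C = {} \<longleftrightarrow> A = C" for A by auto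
    show "coef (x * 1) C = coef x C"
      unfolding coef_mult coef_one *
      by (simp add: if_distrib[of "\<lambda>u. u * _"] if_distrib[of "\<lambda>u. _ * u"] cong: if_cong)
  qed
  show "(x + y) * z = x * z + y * z" "x * (y + z) = x * y + x * z"
    "r *\<^sub>R x * y = r *\<^sub>R (x * y)" "x * r *\<^sub>R y = r *\<^sub>R (x * y)"
    by (rule clifford_eqI; simp add: coef_mult sum.distrib sum_distrib_left algebra_simps)+
  show "0 \<noteq> (1 :: 'a clifford)"
    by (metis coef_one coords_linear(1) zero_index zero_neq_one)
qed

end

definition blade :: "'n::{finite,linorder} set \<Rightarrow> 'n clifford"
  where "blade A = Clifford (axis A 1)"

abbreviation gen :: "'n::{finite,linorder} \<Rightarrow> 'n clifford" where "gen j \<equiv> blade {j}"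

lemma coef_blade: "coef (blade A) B = (if B = A then 1 else 0)"
  by (auto simp: blade_def axis_def)

lemma blade_mult: "blade A * blade B = blade_sign A B *\<^sub>R blade (sym_diff A B)"
proof (rule clifford_eqI)
  fix C
  have *: "sym_diff A C = B \<longleftrightarrow> C = sym_diff A B" by auto
  have "coef (blade A * blade B) C =
      (\<Sum>X\<in>UNIV. if X = A then blade_sign A (sym_diff A C) * coef (blade B) (sym_diff A C) else 0)"
    unfolding coef_mult coef_blade[of A] by (rule sum.cong) simp_all
  also have "\<dots> = blade_sign A (sym_diff A C) * coef (blade B) (sym_diff A C)"
    by simp
  also have "\<dots> = blade_sign A B * coef (blade (sym_diff A B)) C"
    unfolding coef_blade using * by auto
  finally show "coef (blade A * blade B) C = coef (blade_sign A B *\<^sub>R blade (sym_diff A B)) C"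
    by simp
qed

lemma gen_anticommute: "gen j * gen l + gen l * gen j = (if j = l then - 2 else 0)"
proof -
  have 1: "blade {} = 1" by (rule clifford_eqI) (auto simp: blade_def axis_def coef_one)
  have s: "blade_sign {a} {b} = (if b \<le> a then -1 else 1)" for a b :: 'a
  proof -
    have "{(x, y). x \<in> {a} \<and> y \<in> {b} \<and> y \<le> x} = (if b \<le> a then {(a, b)} else {})" by auto
    then show ?thesis unfolding blade_sign_def by (simp split: if_splits)
  qed
  show ?thesis
  proof (cases "j = l")
    case True then show ?thesis by (simp add: blade_mult s 1)
  next
    case False
    have "sym_diff {j} {l} = sym_diff {l} {j}" by auto
    then show ?thesis using False by (auto simp: blade_mult s)
  qed
qed

lemma blade_insert:
  assumes "\<And>a. a \<in> A \<Longrightarrow> j < a" shows "blade (insert j A) = gen j * blade A"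
proof -
  have 1: "{(a, b). a \<in> {j} \<and> b \<in> A \<and> b \<le> a} = {}" and 2: "sym_diff {j} A = insert j A"
    using assms by force+
  show ?thesis unfolding blade_mult blade_sign_def 1 2 by simp
qed

definition cvec :: "real ^ 'n::{finite,linorder} \<Rightarrow> 'n clifford"
  where "cvec x = (\<Sum>j\<in>UNIV. (x $ j) *\<^sub>R gen j)"

text \<open>
  The surface measure of \<open>E\<close> is \<open>m\<close> times the volume of the cone
  \<open>{r \<omega> | 0 < r < 1, \<omega> \<in> E}\<close>. For \<open>m = 1\<close> this is counting measure on two points.
\<close>

definition sphere_measure :: "(real ^ 'n) measure"
  where "sphere_measure = scale_measure (of_nat CARD('n))
    (distr (restrict_space lborel (ball 0 1 - {0})) (restrict_space borel (sphere 0 1))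
      (\<lambda>x. x /\<^sub>R norm x))"

definition sphere_area :: "nat \<Rightarrow> real"
  where "sphere_area m = 2 * pi powr (m / 2) / Gamma (m / 2)"

lemma measure_sphere_measure:
  "measure (sphere_measure :: (real ^ 'n) measure) (sphere 0 1) = sphere_area CARD('n)"
proof -
  let ?M = "restrict_space lborel (ball 0 1 - {0}) :: (real ^ 'n) measure"
  let ?g = "\<lambda>x :: real ^ 'n. x /\<^sub>R norm x"
  have "?g \<in> borel_measurable ?M"
    by (rule measurable_restrict_space1) measurable
  then have meas: "?g \<in> measurable ?M (restrict_space borel (sphere 0 1))"
    by (intro measurable_restrict_space2) (auto simp: space_restrict_space)
  have S: "sphere 0 1 \<in> sets (restrict_space borel (sphere 0 (1::real)) :: (real ^ 'n) measure)"
    by (subst sets_restrict_space_iff) auto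
  have pre: "?g -` sphere 0 1 \<inter> space ?M = ball 0 1 - {0}"
    by (auto simp: space_restrict_space)
  have "emeasure ?M (ball 0 1 - {0}) = emeasure lborel (ball (0::real ^ 'n) 1 - {0})"
    by (subst emeasure_restrict_space) auto
  also have "\<dots> = emeasure lborel (ball (0::real ^ 'n) 1)"
    by (subst emeasure_Diff) auto
  also have "\<dots> = ennreal (unit_ball_vol CARD('n))"
    by (simp add: emeasure_ball)
  finally have "emeasure (sphere_measure :: (real ^ 'n) measure) (sphere 0 1) =
      of_nat CARD('n) * ennreal (unit_ball_vol CARD('n))"
    unfolding sphere_measure_def emeasure_scale_measure emeasure_distr[OF meas S] pre by simp
  also have "\<dots> = ennreal (CARD('n) * unit_ball_vol CARD('n))"
    by (simp add: ennreal_mult ennreal_of_nat_eq_real_of_nat)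
  finally have "measure (sphere_measure :: (real ^ 'n) measure) (sphere 0 1) =
      CARD('n) * unit_ball_vol CARD('n)"
    by (simp add: measure_def)
  also have "\<dots> = sphere_area CARD('n)"
  proof -
    have "real CARD('n) / 2 > 0" by simp
    then have "real CARD('n) / 2 \<notin> \<int>\<^sub>\<le>\<^sub>0" by (meson nonpos_Ints_nonpos not_le)
    from Gamma_plus1[OF this] show ?thesis
      unfolding unit_ball_vol_def sphere_area_def by (simp only:) simp
  qed
  finally show ?thesis .
qed

text \<open>
  Local expansion in the coordinates; the multi-indices are the \<open>\<alpha> \<in> Basis \<rightarrow>\<^sub>E UNIV\<close>.
\<close>

definition real_analytic_on ::
    "('a::euclidean_space \<Rightarrow> 'b::real_normed_vector) \<Rightarrow> 'a set \<Rightarrow> bool"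
  where "real_analytic_on F S \<longleftrightarrow> (\<forall>p\<in>S. \<exists>r>0. \<exists>c :: ('a \<Rightarrow> nat) \<Rightarrow> 'b. \<forall>x\<in>ball p r.
    ((\<lambda>\<alpha>. (\<Prod>b\<in>Basis. ((x - p) \<bullet> b) ^ \<alpha> b) *\<^sub>R c \<alpha>) has_sum F x) (Basis \<rightarrow>\<^sub>E UNIV))"

text \<open>
  The Clifford-valued functions \<open>\<Sum>\<^sub>A f\<^sub>A e\<^sub>A\<close> with real-analytic \<open>f\<^sub>A\<close>. Functions on \<open>\<Omega>\<^sub>1\<close> are
  represented by total functions that vanish outside \<open>\<Omega>\<^sub>1\<close>.
\<close>

definition analytic_tensor :: "real set \<Rightarrow> (real \<Rightarrow> 'n::{finite,linorder} clifford) set"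
  where "analytic_tensor \<Omega>\<^sub>1 =
    {f. (\<forall>A. real_analytic_on (\<lambda>t. coef (f t) A) \<Omega>\<^sub>1) \<and> (\<forall>t. t \<notin> \<Omega>\<^sub>1 \<longrightarrow> f t = 0)}"

definition nth_vderiv :: "nat \<Rightarrow> (real \<Rightarrow> 'b::real_normed_vector) \<Rightarrow> real \<Rightarrow> 'b"
  where "nth_vderiv j f = ((\<lambda>g t. vector_derivative g (at t)) ^^ j) f"

text \<open>A paravector \<open>x\<^sub>0 + x\<close> is the pair \<open>(x\<^sub>0, x)\<close>.\<close>

type_synonym 'n pvec = "real \<times> (real ^ 'n)"

definition axial_slice_nbhd :: "real set \<Rightarrow> 'n::finite pvec set \<Rightarrow> bool"
  where "axial_slice_nbhd \<Omega>\<^sub>1 \<Omega> \<longleftrightarrow> (\<exists>\<Omega>\<^sub>2 :: complex set.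
    open \<Omega>\<^sub>2 \<and> connected \<Omega>\<^sub>2 \<and> (\<forall>z\<in>\<Omega>\<^sub>2. cnj z \<in> \<Omega>\<^sub>2) \<and>
    (\<forall>t. complex_of_real t \<in> \<Omega>\<^sub>2 \<longleftrightarrow> t \<in> \<Omega>\<^sub>1) \<and>
    \<Omega> = {(u, v *\<^sub>R \<omega>) | u v \<omega>. Complex u v \<in> \<Omega>\<^sub>2 \<and> \<omega> \<in> sphere 0 1})"

text \<open>
  Each restriction to a slice is required to be real differentiable, not merely to have partial
  derivatives.
\<close>

definition slice_monogenic ::
    "'n::{finite,linorder} pvec set \<Rightarrow> ('n pvec \<Rightarrow> 'n clifford) \<Rightarrow> bool"
  where "slice_monogenic \<Omega> f \<longleftrightarrow> (\<forall>\<omega>\<in>sphere 0 1. \<forall>u v. (u, v *\<^sub>R \<omega>) \<in> \<Omega> \<longrightarrow>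
    (let f\<^sub>\<omega> = \<lambda>(s, t). f (s, t *\<^sub>R \<omega>) in
      f\<^sub>\<omega> differentiable (at (u, v)) \<and>
      frechet_derivative f\<^sub>\<omega> (at (u, v)) (1, 0)
        + cvec \<omega> * frechet_derivative f\<^sub>\<omega> (at (u, v)) (0, 1) = 0))"

text \<open>
  \<open>A\<close> and \<open>B\<close> are Clifford-valued. At \<open>x = 0\<close> the quotient \<open>x / |x|\<close> evaluates to \<open>0\<close>, which is
  harmless because \<open>B\<close> vanishes there.
\<close>

definition axially_monogenic ::
    "'n::{finite,linorder} pvec set \<Rightarrow> ('n pvec \<Rightarrow> 'n clifford) \<Rightarrow> bool"
  where "axially_monogenic \<Omega> F \<longleftrightarrow>
    real_analytic_on F \<Omega> \<and>
    (\<forall>p\<in>\<Omega>. frechet_derivative F (at p) (1, 0)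
      + (\<Sum>j\<in>UNIV. gen j * frechet_derivative F (at p) (0, axis j 1)) = 0) \<and>
    (\<exists>A B :: real \<Rightarrow> real \<Rightarrow> 'n clifford.
      (\<forall>u v. A u (- v) = A u v \<and> B u (- v) = - B u v) \<and>
      (\<forall>(x\<^sub>0, x)\<in>\<Omega>. F (x\<^sub>0, x) = A x\<^sub>0 (norm x) + cvec (x /\<^sub>R norm x) * B x\<^sub>0 (norm x)))"

definition near :: "real set \<Rightarrow> ('n::finite pvec \<Rightarrow> bool) \<Rightarrow> bool"
  where "near \<Omega>\<^sub>1 P \<longleftrightarrow> (\<exists>U. open U \<and> (\<forall>t\<in>\<Omega>\<^sub>1. (t, 0) \<in> U) \<and> (\<forall>p\<in>U. P p))"

definition germ :: "real set \<Rightarrow> ('n::finite pvec \<Rightarrow> 'b) \<Rightarrow> ('n pvec \<Rightarrow> 'b) set"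
  where "germ \<Omega>\<^sub>1 F = {G. near \<Omega>\<^sub>1 (\<lambda>p. G p = F p)}"

text \<open>
  Right modules over the ring given by the type \<open>'c\<close>. The \<open>monoid\<close> part of the record is the
  additive group, so its \<open>mult\<close> and \<open>one\<close> are addition and zero.
\<close>

record ('a, 'c) rmodule = "'a monoid" +
  act :: "'a \<Rightarrow> 'c \<Rightarrow> 'a"

definition right_module :: "('a, 'c::ring_1) rmodule \<Rightarrow> bool"
  where "right_module M \<longleftrightarrow> comm_group M \<and>
    (\<forall>x\<in>carrier M. \<forall>c. act M x c \<in> carrier M) \<and>
    (\<forall>x\<in>carrier M. \<forall>y\<in>carrier M. \<forall>c. act M (x \<otimes>\<^bsub>M\<^esub> y) c = act M x c \<otimes>\<^bsub>M\<^esub> act M y c) \<and>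
    (\<forall>x\<in>carrier M. \<forall>c d. act M x (c + d) = act M x c \<otimes>\<^bsub>M\<^esub> act M x d) \<and>
    (\<forall>x\<in>carrier M. \<forall>c d. act M x (c * d) = act M (act M x c) d) \<and>
    (\<forall>x\<in>carrier M. act M x 1 = x)"

definition right_module_iso ::
    "('a, 'c::ring_1) rmodule \<Rightarrow> ('b, 'c) rmodule \<Rightarrow> ('a \<Rightarrow> 'b) \<Rightarrow> bool"
  where "right_module_iso M N h \<longleftrightarrow> right_module M \<and> right_module N \<and> h \<in> iso M N \<and>
    (\<forall>x\<in>carrier M. \<forall>c. h (act M x c) = act N (h x) c)"

definition analytic_module ::
    "real set \<Rightarrow> (real \<Rightarrow> 'n::{finite,linorder} clifford, 'n clifford) rmodule"
  where "analytic_module \<Omega>\<^sub>1 = \<lparr>carrier = analytic_tensor \<Omega>\<^sub>1,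
    mult = (\<lambda>f g t. f t + g t), one = (\<lambda>t. 0), act = (\<lambda>f c t. f t * c)\<rparr>"

text \<open>
  A germ is an equivalence class, and an operation on germs is applied to representatives. The
  unions below only collect results that coincide for all representatives.
\<close>

definition germ_module ::
    "real set \<Rightarrow> ('n pvec \<Rightarrow> 'n clifford) set set \<Rightarrow>
      (('n::{finite,linorder} pvec \<Rightarrow> 'n clifford) set, 'n clifford) rmodule"
  where "germ_module \<Omega>\<^sub>1 X = \<lparr>carrier = X,
    mult = (\<lambda>\<phi> \<psi>. \<Union>f\<in>\<phi>. \<Union>g\<in>\<psi>. germ \<Omega>\<^sub>1 (\<lambda>p. f p + g p)),
    one = germ \<Omega>\<^sub>1 (\<lambda>p. 0),
    act = (\<lambda>\<phi> c. \<Union>f\<in>\<phi>. germ \<Omega>\<^sub>1 (\<lambda>p. f p * c))\<rparr>"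

definition SM :: "real set \<Rightarrow> (('n::{finite,linorder} pvec \<Rightarrow> 'n clifford) set, 'n clifford) rmodule"
  where "SM \<Omega>\<^sub>1 = germ_module \<Omega>\<^sub>1
    {germ \<Omega>\<^sub>1 f | \<Omega> f. axial_slice_nbhd \<Omega>\<^sub>1 \<Omega> \<and> slice_monogenic \<Omega> f}"

definition AM :: "real set \<Rightarrow> (('n::{finite,linorder} pvec \<Rightarrow> 'n clifford) set, 'n clifford) rmodule"
  where "AM \<Omega>\<^sub>1 = germ_module \<Omega>\<^sub>1
    {germ \<Omega>\<^sub>1 F | \<Omega> F. axial_slice_nbhd \<Omega>\<^sub>1 \<Omega> \<and> axially_monogenic \<Omega> F}"

definition slice_term ::
    "(real \<Rightarrow> 'n::{finite,linorder} clifford) \<Rightarrow> 'n pvec \<Rightarrow> nat \<Rightarrow> 'n clifford"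
  where "slice_term f\<^sub>0 = (\<lambda>(x\<^sub>0, x) j. (cvec x ^ j /\<^sub>R fact j) * nth_vderiv j f\<^sub>0 x\<^sub>0)"

definition slice_ext ::
    "(real \<Rightarrow> 'n::{finite,linorder} clifford) \<Rightarrow> 'n pvec \<Rightarrow> 'n clifford"
  where "slice_ext f\<^sub>0 p = (\<Sum>j. slice_term f\<^sub>0 p j)"

definition S_map ::
    "real set \<Rightarrow> (real \<Rightarrow> 'n::{finite,linorder} clifford) \<Rightarrow> ('n pvec \<Rightarrow> 'n clifford) set"
  where "S_map \<Omega>\<^sub>1 f\<^sub>0 = germ \<Omega>\<^sub>1 (slice_ext f\<^sub>0)"

definition exp_op ::
    "real ^ ('n::{finite,linorder}) \<Rightarrow> real ^ ('n::{finite,linorder}) \<Rightarrow>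
      (real \<Rightarrow> 'n clifford) \<Rightarrow> real \<Rightarrow> 'n clifford"
  where "exp_op \<omega> x f\<^sub>0 x\<^sub>0 =
    (\<Sum>j. (((\<omega> \<bullet> x) ^ j / fact j) *\<^sub>R cvec \<omega> ^ j) * nth_vderiv j f\<^sub>0 x\<^sub>0)"

definition is_GCK ::
    "real set \<Rightarrow> (real \<Rightarrow> 'n::{finite,linorder} clifford) \<Rightarrow> ('n pvec \<Rightarrow> 'n clifford) \<Rightarrow> bool"
  where "is_GCK \<Omega>\<^sub>1 f\<^sub>0 F \<longleftrightarrow>
    (\<exists>\<Omega>. axial_slice_nbhd \<Omega>\<^sub>1 \<Omega> \<and> axially_monogenic \<Omega> F) \<and>
    (\<exists>f. (\<forall>j. f j \<in> analytic_tensor \<Omega>\<^sub>1) \<and>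
      near \<Omega>\<^sub>1 (\<lambda>(x\<^sub>0, x). (\<lambda>j. cvec x ^ j * f j x\<^sub>0) sums F (x\<^sub>0, x))) \<and>
    (\<forall>t\<in>\<Omega>\<^sub>1. F (t, 0) = f\<^sub>0 t)"

text \<open>
  The generalized Cauchy-Kovalevskaya extension is unique as a germ; two extensions may differ far
  from \<open>\<Omega>\<^sub>1\<close>.
\<close>

definition GCK ::
    "real set \<Rightarrow> (real \<Rightarrow> 'n::{finite,linorder} clifford) \<Rightarrow> ('n pvec \<Rightarrow> 'n clifford) set"
  where "GCK \<Omega>\<^sub>1 f\<^sub>0 = (THE \<phi>. \<exists>F. is_GCK \<Omega>\<^sub>1 f\<^sub>0 F \<and> \<phi> = germ \<Omega>\<^sub>1 F)"

definition dual_radon ::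
    "('n pvec \<Rightarrow> 'n clifford) \<Rightarrow> 'n::{finite,linorder} pvec \<Rightarrow> 'n clifford"
  where "dual_radon f = (\<lambda>(x\<^sub>0, x).
    (1 / sphere_area CARD('n)) *\<^sub>R (\<integral>\<omega>. f (x\<^sub>0, (x \<bullet> \<omega>) *\<^sub>R \<omega>) \<partial>sphere_measure))"

definition R_map ::
    "real set \<Rightarrow> ('n pvec \<Rightarrow> 'n clifford) set \<Rightarrow> ('n::{finite,linorder} pvec \<Rightarrow> 'n clifford) set"
  where "R_map \<Omega>\<^sub>1 \<phi> = (\<Union>f\<in>\<phi>. germ \<Omega>\<^sub>1 (dual_radon f))"

end

theory Submission
  imports Defs "HOL-Complex_Analysis.Complex_Analysis"
begin

text \<open>
  A slice monogenic function is a family of holomorphic functions, one on each complex plane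
  \<open>\<real> + \<real>\<omega>\<close> with \<open>\<omega>\<close> a unit vector, and plane waves over these planes are monogenic; averaging over
  \<open>\<omega>\<close> keeps monogenicity and produces axial symmetry. The generalized Cauchy-Kovalevskaya extension and
  the slice extension are then both inverse to the restriction to the real axis.

  Since \<open>\<omega>\<^sup>2 = - 1\<close>, the map \<open>a + \<i> b \<mapsto> a + b \<omega>\<close> embeds the complex numbers into the Clifford algebra
  (\<open>cplx\<close>). If the coordinates of \<open>f\<^sub>0\<close> extend holomorphically to \<open>H\<^sub>A\<close> near a real point, the series of
  the slice extension at \<open>u + v \<omega>\<close> is the Taylor series of \<open>\<Sum>\<^sub>A H\<^sub>A e\<^sub>A\<close> at \<open>u + \<i> v\<close>, transported by this
  embedding (\<open>slice_term_sums\<close>), so it converges and satisfies the Cauchy-Riemann equations in every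
  plane. Conversely, the coordinates of a slice monogenic function on a slice are real parts of
  holomorphic functions (\<open>slice_monogenic_components_holomorphic\<close>). Hence its restriction to the real
  axis is real analytic, and by the identity theorem it determines the function near the axis.

  For fixed \<open>\<omega>\<close> the function \<open>x\<^sub>0 + x \<mapsto> f (x\<^sub>0 + \<langle>x, \<omega>\<rangle> \<omega>)\<close> is monogenic, because its Dirac derivative is
  \<open>(\<partial>\<^sub>u + \<omega> \<partial>\<^sub>v) f\<close>. Expansion into a power series and differentiation under the integral sign are
  justified by Cauchy's estimates, which are uniform in \<open>\<omega>\<close> (\<open>ridge_integral\<close>,
  \<open>plane_wave_average_monogenic\<close>). By rotation invariance the average of \<open>\<langle>x, \<omega>\<rangle>\<^sup>j \<omega>\<^sup>j\<close> is a multiple of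
  \<open>x\<^sup>j\<close> (\<open>average_plane_wave_power\<close>). Thus the average is a series \<open>\<Sum>\<^sub>j x\<^sup>j f\<^sub>j(x\<^sub>0)\<close>
  (\<open>dual_radon_series\<close>), from which the axial form can be read off, and on the real axis it equals \<open>f\<^sub>0\<close>.

  An axially monogenic function vanishing on the real axis vanishes near it: along one coordinate
  direction the Dirac equation becomes a Vekua system in two real variables, and this is a recursion
  that determines all Taylor coefficients from those on the axis (\<open>axially_monogenic_zero_near_axis\<close>).
  Therefore the average of the slice extension is the only candidate for the generalized
  Cauchy-Kovalevskaya extension (\<open>GCK_eq\<close>). Existence, uniqueness and analyticity of the restriction
  make both extensions isomorphisms (\<open>germ_extension_iso\<close>), and the dual Radon transform is the
  inverse of the slice extension followed by the generalized Cauchy-Kovalevskaya extension.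
\<close>

section \<open>Rotation invariance of the surface measure\<close>

text \<open>
  For two translation invariant measures, Fubini's theorem gives
  \<open>\<lambda>(A) \<mu>(B) = \<integral>\<integral> 1\<^sub>A(x + y) 1\<^sub>B(y) = \<integral>\<integral> 1\<^sub>A(y) 1\<^sub>B(y - x) = \<lambda>(B) \<mu>(A)\<close> for the unit ball \<open>B = - B\<close>,
  and agreement on balls does the rest.
\<close>
lemma translation_invariant_eq_lborel:
  fixes M :: "'a::euclidean_space measure"
  assumes [measurable_cong, simp]: "sets M = sets borel"
    and shift: "\<And>a. distr M borel (\<lambda>x. x + a) = M"
    and balls: "\<And>r. emeasure M (ball 0 r) = emeasure lborel (ball (0::'a) r)"
  shows "M = lborel"
proof (rule measure_eqI)
  fix A assume "A \<in> sets M"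
  then have A [measurable]: "A \<in> sets borel" by simp
  interpret M: sigma_finite_measure M
  proof (intro sigma_finite_measure.intro exI conjI)
    show "countable (range (\<lambda>n::nat. ball (0::'a) (real n)))" by simp
    show "range (\<lambda>n::nat. ball (0::'a) (real n)) \<subseteq> sets M" by auto
    show "\<Union> (range (\<lambda>n::nat. ball (0::'a) (real n))) = space M"
      using reals_Archimedean2 sets_eq_imp_space_eq[OF assms(1)] by auto
    show "\<forall>a\<in>range (\<lambda>n::nat. ball (0::'a) (real n)). emeasure M a \<noteq> \<infinity>"
      by (auto simp: balls emeasure_ball)
  qed
  interpret pair_sigma_finite lborel M ..
  define B where "B = ball (0::'a) 1"
  have [measurable]: "B \<in> sets borel" by (simp add: B_def)
  have B: "(\<integral>\<^sup>+x. indicator B (y - x) \<partial>lborel) = emeasure lborel B" for y :: 'a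
  proof -
    have "(\<integral>\<^sup>+x. indicator B (y - x) \<partial>lborel) = (\<integral>\<^sup>+x. indicator (ball y 1) x \<partial>lborel)"
      by (intro nn_integral_cong) (auto simp: indicator_def B_def dist_norm norm_minus_commute)
    then show ?thesis by (simp add: B_def emeasure_ball)
  qed
  have "emeasure lborel A * emeasure M B = (\<integral>\<^sup>+y. emeasure lborel A * indicator B y \<partial>M)"
    by (subst nn_integral_cmult_indicator) auto
  also have "\<dots> = (\<integral>\<^sup>+y. (\<integral>\<^sup>+x. indicator A (x + y) * indicator B y \<partial>lborel) \<partial>M)"
  proof (rule nn_integral_cong)
    fix y :: 'a
    have "emeasure lborel A = emeasure (distr lborel borel (\<lambda>x. y + x)) A"
      by (simp add: lborel_distr_plus)
    also have "\<dots> = (\<integral>\<^sup>+x. indicator A x \<partial>distr lborel borel (\<lambda>x. y + x))"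
      by simp
    also have "\<dots> = (\<integral>\<^sup>+x. indicator A (x + y) \<partial>lborel)"
      by (subst nn_integral_distr) (auto simp: add.commute)
    finally show "emeasure lborel A * indicator B y = (\<integral>\<^sup>+x. indicator A (x + y) * indicator B y \<partial>lborel)"
      by (subst nn_integral_multc) auto
  qed
  also have "\<dots> = (\<integral>\<^sup>+x. (\<integral>\<^sup>+y. indicator A (x + y) * indicator B y \<partial>M) \<partial>lborel)"
    by (rule Fubini') measurable
  also have "\<dots> = (\<integral>\<^sup>+x. (\<integral>\<^sup>+y. indicator A y * indicator B (y - x) \<partial>M) \<partial>lborel)"
  proof (rule nn_integral_cong)
    fix x :: 'a
    have "(\<integral>\<^sup>+y. indicator A y * indicator B (y - x) \<partial>M) = (\<integral>\<^sup>+y. indicator A y * indicator B (y - x) \<partial>distr M borel (\<lambda>y. y + x))"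
      by (simp add: shift)
    also have "\<dots> = (\<integral>\<^sup>+y. indicator A (x + y) * indicator B y \<partial>M)"
      by (subst nn_integral_distr) (auto simp: add.commute)
    finally show "(\<integral>\<^sup>+y. indicator A (x + y) * indicator B y \<partial>M) =
      (\<integral>\<^sup>+y. indicator A y * indicator B (y - x) \<partial>M)" ..
  qed
  also have "\<dots> = (\<integral>\<^sup>+y. (\<integral>\<^sup>+x. indicator A y * indicator B (y - x) \<partial>lborel) \<partial>M)"
    by (rule Fubini'[symmetric]) measurable
  also have "\<dots> = (\<integral>\<^sup>+y. emeasure lborel B * indicator A y \<partial>M)"
    by (intro nn_integral_cong, subst nn_integral_cmult) (auto simp: B mult.commute)
  also have "\<dots> = emeasure lborel B * emeasure M A"
    by (subst nn_integral_cmult_indicator) auto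
  finally have "emeasure lborel B * emeasure lborel A = emeasure lborel B * emeasure M A"
    by (simp add: B_def balls mult.commute)
  then show "emeasure M A = emeasure lborel A"
    using less_imp_neq[OF unit_ball_vol_pos[of "real DIM('a)"]]
    by (subst (asm) ennreal_mult_cancel_left) (auto simp: B_def emeasure_ball)
qed simp

text \<open>
  The image of Lebesgue measure is again translation invariant, since \<open>T x + T b = T (x + b)\<close> and \<open>T\<close> is
  onto, and orthogonal maps preserve balls.
\<close>
lemma distr_lborel_orthogonal:
  fixes T :: "'a::euclidean_space \<Rightarrow> 'a"
  assumes T: "orthogonal_transformation T"
  shows "distr lborel borel T = lborel"
proof (rule translation_invariant_eq_lborel)
  have lin: "linear T" using T by (simp add: orthogonal_transformation_linear)
  have meas [measurable]: "T \<in> borel_measurable borel"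
    using lin by (intro borel_measurable_continuous_onI linear_continuous_on) (simp add: linear_linear)
  show "distr (distr lborel borel T) borel (\<lambda>x. x + a) = distr lborel borel T" for a
  proof -
    obtain b where b: "a = T b"
      using orthogonal_transformation_surj[OF T] by blast
    have "distr (distr lborel borel T) borel (\<lambda>x. x + a) = distr lborel borel (\<lambda>x. T (b + x))"
      by (subst distr_distr) (auto simp: b o_def linear_add[OF lin] add.commute)
    also have "\<dots> = distr (distr lborel borel ((+) b)) borel T"
      by (subst distr_distr) (auto simp: o_def)
    finally show ?thesis by (simp add: lborel_distr_plus)
  qed
  show "emeasure (distr lborel borel T) (ball 0 r) = emeasure lborel (ball (0::'a) r)" for r
    proof -
    have "T -` ball 0 r = ball 0 r" by (auto simp: orthogonal_transformation_norm[OF T])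
    then show ?thesis by (subst emeasure_distr) auto
  qed
qed simp

lemma sphere_measure_projection [measurable]:
  "(\<lambda>x :: real ^ 'n. x /\<^sub>R norm x) \<in> measurable (restrict_space lborel (ball 0 1 - {0}))
     (restrict_space borel (sphere 0 1))"
  by (intro measurable_restrict_space2 measurable_restrict_space1)
    (auto simp: space_restrict_space)

lemma space_sphere_measure [simp]: "space (sphere_measure :: (real ^ 'n) measure) = sphere 0 1"
  by (simp add: sphere_measure_def space_scale_measure space_restrict_space)

lemma sets_sphere_measure [measurable_cong]:
  "sets (sphere_measure :: (real ^ 'n) measure) = sets (restrict_space borel (sphere 0 1))"
  by (simp add: sphere_measure_def)

lemma emeasure_sphere_measure:
  assumes "E \<in> sets (sphere_measure :: (real ^ 'n) measure)"
  shows "emeasure sphere_measure E =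
    of_nat CARD('n) * emeasure lborel {x :: real ^ 'n. x \<in> ball 0 1 - {0} \<and> x /\<^sub>R norm x \<in> E}"
proof -
  have "emeasure sphere_measure E = of_nat CARD('n) *
    emeasure (restrict_space lborel (ball 0 1 - {0})) ((\<lambda>x. x /\<^sub>R norm x) -` E \<inter>
      space (restrict_space lborel (ball 0 1 - {0})))"
    unfolding sphere_measure_def emeasure_scale_measure using assms
    by (subst emeasure_distr[OF sphere_measure_projection]) (auto simp: sphere_measure_def)
  also have "\<dots> = of_nat CARD('n) * emeasure lborel ((\<lambda>x. x /\<^sub>R norm x) -` E \<inter> (ball 0 1 - {0}))"
    by (subst emeasure_restrict_space) (auto simp: space_restrict_space)
  also have "(\<lambda>x. x /\<^sub>R norm x) -` E \<inter> (ball 0 1 - {0}) =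
      {x :: real ^ 'n. x \<in> ball 0 1 - {0} \<and> x /\<^sub>R norm x \<in> E}"
    by auto
  finally show ?thesis .
qed

interpretation sphere: finite_measure "sphere_measure :: (real ^ 'n) measure"
proof
  have "{x :: real ^ 'n. x \<in> ball 0 1 - {0} \<and> x /\<^sub>R norm x \<in> sphere 0 1} \<subseteq> ball 0 1" by auto
  then have "emeasure lborel {x :: real ^ 'n. x \<in> ball 0 1 - {0} \<and> x /\<^sub>R norm x \<in> sphere 0 1}
    \<le> emeasure lborel (ball (0 :: real ^ 'n) 1)"
    by (intro emeasure_mono) auto
  also have "\<dots> < \<infinity>" by (simp add: emeasure_ball)
  finally have "of_nat CARD('n) *
      emeasure lborel {x :: real ^ 'n. x \<in> ball 0 1 - {0} \<and> x /\<^sub>R norm x \<in> sphere 0 1} < \<infinity>"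
    by (auto intro!: ennreal_mult_less_top[THEN iffD2] simp: of_nat_less_top simp del: mem_ball_0)
  moreover have "sphere 0 1 \<in> sets (sphere_measure :: (real ^ 'n) measure)"
    using sets.top[of "sphere_measure :: (real ^ 'n) measure"] by simp
  ultimately show "emeasure sphere_measure (space (sphere_measure :: (real ^ 'n) measure)) \<noteq> \<infinity>"
    by (simp add: emeasure_sphere_measure)
qed

lemma measurable_orthogonal_sphere:
  fixes T :: "real ^ 'n \<Rightarrow> real ^ 'n"
  assumes T: "orthogonal_transformation T"
  shows "T \<in> measurable sphere_measure sphere_measure"
proof -
  have "T \<in> borel_measurable borel"
    using orthogonal_transformation_linear[OF T]
    by (intro borel_measurable_continuous_onI linear_continuous_on) (simp add: linear_linear)
  then have "T \<in> measurable (restrict_space borel (sphere 0 1)) (restrict_space borel (sphere 0 1))"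
    by (intro measurable_restrict_space2 measurable_restrict_space1)
      (auto simp: space_restrict_space orthogonal_transformation_norm[OF T])
  then show ?thesis by (simp add: measurable_cong_sets[OF sets_sphere_measure sets_sphere_measure])
qed

lemma distr_sphere_measure_orthogonal:
  fixes T :: "real ^ 'n \<Rightarrow> real ^ 'n"
  assumes T: "orthogonal_transformation T"
  shows "distr sphere_measure sphere_measure T = sphere_measure"
proof (rule measure_eqI)
  note meas = measurable_orthogonal_sphere[OF T]
  have lin: "linear T" and norm: "norm (T x) = norm x" for x
    using T by (simp_all add: orthogonal_transformation_linear orthogonal_transformation_norm)
  have T_eq_0: "T x = 0 \<longleftrightarrow> x = 0" for x
    by (metis norm norm_eq_zero)
  have [measurable]: "T \<in> borel_measurable borel"
    using lin by (intro borel_measurable_continuous_onI linear_continuous_on) (simp add: linear_linear)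
  fix E assume "E \<in> sets (distr sphere_measure sphere_measure T)"
  then have E [measurable]: "E \<in> sets (sphere_measure :: (real ^ 'n) measure)" by simp
  then have "E \<in> sets borel"
    by (simp add: sets_sphere_measure sets_restrict_space_iff)
  then have cone: "{x. x \<in> ball 0 1 - {0} \<and> x /\<^sub>R norm x \<in> E} \<in> sets borel"
    by measurable
  have "emeasure (distr sphere_measure sphere_measure T) E = of_nat CARD('n) *
      emeasure lborel {x. x \<in> ball 0 1 - {0} \<and> x /\<^sub>R norm x \<in> T -` E \<inter> sphere 0 1}"
    unfolding emeasure_distr[OF meas E] emeasure_sphere_measure[OF measurable_sets[OF meas E]] by simp
  also have "{x. x \<in> ball 0 1 - {0} \<and> x /\<^sub>R norm x \<in> T -` E \<inter> sphere 0 1} =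
      T -` {x. x \<in> ball 0 1 - {0} \<and> x /\<^sub>R norm x \<in> E} \<inter> space lborel"
    by (auto simp: linear_cmul[OF lin] norm linear_0[OF lin] T_eq_0)
  also have "emeasure lborel \<dots> =
      emeasure (distr lborel borel T) {x. x \<in> ball 0 1 - {0} \<and> x /\<^sub>R norm x \<in> E}"
    by (subst emeasure_distr[OF _ cone]) simp_all
  finally show "emeasure (distr sphere_measure sphere_measure T) E = emeasure sphere_measure E"
    using E by (simp add: emeasure_sphere_measure distr_lborel_orthogonal[OF T])
qed simp

lemma integrable_sphere_continuous:
  fixes g :: "real ^ 'n \<Rightarrow> 'b::euclidean_space"
  assumes "continuous_on (sphere 0 1) g"
  shows "integrable sphere_measure g"
proof -
  have "bounded (g ` sphere 0 1)"
    using assms compact_continuous_image compact_imp_bounded compact_sphere by blast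
  then obtain B where "\<And>x. x \<in> sphere 0 1 \<Longrightarrow> norm (g x) \<le> B"
    unfolding bounded_iff by blast
  moreover have "g \<in> borel_measurable sphere_measure"
    using borel_measurable_continuous_on_restrict[OF assms]
    by (simp add: measurable_cong_sets[OF sets_sphere_measure refl])
  ultimately show ?thesis
    by (intro sphere.integrable_const_bound[of _ B]) auto
qed

lemma integral_sphere_orthogonal:
  fixes g :: "real ^ 'n \<Rightarrow> 'b::euclidean_space" and T :: "real ^ 'n \<Rightarrow> real ^ 'n"
  assumes T: "orthogonal_transformation T" and g: "continuous_on (sphere 0 1) g"
  shows "(\<integral>\<omega>. g (T \<omega>) \<partial>sphere_measure) = (\<integral>\<omega>. g \<omega> \<partial>sphere_measure)"
proof -
  have "g \<in> borel_measurable sphere_measure"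
    using integrable_sphere_continuous[OF g] by simp
  then have "(\<integral>\<omega>. g (T \<omega>) \<partial>sphere_measure) = (\<integral>\<omega>. g \<omega> \<partial>distr sphere_measure sphere_measure T)"
    using measurable_orthogonal_sphere[OF T] by (simp add: integral_distr)
  then show ?thesis by (simp add: distr_sphere_measure_orthogonal[OF T])
qed

section \<open>The complex planes inside the Clifford algebra\<close>

lemma cvec_add: "cvec (x + y) = cvec x + cvec y"
  by (simp add: cvec_def scaleR_left_distrib sum.distrib)

lemma cvec_scaleR: "cvec (r *\<^sub>R x) = r *\<^sub>R cvec x"
  by (simp add: cvec_def scaleR_sum_right)

lemma cvec_zero [simp]: "cvec 0 = 0"
  by (simp add: cvec_def)

lemma cvec_axis: "cvec (axis j 1) = gen j"
proof -
  have "cvec (axis j 1) = (\<Sum>i\<in>UNIV. if i = j then gen i else 0)"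
    unfolding cvec_def by (rule sum.cong) (auto simp: axis_def)
  then show ?thesis by simp
qed

lemma bounded_linear_cvec: "bounded_linear cvec"
  by (rule linear_conv_bounded_linear[THEN iffD1]) (simp add: linear_iff cvec_add cvec_scaleR)

text \<open>
  The products with \<open>j \<noteq> l\<close> cancel in pairs, so twice the double sum is computed by the anticommutation
  relation.
\<close>
lemma cvec_square: "cvec x * cvec x = - ((norm x)\<^sup>2 *\<^sub>R 1)"
proof -
  let ?S = "\<Sum>j\<in>UNIV. \<Sum>l\<in>UNIV. (x $ j * x $ l) *\<^sub>R (gen j * gen l)"
  have S: "cvec x * cvec x = ?S"
    by (simp add: cvec_def sum_product scaleR_scaleR mult.commute)
  have "?S + ?S = ?S + (\<Sum>l\<in>UNIV. \<Sum>j\<in>UNIV. (x $ j * x $ l) *\<^sub>R (gen j * gen l))"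
    by (subst (2) sum.swap) (rule refl)
  also have "\<dots> = (\<Sum>j\<in>UNIV. \<Sum>l\<in>UNIV. (x $ j * x $ l) *\<^sub>R (gen j * gen l + gen l * gen j))"
    by (simp add: sum.distrib scaleR_right_distrib mult.commute)
  also have "\<dots> = (\<Sum>j\<in>UNIV. (- 2 * (x $ j * x $ j)) *\<^sub>R 1)"
  proof (rule sum.cong[OF refl])
    fix j
    have "(\<Sum>l\<in>UNIV. (x $ j * x $ l) *\<^sub>R (gen j * gen l + gen l * gen j)) =
      (\<Sum>l\<in>UNIV. if j = l then (- 2 * (x $ j * x $ j)) *\<^sub>R 1 else 0)"
      by (rule sum.cong[OF refl]) (auto simp: gen_anticommute scaleR_conv_of_real mult_ac)
    then show "(\<Sum>l\<in>UNIV. (x $ j * x $ l) *\<^sub>R (gen j * gen l + gen l * gen j)) =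
      (- 2 * (x $ j * x $ j)) *\<^sub>R 1" by simp
  qed
  also have "\<dots> = (- 2 * (norm x)\<^sup>2) *\<^sub>R 1"
    by (simp add: scaleR_sum_left[symmetric] sum_distrib_left power2_norm_eq_inner inner_vec_def sum_negf
        del: scaleR_minus_left)
  finally have "2 *\<^sub>R ?S = 2 *\<^sub>R (- ((norm x)\<^sup>2 *\<^sub>R (1 :: 'a clifford)))"
    by (simp add: scaleR_2)
  then show ?thesis unfolding S by (simp only: scaleR_cancel_left) simp
qed

lemma bounded_bilinear_clifford_mult: "bounded_bilinear ((*) :: 'n::{finite,linorder} clifford \<Rightarrow> _)"
  by (intro bilinear_conv_bounded_bilinear[THEN iffD1])
    (auto simp: bilinear_def linear_iff algebra_simps)

lemma bounded_linear_clifford_mult_left: "bounded_linear (\<lambda>x. x * (c :: 'n::{finite,linorder} clifford))"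
  and bounded_linear_clifford_mult_right: "bounded_linear (\<lambda>x. c * (x :: 'n::{finite,linorder} clifford))"
  using bounded_bilinear.bounded_linear_left[OF bounded_bilinear_clifford_mult]
    bounded_bilinear.bounded_linear_right[OF bounded_bilinear_clifford_mult] by blast+

lemma linear_coef: "linear (\<lambda>x. coef x A)"
  by (simp add: linear_iff)

lemma bounded_linear_coef: "bounded_linear (\<lambda>x. coef x A)"
  by (rule linear_conv_bounded_linear[THEN iffD1, OF linear_coef])

lemma clifford_expansion: "x = (\<Sum>A\<in>UNIV. coef x A *\<^sub>R blade A)"
proof (rule clifford_eqI)
  fix B
  have "coef (\<Sum>A\<in>UNIV. coef x A *\<^sub>R blade A) B = (\<Sum>A\<in>UNIV. coef (coef x A *\<^sub>R blade A) B)"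
    by (rule linear_sum[OF linear_coef])
  also have "\<dots> = (\<Sum>A\<in>UNIV. if A = B then coef x A else 0)"
    by (rule sum.cong) (auto simp: coef_blade)
  finally show "coef x B = coef (\<Sum>A\<in>UNIV. coef x A *\<^sub>R blade A) B" by simp
qed

lemma coef_sum_blade: "coef (\<Sum>A\<in>UNIV. g A *\<^sub>R blade A) B = g B"
proof -
  have "coef (\<Sum>A\<in>UNIV. g A *\<^sub>R blade A) B = (\<Sum>A\<in>UNIV. coef (g A *\<^sub>R blade A) B)"
    by (rule linear_sum[OF linear_coef])
  also have "\<dots> = (\<Sum>A\<in>UNIV. if A = B then g A else 0)"
    by (rule sum.cong) (auto simp: coef_blade)
  finally show ?thesis by simp
qed

text \<open>
  The embedding of \<open>\<complex>\<close> onto the plane \<open>\<real> + \<real>\<omega>\<close> that sends \<open>\<i>\<close> to \<open>\<omega>\<close>.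
\<close>
definition cplx :: "real ^ 'n::{finite,linorder} \<Rightarrow> complex \<Rightarrow> 'n clifford"
  where "cplx \<omega> z = Re z *\<^sub>R 1 + Im z *\<^sub>R cvec \<omega>"

lemma linear_cplx: "linear (cplx \<omega>)"
  by (auto simp: linear_iff cplx_def algebra_simps)

lemma bounded_linear_cplx: "bounded_linear (cplx \<omega>)"
  by (rule linear_conv_bounded_linear[THEN iffD1, OF linear_cplx])

lemma cplx_of_real [simp]: "cplx \<omega> (of_real r) = r *\<^sub>R 1"
  and cplx_i [simp]: "cplx \<omega> \<i> = cvec \<omega>"
  and cplx_zero [simp]: "cplx \<omega> 0 = 0"
  and cplx_one [simp]: "cplx \<omega> 1 = 1"
  by (simp_all add: cplx_def)

lemma cplx_add: "cplx \<omega> (z + w) = cplx \<omega> z + cplx \<omega> w"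
  by (simp add: cplx_def algebra_simps)

lemma cplx_scaleR: "cplx \<omega> (r *\<^sub>R z) = r *\<^sub>R cplx \<omega> z"
  by (simp add: cplx_def algebra_simps)

lemma cplx_mult:
  assumes "norm \<omega> = 1"
  shows "cplx \<omega> (z * w) = cplx \<omega> z * cplx \<omega> w"
  using cvec_square[of \<omega>] assms by (simp add: cplx_def algebra_simps)

lemma cplx_power: "norm \<omega> = 1 \<Longrightarrow> cplx \<omega> (z ^ n) = cplx \<omega> z ^ n"
  by (induction n) (simp_all add: cplx_mult)

lemma cvec_scaleR_power:
  assumes "norm \<omega> = 1"
  shows "cvec (v *\<^sub>R \<omega>) ^ j = cplx \<omega> ((\<i> * of_real v) ^ j)"
proof -
  have "cvec (v *\<^sub>R \<omega>) = cplx \<omega> (\<i> * of_real v)" by (simp add: cplx_def cvec_scaleR)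
  then show ?thesis by (simp add: cplx_power[OF assms])
qed

text \<open>
  The Euclidean norm of the Clifford algebra is only submultiplicative up to a factor, whose powers
  would spoil the convergence of power series. Powers of an element of one plane can be formed in \<open>\<complex>\<close>,
  so the factor enters only once.
\<close>
lemma cplx_mult_bound:
  obtains C where "C > 0"
    "\<And>(\<omega> :: real ^ ('n::{finite,linorder})) z (a :: 'n::{finite,linorder} clifford). norm \<omega> = 1 \<Longrightarrow> norm (cplx \<omega> z * a) \<le> C * cmod z * norm a"
proof -
  obtain K where K: "K > 0" "\<And>x y :: 'n clifford. norm (x * y) \<le> norm x * norm y * K"
    using bounded_bilinear.pos_bounded[OF bounded_bilinear_clifford_mult] by blast
  obtain L where L: "L > 0" "\<And>\<omega> :: (real, 'n) vec. norm (cvec \<omega>) \<le> norm \<omega> * L"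
    using bounded_linear.pos_bounded[OF bounded_linear_cvec] by blast
  show ?thesis
  proof
    show "(norm (1 :: 'n clifford) + L) * K > 0" using K L by (simp add: add_nonneg_pos)
    fix \<omega> :: "(real, 'n) vec" and z and a :: "'n clifford" assume \<omega>: "norm \<omega> = 1"
    have "norm (cplx \<omega> z) \<le> \<bar>Re z\<bar> * norm (1 :: 'n clifford) + \<bar>Im z\<bar> * norm (cvec \<omega>)"
      unfolding cplx_def by (rule norm_triangle_le) simp
    also have "\<dots> \<le> cmod z * norm (1 :: 'n clifford) + cmod z * L"
      using L(2)[of \<omega>] \<omega> by (intro add_mono mult_mono abs_Re_le_cmod abs_Im_le_cmod) auto
    finally have *: "norm (cplx \<omega> z) \<le> (norm (1 :: 'n clifford) + L) * cmod z"
      by (simp add: algebra_simps)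
    have "norm (cplx \<omega> z * a) \<le> norm (cplx \<omega> z) * norm a * K" by (rule K)
    also have "\<dots> \<le> (norm (1 :: 'n clifford) + L) * cmod z * norm a * K"
      using * K by (intro mult_right_mono) auto
    finally show "norm (cplx \<omega> z * a) \<le> (norm (1 :: 'n clifford) + L) * K * cmod z * norm a"
      by (simp add: algebra_simps)
  qed
qed

section \<open>Holomorphic extension of real-analytic functions\<close>

lemma has_sum_multi_indices_real:
  fixes y :: real
  shows "((\<lambda>\<alpha>. (\<Prod>b\<in>Basis. (y \<bullet> b) ^ \<alpha> b) *\<^sub>R c \<alpha>) has_sum S) (Basis \<rightarrow>\<^sub>E UNIV) \<longleftrightarrow>
    ((\<lambda>n. y ^ n *\<^sub>R c (\<lambda>b\<in>{1}. n)) has_sum S) UNIV"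
proof (rule has_sum_reindex_bij_witness[where j = "\<lambda>\<alpha>. \<alpha> 1" and i = "\<lambda>n. \<lambda>b\<in>{1}. n"])
  fix \<alpha> :: "real \<Rightarrow> nat" assume "\<alpha> \<in> Basis \<rightarrow>\<^sub>E UNIV"
  then show \<alpha>: "(\<lambda>b\<in>{1}. \<alpha> 1) = \<alpha>" by (auto simp: PiE_iff extensional_def fun_eq_iff)
  show "y ^ \<alpha> 1 *\<^sub>R c (\<lambda>b\<in>{1}. \<alpha> 1) = (\<Prod>b\<in>Basis. (y \<bullet> b) ^ \<alpha> b) *\<^sub>R c \<alpha>"
    unfolding \<alpha> by simp
qed auto

lemma real_analytic_imp_holomorphic:
  fixes g :: "real \<Rightarrow> real"
  assumes "real_analytic_on g S" "t \<in> S"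
  obtains r h where "r > 0" "h holomorphic_on ball (complex_of_real t) r"
    "\<And>x. x \<in> ball t r \<Longrightarrow> h (of_real x) = of_real (g x)"
proof -
  obtain r and c :: "(real \<Rightarrow> nat) \<Rightarrow> real" where r: "r > 0" and
    sum: "\<And>x. x \<in> ball t r \<Longrightarrow>
      ((\<lambda>\<alpha>. (\<Prod>b\<in>Basis. ((x - t) \<bullet> b) ^ \<alpha> b) *\<^sub>R c \<alpha>) has_sum g x) (Basis \<rightarrow>\<^sub>E UNIV)"
    using assms unfolding real_analytic_on_def by blast
  define a where "a n = c (\<lambda>b\<in>{1}. n)" for n
  have sums: "(\<lambda>n. (x - t) ^ n * a n) sums g x" if "x \<in> ball t r" for x
  proof -
    have "((\<lambda>n. (x - t) ^ n * a n) has_sum g x) UNIV"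
      using sum[OF that] unfolding has_sum_multi_indices_real by (simp add: a_def)
    then show ?thesis by (rule has_sum_imp_sums)
  qed
  define h where "h z = (\<Sum>n. of_real (a n) * (z - of_real t) ^ n)" for z :: complex
  show ?thesis
  proof (rule that[OF r])
    show "h holomorphic_on ball (complex_of_real t) r"
    proof (rule power_series_holomorphic)
      fix w assume w: "w \<in> ball (complex_of_real t) r"
      define s where "s = (cmod (w - of_real t) + r) / 2"
      have s: "cmod (w - of_real t) < s" "s < r" "0 < s"
        using w r by (auto simp: s_def dist_norm norm_minus_commute field_simps intro: add_pos_nonneg)
      have "summable (\<lambda>n. a n * s ^ n)"
        using sums[of "t + s"] s by (auto simp: dist_norm mult.commute dest: sums_summable)
      then have "summable (\<lambda>n. complex_of_real (a n) * of_real s ^ n)"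
        by (subst (asm) summable_of_real_iff[where ?'a = complex, symmetric]) simp
      then have "summable (\<lambda>n. of_real (a n) * (w - of_real t) ^ n)"
        by (rule powser_inside) (use s in auto)
      then show "(\<lambda>n. of_real (a n) * (w - of_real t) ^ n) sums h w"
        unfolding h_def by (rule summable_sums)
    qed
    fix x assume "x \<in> ball t r"
    from sums_of_real[OF sums[OF this], where ?'a = complex]
    show "h (of_real x) = of_real (g x)"
      unfolding h_def by (simp add: sums_iff mult.commute)
  qed
qed

lemma holomorphic_imp_real_analytic:
  fixes g :: "real \<Rightarrow> real"
  assumes "\<And>t. t \<in> S \<Longrightarrow> \<exists>r>0. \<exists>h. h holomorphic_on ball (complex_of_real t) r \<and>
    (\<forall>x\<in>ball t r. g x = Re (h (of_real x)))"
  shows "real_analytic_on g S"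
  unfolding real_analytic_on_def
proof
  fix t assume "t \<in> S"
  then obtain r h where r: "r > 0" and h: "h holomorphic_on ball (complex_of_real t) r"
    and g: "\<And>x. x \<in> ball t r \<Longrightarrow> g x = Re (h (of_real x))"
    using assms by blast
  define a where "a n = Re ((deriv ^^ n) h (of_real t) / fact n)" for n
  have sums: "(\<lambda>n. a n * (x - t) ^ n) sums g x" if "x \<in> ball t r" for x
  proof -
    have "of_real x \<in> ball (complex_of_real t) r"
      using that by (simp add: dist_norm norm_of_real flip: of_real_diff)
    from sums_Re[OF holomorphic_power_series[OF h this]]
    have "(\<lambda>n. Re ((deriv ^^ n) h (of_real t) / fact n * of_real ((x - t) ^ n))) sums g x"
      by (simp add: g[OF that])
    then show ?thesis
      by (simp only: a_def Re_complex_of_real Im_complex_of_real times_complex.sel mult_zero_right diff_zero)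
  qed
  show "\<exists>r>0. \<exists>c :: (real \<Rightarrow> nat) \<Rightarrow> real. \<forall>x\<in>ball t r.
    ((\<lambda>\<alpha>. (\<Prod>b\<in>Basis. ((x - t) \<bullet> b) ^ \<alpha> b) *\<^sub>R c \<alpha>) has_sum g x) (Basis \<rightarrow>\<^sub>E UNIV)"
  proof (intro exI[of _ r] conjI exI[of _ "\<lambda>\<alpha>. a (\<alpha> 1)"] ballI r)
    fix x assume x: "x \<in> ball t r"
    define s where "s = (\<bar>x - t\<bar> + r) / 2"
    have s: "\<bar>x - t\<bar> < s" "s < r" "0 < s"
      using x r by (auto simp: s_def dist_real_def field_simps)
    have "summable (\<lambda>n. a n * s ^ n)"
      using sums[of "t + s"] s by (auto simp: dist_norm dest: sums_summable)
    then have "summable (\<lambda>n. norm (a n * (x - t) ^ n))"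
      by (rule powser_insidea) (use s in auto)
    from norm_summable_imp_has_sum[OF this sums[OF x]]
    show "((\<lambda>\<alpha>. (\<Prod>b\<in>Basis. ((x - t) \<bullet> b) ^ \<alpha> b) *\<^sub>R a (\<alpha> 1)) has_sum g x) (Basis \<rightarrow>\<^sub>E UNIV)"
      unfolding has_sum_multi_indices_real[of "x - t" "\<lambda>\<alpha>. a (\<alpha> 1)"] by (simp add: mult.commute)
  qed
qed


lemma analytic_tensorI:
  assumes "\<And>t. t \<in> \<Omega>\<^sub>1 \<Longrightarrow> \<exists>r>0. \<forall>A. \<exists>h. h holomorphic_on ball (complex_of_real t) r \<and>
    (\<forall>x\<in>ball t r. coef (f x) A = Re (h (of_real x)))"
    and "\<And>t. t \<notin> \<Omega>\<^sub>1 \<Longrightarrow> f t = 0"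
  shows "f \<in> analytic_tensor \<Omega>\<^sub>1"
  unfolding analytic_tensor_def
proof (intro CollectI conjI allI impI)
  show "real_analytic_on (\<lambda>t. coef (f t) A) \<Omega>\<^sub>1" for A
  proof (rule holomorphic_imp_real_analytic)
    fix t assume "t \<in> \<Omega>\<^sub>1"
    with assms(1) show "\<exists>r>0. \<exists>h. h holomorphic_on ball (complex_of_real t) r \<and>
      (\<forall>x\<in>ball t r. coef (f x) A = Re (h (of_real x)))" by meson
  qed
qed (fact assms(2))

text \<open>
  \<open>H A\<close> is a holomorphic extension of the coordinate of \<open>f\<close> at \<open>e\<^sub>A\<close> to the disk of radius \<open>r\<close> around \<open>t\<close>;
  all coordinates share one radius.
\<close>
definition hol_ext ::
    "(real \<Rightarrow> 'n::{finite,linorder} clifford) \<Rightarrow> real \<Rightarrow> real \<Rightarrow> ('n set \<Rightarrow> complex \<Rightarrow> complex) \<Rightarrow> bool"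
  where "hol_ext f t r H \<longleftrightarrow> (\<forall>A. H A holomorphic_on ball (of_real t) r \<and>
    (\<forall>x\<in>ball t r. H A (of_real x) = of_real (coef (f x) A)))"

lemma analytic_tensor_hol_ext:
  assumes "f \<in> analytic_tensor \<Omega>\<^sub>1" "t \<in> \<Omega>\<^sub>1"
  obtains r H where "r > 0" "hol_ext f t r H"
proof -
  have "\<exists>r h. r > 0 \<and> h holomorphic_on ball (complex_of_real t) r \<and>
    (\<forall>x\<in>ball t r. h (of_real x) = of_real (coef (f x) A))" for A
  proof -
    have "real_analytic_on (\<lambda>t. coef (f t) A) \<Omega>\<^sub>1"
      using assms(1) by (simp add: analytic_tensor_def)
    from real_analytic_imp_holomorphic[OF this assms(2)] show ?thesis by metis
  qed
  then obtain R H where R: "\<And>A. R A > 0" and H: "\<And>A. H A holomorphic_on ball (complex_of_real t) (R A)"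
    and eq: "\<And>A x. x \<in> ball t (R A) \<Longrightarrow> H A (of_real x) = of_real (coef (f x) A)"
    by metis
  define r where "r = Min (range R)"
  have r: "r \<le> R A" for A by (simp add: r_def)
  have "r > 0" using R by (simp add: r_def)
  moreover have "hol_ext f t r H"
    unfolding hol_ext_def
  proof (intro allI conjI ballI)
    fix A
    show "H A holomorphic_on ball (complex_of_real t) r"
      by (rule holomorphic_on_subset[OF H]) (use r[of A] in auto)
    show "H A (of_real x) = of_real (coef (f x) A)" if "x \<in> ball t r" for x
      by (rule eq) (use that r[of A] in auto)
  qed
  ultimately show ?thesis by (rule that)
qed

text \<open>
  The complex derivative of a function that is real on the real axis is real there: the imaginary part
  vanishes along the axis, hence so does its derivative.
\<close>
lemma hol_ext_vector_derivative:
  assumes "hol_ext f t r H"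
  shows "hol_ext (\<lambda>x. vector_derivative f (at x)) t r (\<lambda>A. deriv (H A))"
  unfolding hol_ext_def
proof (intro allI conjI ballI)
  fix A
  have hol: "H A holomorphic_on ball (of_real t) r" for A
    using assms by (simp add: hol_ext_def)
  show "deriv (H A) holomorphic_on ball (of_real t) r"
    by (rule holomorphic_deriv[OF hol open_ball])
  fix x assume x: "x \<in> ball t r"
  then have x': "complex_of_real x \<in> ball (of_real t) r"
    by (simp add: dist_norm flip: of_real_diff)
  have eq: "H A (of_real y) = of_real (coef (f y) A)" if "y \<in> ball t r" for y A
    using assms that by (simp add: hol_ext_def)
  have "((\<lambda>y. H A (of_real y)) has_vector_derivative deriv (H A) (of_real x)) (at x)" for A
    using holomorphic_derivI[OF hol open_ball x'] by (rule has_vector_derivative_real_field)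
  then have der: "((\<lambda>y. of_real (coef (f y) A)) has_vector_derivative deriv (H A) (of_real x)) (at x)" for A
    by (rule has_vector_derivative_transform_within_open[OF _ open_ball x]) (rule eq)
  have Re: "((\<lambda>y. coef (f y) A) has_vector_derivative Re (deriv (H A) (of_real x))) (at x)"
    and Im: "((\<lambda>y. 0) has_vector_derivative Im (deriv (H A) (of_real x))) (at x)" for A
    using bounded_linear.has_vector_derivative[OF bounded_linear_Re der[of A]]
      bounded_linear.has_vector_derivative[OF bounded_linear_Im der[of A]] by simp_all
  have "((\<lambda>y. \<Sum>A\<in>UNIV. coef (f y) A *\<^sub>R blade A) has_vector_derivative
    (\<Sum>A\<in>UNIV. Re (deriv (H A) (of_real x)) *\<^sub>R blade A)) (at x)"
    by (intro has_vector_derivative_sum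
        bounded_linear.has_vector_derivative[OF bounded_linear_scaleR_left Re])
  then have "vector_derivative f (at x) = (\<Sum>A\<in>UNIV. Re (deriv (H A) (of_real x)) *\<^sub>R blade A)"
    by (intro vector_derivative_at) (simp flip: clifford_expansion)
  then have "coef (vector_derivative f (at x)) A = Re (deriv (H A) (of_real x))"
    by (simp add: coef_sum_blade)
  moreover have "Im (deriv (H A) (of_real x)) = 0"
    using vector_derivative_unique_at[OF Im[of A] has_vector_derivative_const] .
  ultimately show "deriv (H A) (of_real x) = of_real (coef (vector_derivative f (at x)) A)"
    by (simp add: complex_eq_iff)
qed

lemma hol_ext_nth_vderiv:
  assumes "hol_ext f t r H"
  shows "hol_ext (nth_vderiv j f) t r (\<lambda>A. (deriv ^^ j) (H A))"
proof (induction j)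
  case 0
  then show ?case using assms by (simp add: nth_vderiv_def)
next
  case (Suc j)
  then show ?case using hol_ext_vector_derivative[OF Suc] by (simp add: nth_vderiv_def)
qed

lemma nth_vderiv_analytic:
  assumes f: "f \<in> analytic_tensor \<Omega>\<^sub>1" and "open \<Omega>\<^sub>1"
  shows "(\<lambda>t. if t \<in> \<Omega>\<^sub>1 then c *\<^sub>R nth_vderiv j f t else 0) \<in> analytic_tensor \<Omega>\<^sub>1"
proof (rule analytic_tensorI)
  fix t assume t: "t \<in> \<Omega>\<^sub>1"
  obtain r H where r: "r > 0" and H: "hol_ext f t r H"
    using analytic_tensor_hol_ext[OF f t] .
  obtain s where s: "s > 0" "ball t s \<subseteq> \<Omega>\<^sub>1"
    using \<open>open \<Omega>\<^sub>1\<close> t by (meson openE)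
  have K: "hol_ext (nth_vderiv j f) t r (\<lambda>A. (deriv ^^ j) (H A))"
    by (rule hol_ext_nth_vderiv[OF H])
  show "\<exists>r>0. \<forall>A. \<exists>h. h holomorphic_on ball (complex_of_real t) r \<and>
    (\<forall>x\<in>ball t r. coef (if x \<in> \<Omega>\<^sub>1 then c *\<^sub>R nth_vderiv j f x else 0) A = Re (h (of_real x)))"
  proof (intro exI[of _ "min r s"] conjI allI ballI)
    show "min r s > 0" using r s by simp
    fix A
    show "\<exists>h. h holomorphic_on ball (complex_of_real t) (min r s) \<and>
      (\<forall>x\<in>ball t (min r s). coef (if x \<in> \<Omega>\<^sub>1 then c *\<^sub>R nth_vderiv j f x else 0) A = Re (h (of_real x)))"
    proof (intro exI[of _ "\<lambda>z. of_real c * (deriv ^^ j) (H A) z"] conjI ballI)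
      show "(\<lambda>z. of_real c * (deriv ^^ j) (H A) z) holomorphic_on ball (complex_of_real t) (min r s)"
      proof (intro holomorphic_on_mult holomorphic_on_const)
        show "(deriv ^^ j) (H A) holomorphic_on ball (complex_of_real t) (min r s)"
          by (rule holomorphic_on_subset[of _ "ball (of_real t) r"]) (use K in \<open>auto simp: hol_ext_def\<close>)
      qed
      fix x assume "x \<in> ball t (min r s)"
      with s K show "coef (if x \<in> \<Omega>\<^sub>1 then c *\<^sub>R nth_vderiv j f x else 0) A =
        Re (of_real c * (deriv ^^ j) (H A) (of_real x))"
        by (auto simp: hol_ext_def subset_iff)
    qed
  qed
qed simp

text \<open>
  The function \<open>\<Sum>\<^sub>A H\<^sub>A e\<^sub>A\<close> evaluated in the copy \<open>\<real> + \<real>\<omega>\<close> of \<open>\<complex>\<close>.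
\<close>
definition plane_wave :: "('n set \<Rightarrow> complex \<Rightarrow> complex) \<Rightarrow> real ^ ('n::{finite,linorder}) \<Rightarrow>
    complex \<Rightarrow> 'n clifford"
  where "plane_wave H \<omega> z = (\<Sum>A\<in>UNIV. cplx \<omega> (H A z) * blade A)"

lemma hol_ext_centre_ball:
  assumes "hol_ext f t r H"
  shows "H A holomorphic_on ball (of_real u) (r - \<bar>u - t\<bar>)"
proof (rule holomorphic_on_subset)
  show "H A holomorphic_on ball (of_real t) r" using assms by (simp add: hol_ext_def)
  have "dist (complex_of_real t) (of_real u) = \<bar>u - t\<bar>"
    by (simp add: dist_norm abs_minus_commute flip: of_real_diff)
  then show "ball (complex_of_real u) (r - \<bar>u - t\<bar>) \<subseteq> ball (of_real t) r"
    using dist_triangle[of "of_real t" w "of_real u" for w :: complex]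
    by (auto simp: subset_iff less_diff_eq add.commute intro: le_less_trans)
qed

text \<open>
  On \<open>\<real> + \<real>\<omega>\<close> the defining series of the slice extension is the Taylor series at \<open>u\<close> of the holomorphic
  extensions, evaluated at \<open>u + \<i> v\<close>. The condition says that this point lies in a disk around \<open>u\<close>
  inside the domain of \<open>H\<close>.
\<close>
lemma slice_term_sums:
  assumes H: "hol_ext f t r H" and \<omega>: "norm \<omega> = 1" and uv: "\<bar>u - t\<bar> + \<bar>v\<bar> < r"
  shows "slice_term f (u, v *\<^sub>R \<omega>) sums plane_wave H \<omega> (Complex u v)"
proof -
  note hol = hol_ext_centre_ball[OF H]
  have z: "Complex u v - of_real u = \<i> * of_real v" by (simp add: complex_eq_iff)
  have "Complex u v \<in> ball (of_real u) (r - \<bar>u - t\<bar>)"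
    using uv z by (simp add: dist_norm norm_minus_commute[of "of_real u"] norm_mult)
  from holomorphic_power_series[OF hol this]
  have "(\<lambda>j. (deriv ^^ j) (H A) (of_real u) / fact j * (\<i> * of_real v) ^ j) sums H A (Complex u v)" for A
    by (simp add: z)
  then have "(\<lambda>j. \<Sum>A\<in>UNIV. cplx \<omega> ((deriv ^^ j) (H A) (of_real u) / fact j * (\<i> * of_real v) ^ j) * blade A)
      sums plane_wave H \<omega> (Complex u v)"
    unfolding plane_wave_def
    by (intro sums_sum bounded_linear.sums[OF bounded_linear_clifford_mult_left]
        bounded_linear.sums[OF bounded_linear_cplx])
  moreover have "(\<Sum>A\<in>UNIV. cplx \<omega> ((deriv ^^ j) (H A) (of_real u) / fact j * (\<i> * of_real v) ^ j) * blade A) =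
      slice_term f (u, v *\<^sub>R \<omega>) j" for j
  proof -
    have u: "u \<in> ball t r" using uv by (simp add: dist_real_def abs_minus_commute)
    have "(deriv ^^ j) (H A) (of_real u) = of_real (coef (nth_vderiv j f u) A)" for A
      using hol_ext_nth_vderiv[OF H, of j] u by (simp add: hol_ext_def)
    then have "cplx \<omega> ((deriv ^^ j) (H A) (of_real u) / fact j * (\<i> * of_real v) ^ j) * blade A =
        (cvec (v *\<^sub>R \<omega>) ^ j /\<^sub>R fact j) * (coef (nth_vderiv j f u) A *\<^sub>R blade A)" for A
      using cplx_scaleR[of \<omega> "coef (nth_vderiv j f u) A / fact j" "(\<i> * of_real v) ^ j"]
      by (simp add: cvec_scaleR_power[OF \<omega>] scaleR_conv_of_real[where 'a = complex] divide_inverse mult_ac)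
    then have "(\<Sum>A\<in>UNIV. cplx \<omega> ((deriv ^^ j) (H A) (of_real u) / fact j * (\<i> * of_real v) ^ j) * blade A) =
        (cvec (v *\<^sub>R \<omega>) ^ j /\<^sub>R fact j) * (\<Sum>A\<in>UNIV. coef (nth_vderiv j f u) A *\<^sub>R blade A)"
      unfolding sum_distrib_left by (intro sum.cong refl)
    then show ?thesis
      unfolding slice_term_def prod.case by (simp only: clifford_expansion[symmetric])
  qed
  ultimately show ?thesis by simp
qed

lemma slice_ext_eq_plane_wave:
  assumes "hol_ext f t r H" "norm \<omega> = 1" "\<bar>u - t\<bar> + \<bar>v\<bar> < r"
  shows "slice_ext f (u, v *\<^sub>R \<omega>) = plane_wave H \<omega> (Complex u v)"
  using sums_unique[OF slice_term_sums[OF assms]] by (simp add: slice_ext_def)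

lemma slice_ext_axis: "slice_ext f (t, 0) = f t"
proof -
  have "slice_term f (t, 0) = (\<lambda>j. if j = 0 then f t else 0)"
    by (auto simp: slice_term_def fun_eq_iff nth_vderiv_def power_0_left)
  then show ?thesis
    using sums_single[of 0 "\<lambda>_. f t"] by (simp add: slice_ext_def sums_iff eq_commute)
qed

section \<open>Slice monogenic functions\<close>

lemma open_axis_box:
  assumes "open U" "(t, 0) \<in> U"
  obtains r where "r > 0" "\<And>u (x :: 'a::real_normed_vector). \<bar>u - t\<bar> < r \<Longrightarrow> norm x < r \<Longrightarrow> (u :: real, x) \<in> U"
proof -
  obtain A B where AB: "open A" "open B" "(t, 0) \<in> A \<times> B" "A \<times> B \<subseteq> U"
    using open_prod_elim[OF assms] .
  then obtain r s where "r > 0" "ball t r \<subseteq> A" "s > 0" "ball 0 s \<subseteq> B"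
    by (metis mem_Sigma_iff openE)
  with AB(4) show ?thesis
    by (intro that[of "min r s"]) (auto simp: subset_iff dist_real_def abs_minus_commute)
qed

lemma obtain_direction:
  fixes x :: "(real, 'n::finite) vec"
  obtains \<omega> where "norm \<omega> = 1" "x = norm x *\<^sub>R \<omega>"
proof (cases "x = 0")
  case True
  show ?thesis by (rule that[of "axis undefined 1"]) (simp_all add: True)
next
  case False
  then show ?thesis by (intro that[of "x /\<^sub>R norm x"]) auto
qed

text \<open>
  By the symmetry of \<open>\<Omega>\<^sub>2\<close> the pair \<open>(u, x)\<close> lies in \<open>\<Omega>\<close> exactly if \<open>u + \<i> |x|\<close> lies in \<open>\<Omega>\<^sub>2\<close>, which makes \<open>\<Omega>\<close> a
  preimage under a continuous map.
\<close>
lemma axial_slice_nbhd_open: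
  assumes "axial_slice_nbhd \<Omega>\<^sub>1 (\<Omega> :: 'n::finite pvec set)"
  shows "open \<Omega>" "t \<in> \<Omega>\<^sub>1 \<Longrightarrow> (t, 0) \<in> \<Omega>"
proof -
  obtain \<Omega>\<^sub>2 where \<Omega>\<^sub>2: "open \<Omega>\<^sub>2" "\<And>z. z \<in> \<Omega>\<^sub>2 \<Longrightarrow> cnj z \<in> \<Omega>\<^sub>2"
    "\<And>t. complex_of_real t \<in> \<Omega>\<^sub>2 \<longleftrightarrow> t \<in> \<Omega>\<^sub>1"
    and \<Omega>: "\<Omega> = {(u, v *\<^sub>R \<omega>) | u v \<omega>. Complex u v \<in> \<Omega>\<^sub>2 \<and> \<omega> \<in> sphere 0 1}"
    using assms unfolding axial_slice_nbhd_def by blast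
  have "(u, x) \<in> \<Omega> \<longleftrightarrow> Complex u (norm x) \<in> \<Omega>\<^sub>2" for u x
  proof
    assume "(u, x) \<in> \<Omega>"
    then obtain v \<omega> where v: "x = v *\<^sub>R \<omega>" "Complex u v \<in> \<Omega>\<^sub>2" "norm \<omega> = 1"
      by (auto simp: \<Omega>)
    have "cnj (Complex u v) = Complex u (- v)" by (simp add: complex_eq_iff)
    with \<Omega>\<^sub>2(2)[OF v(2)] v show "Complex u (norm x) \<in> \<Omega>\<^sub>2" by (auto simp: abs_if)
  next
    assume *: "Complex u (norm x) \<in> \<Omega>\<^sub>2"
    obtain \<omega> where "norm \<omega> = 1" "x = norm x *\<^sub>R \<omega>"
      by (rule obtain_direction[of x])
    with * show "(u, x) \<in> \<Omega>" by (force simp: \<Omega>)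
  qed
  then have \<Omega>: "\<Omega> = (\<lambda>p. Complex (fst p) (norm (snd p))) -` \<Omega>\<^sub>2" by force
  have "continuous_on UNIV (\<lambda>p :: 'n pvec. Complex (fst p) (norm (snd p)))"
    unfolding Complex_eq by (intro continuous_intros)
  then show "open \<Omega>"
    unfolding \<Omega> by (intro open_vimage \<Omega>\<^sub>2)
  show "t \<in> \<Omega>\<^sub>1 \<Longrightarrow> (t, 0) \<in> \<Omega>"
    using \<Omega>\<^sub>2(3)[of t] unfolding \<Omega> by (simp add: complex_of_real_def)
qed

text \<open>
  The neighbourhoods used for all extensions: the associated set \<open>\<Omega>\<^sub>2\<close> is a union of squares centred on
  the real axis.
\<close>
definition boxes :: "real set \<Rightarrow> (real \<Rightarrow> real) \<Rightarrow> 'n::finite pvec set"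
  where "boxes \<Omega>\<^sub>1 r = {(u, x). \<exists>t\<in>\<Omega>\<^sub>1. \<bar>u - t\<bar> < r t \<and> norm x < r t}"

text \<open>
  Connectedness of the union of squares: each square together with the whole real part \<open>\<Omega>\<^sub>1\<close> is
  connected, and these sets have \<open>\<Omega>\<^sub>1\<close> in common.
\<close>
lemma axial_slice_nbhd_boxes:
  assumes "connected \<Omega>\<^sub>1" "\<Omega>\<^sub>1 \<noteq> {}" and r: "\<And>t. t \<in> \<Omega>\<^sub>1 \<Longrightarrow> r t > 0"
    "\<And>t u. t \<in> \<Omega>\<^sub>1 \<Longrightarrow> \<bar>u - t\<bar> < r t \<Longrightarrow> u \<in> \<Omega>\<^sub>1"
  shows "axial_slice_nbhd \<Omega>\<^sub>1 (boxes \<Omega>\<^sub>1 r :: 'n::finite pvec set)"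
  unfolding axial_slice_nbhd_def
proof (intro exI conjI)
  let ?Q = "\<lambda>t. {z. \<bar>Re z - t\<bar> < r t \<and> \<bar>Im z\<bar> < r t}"
  let ?\<Omega> = "\<Union>t\<in>\<Omega>\<^sub>1. ?Q t"
  have M: "complex_of_real t \<in> ?Q t" if "t \<in> \<Omega>\<^sub>1" for t using r(1)[OF that] by simp
  have Q: "?Q t = box (Complex (t - r t) (- r t)) (Complex (t + r t) (r t))" for t
    by (auto simp: in_box_complex_iff)
  show "open ?\<Omega>"
    unfolding Q by (intro open_UN ballI open_box)
  have line: "connected (complex_of_real ` \<Omega>\<^sub>1)"
    by (intro connected_continuous_image continuous_intros assms)
  have "connected (\<Union>t\<in>\<Omega>\<^sub>1. ?Q t \<union> complex_of_real ` \<Omega>\<^sub>1)"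
  proof (rule connected_Union)
    fix S assume "S \<in> (\<lambda>t. ?Q t \<union> complex_of_real ` \<Omega>\<^sub>1) ` \<Omega>\<^sub>1"
    then obtain t where t: "t \<in> \<Omega>\<^sub>1" and S: "S = ?Q t \<union> complex_of_real ` \<Omega>\<^sub>1" by blast
    have "complex_of_real t \<in> ?Q t \<inter> complex_of_real ` \<Omega>\<^sub>1" using t M by blast
    then show "connected S"
      unfolding S using line by (intro connected_Un) (auto simp: Q intro: convex_connected)
  qed (use assms(2) in auto)
  also have "(\<Union>t\<in>\<Omega>\<^sub>1. ?Q t \<union> complex_of_real ` \<Omega>\<^sub>1) = ?\<Omega>"
    using M by blast
  finally show "connected ?\<Omega>" .
  show "\<forall>z\<in>?\<Omega>. cnj z \<in> ?\<Omega>" by auto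
  show "\<forall>t. complex_of_real t \<in> ?\<Omega> \<longleftrightarrow> t \<in> \<Omega>\<^sub>1"
  proof (intro allI iffI)
    fix t assume "complex_of_real t \<in> ?\<Omega>"
    then obtain t' where "t' \<in> \<Omega>\<^sub>1" "\<bar>t - t'\<bar> < r t'" by auto
    then show "t \<in> \<Omega>\<^sub>1" by (rule r(2))
  qed (use M in blast)
  show "boxes \<Omega>\<^sub>1 r = {(u, v *\<^sub>R \<omega>) |u v \<omega>. Complex u v \<in> ?\<Omega> \<and> \<omega> \<in> sphere (0 :: real ^ 'n) 1}"
  proof (intro equalityI subsetI)
    fix p :: "'n pvec" assume "p \<in> boxes \<Omega>\<^sub>1 r"
    then obtain u x t where p: "p = (u, x)" and t: "t \<in> \<Omega>\<^sub>1" "\<bar>u - t\<bar> < r t" "norm x < r t"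
      by (auto simp: boxes_def)
    obtain \<omega> where \<omega>: "norm \<omega> = 1" "x = norm x *\<^sub>R \<omega>"
      by (rule obtain_direction[of x])
    show "p \<in> {(u, v *\<^sub>R \<omega>) |u v \<omega>. Complex u v \<in> ?\<Omega> \<and> \<omega> \<in> sphere (0 :: real ^ 'n) 1}"
      unfolding p by (rule CollectI, rule exI[of _ u], rule exI[of _ "norm x"], rule exI[of _ \<omega>])
        (use t \<omega> in auto)
  next
    fix p :: "'n pvec"
    assume "p \<in> {(u, v *\<^sub>R \<omega>) |u v \<omega>. Complex u v \<in> ?\<Omega> \<and> \<omega> \<in> sphere (0 :: real ^ 'n) 1}"
    then show "p \<in> boxes \<Omega>\<^sub>1 r" by (auto simp: boxes_def)
  qed
qed

lemma Complex_in_ball: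
  assumes "\<bar>u - t\<bar> + \<bar>v\<bar> < r"
  shows "Complex u v \<in> ball (of_real t) r"
proof -
  have "cmod (Complex (u - t) v) \<le> \<bar>u - t\<bar> + \<bar>v\<bar>"
    using cmod_le[of "Complex (u - t) v"] by simp
  moreover have "dist (of_real t) (Complex u v) = cmod (Complex (u - t) v)"
    by (simp add: dist_norm cmod_def power2_commute)
  ultimately show ?thesis using assms by simp
qed

lemma complex_ball_box:
  assumes "z \<in> ball (of_real t) r"
  shows "\<bar>Re z - t\<bar> < r \<and> \<bar>Im z\<bar> < r"
  using abs_Re_le_cmod[of "z - of_real t"] abs_Im_le_cmod[of "z - of_real t"] assms
  by (auto simp: dist_norm norm_minus_commute)

lemma plane_wave_has_derivative:
  assumes H: "\<And>A. H A holomorphic_on S" and S: "open S" "Complex u v \<in> S"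
  shows "((\<lambda>(s, t). plane_wave H \<omega> (Complex s t)) has_derivative
    (\<lambda>(s, t). \<Sum>A\<in>UNIV. cplx \<omega> (deriv (H A) (Complex u v) * Complex s t) * blade A)) (at (u, v))"
proof -
  have C: "((\<lambda>p. Complex (fst p) (snd p)) has_derivative (\<lambda>p. Complex (fst p) (snd p))) (at (u, v))"
    unfolding Complex_eq by (auto intro!: derivative_eq_intros)
  have "((\<lambda>p. H A (Complex (fst p) (snd p))) has_derivative
      (\<lambda>p. deriv (H A) (Complex u v) * Complex (fst p) (snd p))) (at (u, v))" for A
    using holomorphic_derivI[OF H S] unfolding has_field_derivative_def
    by (intro has_derivative_compose[OF C]) simp
  then have "((\<lambda>p. \<Sum>A\<in>UNIV. cplx \<omega> (H A (Complex (fst p) (snd p))) * blade A) has_derivative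
      (\<lambda>p. \<Sum>A\<in>UNIV. cplx \<omega> (deriv (H A) (Complex u v) * Complex (fst p) (snd p)) * blade A)) (at (u, v))"
    by (intro has_derivative_sum bounded_linear.has_derivative[OF bounded_linear_clifford_mult_left]
        bounded_linear.has_derivative[OF bounded_linear_cplx])
  then show ?thesis by (simp add: plane_wave_def case_prod_unfold)
qed

text \<open>
  The disk has twice the radius of the box because the box contains points with \<open>|u - t| + |v|\<close> up to
  twice its size.
\<close>
lemma slice_monogenic_slice_ext:
  fixes f :: "real \<Rightarrow> 'n::{finite,linorder} clifford"
  assumes H: "\<And>t. t \<in> \<Omega>\<^sub>1 \<Longrightarrow> hol_ext f t (2 * r t) (H t)"
  shows "slice_monogenic (boxes \<Omega>\<^sub>1 r) (slice_ext f)"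
  unfolding slice_monogenic_def
proof (intro ballI allI impI)
  fix \<omega> :: "(real, 'n) vec" and u v
  assume "\<omega> \<in> sphere 0 1" and "(u, v *\<^sub>R \<omega>) \<in> boxes \<Omega>\<^sub>1 r"
  then obtain t where \<omega>: "norm \<omega> = 1" and t: "t \<in> \<Omega>\<^sub>1" "\<bar>u - t\<bar> < r t" "\<bar>v\<bar> < r t"
    by (auto simp: boxes_def)
  define W where "W = {p :: real \<times> real. \<bar>fst p - t\<bar> < r t \<and> \<bar>snd p\<bar> < r t}"
  have W: "open W" "(u, v) \<in> W"
    unfolding W_def by (auto intro!: open_Collect_conj open_Collect_less continuous_intros simp: t)
  have hol: "H t A holomorphic_on ball (of_real t) (2 * r t)" for A
    using H[OF t(1)] by (simp add: hol_ext_def)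
  have mem: "Complex u v \<in> ball (of_real t) (2 * r t)"
    using t by (intro Complex_in_ball) simp
  let ?f = "\<lambda>(s, t). slice_ext f (s, t *\<^sub>R \<omega>)"
  let ?D = "\<lambda>(a, b). \<Sum>A\<in>UNIV. cplx \<omega> (deriv (H t A) (Complex u v) * Complex a b) * blade A"
  have D: "(?f has_derivative ?D) (at (u, v))"
  proof (rule has_derivative_transform_within_open[OF plane_wave_has_derivative[OF hol open_ball mem] W])
    fix p assume "p \<in> W"
    then have "\<bar>fst p - t\<bar> + \<bar>snd p\<bar> < 2 * r t" by (auto simp: W_def)
    from slice_ext_eq_plane_wave[OF H[OF t(1)] \<omega> this]
    show "(case p of (s, t') \<Rightarrow> plane_wave (H t) \<omega> (Complex s t')) = ?f p"
      by (simp add: case_prod_unfold)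
  qed
  have "cplx \<omega> (deriv (H t A) (Complex u v) * Complex 1 0) * blade A +
    cvec \<omega> * (cplx \<omega> (deriv (H t A) (Complex u v) * Complex 0 1) * blade A) = 0" for A
  proof -
    have "cvec \<omega> * (cplx \<omega> (deriv (H t A) (Complex u v) * \<i>) * blade A) =
        cplx \<omega> (\<i> * (deriv (H t A) (Complex u v) * \<i>)) * blade A"
      by (simp only: cplx_mult[OF \<omega>, of \<i>] cplx_i mult.assoc)
    also have "\<i> * (deriv (H t A) (Complex u v) * \<i>) = - deriv (H t A) (Complex u v)"
      by (simp add: complex_eq_iff)
    finally show ?thesis
      by (simp add: linear_neg[OF linear_cplx] flip: one_complex.code imaginary_unit.code)
  qed
  then have "?D (1, 0) + cvec \<omega> * ?D (0, 1) = 0"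
    by (simp add: sum_distrib_left flip: sum.distrib)
  with D show "let f\<^sub>\<omega> = ?f in f\<^sub>\<omega> differentiable (at (u, v)) \<and>
      frechet_derivative f\<^sub>\<omega> (at (u, v)) (1, 0) + cvec \<omega> * frechet_derivative f\<^sub>\<omega> (at (u, v)) (0, 1) = 0"
    unfolding Let_def frechet_derivative_at[OF D, symmetric] by (auto simp: differentiable_def)
qed

lemma slice_monogenicD:
  assumes "slice_monogenic \<Omega> f" "norm \<omega> = 1" "(u, v *\<^sub>R \<omega>) \<in> \<Omega>"
  obtains D where "((\<lambda>(s, t). f (s, t *\<^sub>R \<omega>)) has_derivative D) (at (u, v))"
    "D (1, 0) + cvec \<omega> * D (0, 1) = 0"
proof -
  have "\<omega> \<in> sphere 0 1" using assms(2) by simp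
  with assms(1,3) have "((\<lambda>(s, t). f (s, t *\<^sub>R \<omega>)) has_derivative
        frechet_derivative (\<lambda>(s, t). f (s, t *\<^sub>R \<omega>)) (at (u, v))) (at (u, v)) \<and>
      frechet_derivative (\<lambda>(s, t). f (s, t *\<^sub>R \<omega>)) (at (u, v)) (1, 0) +
        cvec \<omega> * frechet_derivative (\<lambda>(s, t). f (s, t *\<^sub>R \<omega>)) (at (u, v)) (0, 1) = 0"
    unfolding slice_monogenic_def Let_def frechet_derivative_works by blast
  then show ?thesis using that by blast
qed
lemma slice_monogenicI:
  assumes "\<And>\<omega> u v. norm \<omega> = 1 \<Longrightarrow> (u, v *\<^sub>R \<omega>) \<in> \<Omega> \<Longrightarrow>
    \<exists>D. ((\<lambda>(s, t). f (s, t *\<^sub>R \<omega>)) has_derivative D) (at (u, v)) \<and> D (1, 0) + cvec \<omega> * D (0, 1) = 0"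
  shows "slice_monogenic \<Omega> f"
  unfolding slice_monogenic_def Let_def
proof (intro ballI allI impI)
  fix \<omega> u v assume "\<omega> \<in> sphere 0 1" "(u, v *\<^sub>R \<omega>) \<in> \<Omega>"
  then obtain D where D: "((\<lambda>(s, t). f (s, t *\<^sub>R \<omega>)) has_derivative D) (at (u, v))"
      "D (1, 0) + cvec \<omega> * D (0, 1) = 0"
    using assms[of \<omega> u v] by auto
  then show "(\<lambda>(s, t). f (s, t *\<^sub>R \<omega>)) differentiable at (u, v) \<and>
    frechet_derivative (\<lambda>(s, t). f (s, t *\<^sub>R \<omega>)) (at (u, v)) (1, 0) +
    cvec \<omega> * frechet_derivative (\<lambda>(s, t). f (s, t *\<^sub>R \<omega>)) (at (u, v)) (0, 1) = 0"
    unfolding frechet_derivative_at[OF D(1), symmetric] by (auto simp: differentiable_def)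
qed

text \<open>
  Closure under sums and under right multiplication in one statement: take \<open>c = 1\<close> for
  the former and \<open>f c = f + f (c - 1)\<close> for the latter.
\<close>
lemma slice_monogenic_add_mult_right:
  assumes f: "slice_monogenic \<Omega> f" and g: "slice_monogenic \<Omega>' g"
  shows "slice_monogenic (\<Omega> \<inter> \<Omega>') (\<lambda>p. f p + g p * c)"
proof (rule slice_monogenicI)
  fix \<omega> :: "(real, 'a) vec" and u v assume \<omega>: "norm \<omega> = 1" and "(u, v *\<^sub>R \<omega>) \<in> \<Omega> \<inter> \<Omega>'"
  then have "(u, v *\<^sub>R \<omega>) \<in> \<Omega>" "(u, v *\<^sub>R \<omega>) \<in> \<Omega>'" by auto
  obtain D where D: "((\<lambda>(s, t). f (s, t *\<^sub>R \<omega>)) has_derivative D) (at (u, v))"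
      "D (1, 0) + cvec \<omega> * D (0, 1) = 0"
    using slice_monogenicD[OF f \<omega> \<open>_ \<in> \<Omega>\<close>] .
  obtain E where E: "((\<lambda>(s, t). g (s, t *\<^sub>R \<omega>)) has_derivative E) (at (u, v))"
      "E (1, 0) + cvec \<omega> * E (0, 1) = 0"
    using slice_monogenicD[OF g \<omega> \<open>_ \<in> \<Omega>'\<close>] .
  have "D (1, 0) + E (1, 0) * c + cvec \<omega> * (D (0, 1) + E (0, 1) * c) =
      (D (1, 0) + cvec \<omega> * D (0, 1)) + (E (1, 0) + cvec \<omega> * E (0, 1)) * c"
    by (simp add: algebra_simps)
  then show "\<exists>D. ((\<lambda>(s, t). f (s, t *\<^sub>R \<omega>) + g (s, t *\<^sub>R \<omega>) * c) has_derivative D) (at (u, v)) \<and>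
      D (1, 0) + cvec \<omega> * D (0, 1) = 0"
    using has_derivative_add[OF D(1) bounded_linear.has_derivative[OF bounded_linear_clifford_mult_left E(1)], of c] D(2) E(2)
    by (intro exI[of _ "\<lambda>p. D p + E p * c"]) (simp add: case_prod_unfold)
qed

text \<open>
  For a real functional \<open>L\<close> the function \<open>L(f) - \<i> L(\<omega> f)\<close> is holomorphic on the slice: from
  \<open>\<partial>\<^sub>v f = \<omega> \<partial>\<^sub>u f\<close> and \<open>\<omega>\<^sup>2 = - 1\<close> its \<open>v\<close>-derivative is \<open>\<i>\<close> times its \<open>u\<close>-derivative. Here \<open>L\<close> is the
  coordinate at \<open>e\<^sub>A\<close>.
\<close>
lemma slice_monogenic_components_holomorphic:
  assumes f: "slice_monogenic \<Omega> f" and \<omega>: "norm \<omega> = 1"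
    and S: "open S" "\<And>z. z \<in> S \<Longrightarrow> (Re z, Im z *\<^sub>R \<omega>) \<in> \<Omega>"
  shows "(\<lambda>z. Complex (coef (f (Re z, Im z *\<^sub>R \<omega>)) A) (- coef (cvec \<omega> * f (Re z, Im z *\<^sub>R \<omega>)) A))
    holomorphic_on S"
  unfolding holomorphic_on_open[OF S(1)]
proof
  fix z assume z: "z \<in> S"
  obtain D where D: "((\<lambda>(s, t). f (s, t *\<^sub>R \<omega>)) has_derivative D) (at (Re z, Im z))"
      "D (1, 0) + cvec \<omega> * D (0, 1) = 0"
    using slice_monogenicD[OF f \<omega> S(2)[OF z]] .
  define a where "a = D (1, 0)"
  have ww: "cvec \<omega> * (cvec \<omega> * b) = - b" for b
    using cvec_square[of \<omega>] \<omega> by (simp flip: mult.assoc)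
  have "cvec \<omega> * (D (1, 0) + cvec \<omega> * D (0, 1)) = 0" by (simp add: D(2))
  then have b: "D (0, 1) = cvec \<omega> * a" by (simp add: a_def ww distrib_left)
  have D_eq: "D (s, t) = s *\<^sub>R a + t *\<^sub>R (cvec \<omega> * a)" for s t
  proof -
    have lin: "linear D" using D(1) by (simp add: has_derivative_linear)
    have "D (s, t) = D (s *\<^sub>R (1, 0) + t *\<^sub>R (0, 1))" by simp
    also have "\<dots> = s *\<^sub>R D (1, 0) + t *\<^sub>R D (0, 1)"
      by (simp only: linear_add[OF lin] linear_cmul[OF lin])
    finally show ?thesis by (simp add: b a_def)
  qed
  have C: "((\<lambda>z. (Re z, Im z)) has_derivative (\<lambda>z. (Re z, Im z))) (at z)"
    by (auto intro!: derivative_eq_intros)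
  have "((\<lambda>z. (\<lambda>(s, t). f (s, t *\<^sub>R \<omega>)) (Re z, Im z)) has_derivative (\<lambda>h. D (Re h, Im h))) (at z)"
    by (rule has_derivative_compose[OF C]) (rule D(1))
  then have F: "((\<lambda>z. f (Re z, Im z *\<^sub>R \<omega>)) has_derivative (\<lambda>h. D (Re h, Im h))) (at z)"
    by simp
  let ?d = "Complex (coef a A) (- coef (cvec \<omega> * a) A)"
  have "((\<lambda>z. Complex (coef (f (Re z, Im z *\<^sub>R \<omega>)) A) (- coef (cvec \<omega> * f (Re z, Im z *\<^sub>R \<omega>)) A))
      has_derivative (\<lambda>h. Complex (coef (D (Re h, Im h)) A) (- coef (cvec \<omega> * D (Re h, Im h)) A))) (at z)"
    unfolding Complex_eq
    by (intro has_derivative_add has_derivative_mult_right has_derivative_of_real has_derivative_minus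
        bounded_linear.has_derivative[OF bounded_linear_coef]
        bounded_linear.has_derivative[OF bounded_linear_clifford_mult_right] F)
  also have "(\<lambda>h. Complex (coef (D (Re h, Im h)) A) (- coef (cvec \<omega> * D (Re h, Im h)) A)) = (*) ?d"
    by (auto simp: fun_eq_iff complex_eq_iff D_eq ww algebra_simps)
  finally show "\<exists>d. ((\<lambda>z. Complex (coef (f (Re z, Im z *\<^sub>R \<omega>)) A) (- coef (cvec \<omega> * f (Re z, Im z *\<^sub>R \<omega>)) A))
      has_field_derivative d) (at z)"
    unfolding has_field_derivative_def by blast
qed

lemma slice_monogenic_restriction_analytic:
  fixes f :: "'n::{finite,linorder} pvec \<Rightarrow> 'n clifford"
  assumes f: "slice_monogenic \<Omega> f" and \<Omega>: "open \<Omega>" "\<And>t. t \<in> \<Omega>\<^sub>1 \<Longrightarrow> (t, 0) \<in> \<Omega>" "open \<Omega>\<^sub>1"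
  shows "(\<lambda>t. if t \<in> \<Omega>\<^sub>1 then f (t, 0) else 0) \<in> analytic_tensor \<Omega>\<^sub>1"
proof (rule analytic_tensorI)
  fix t assume t: "t \<in> \<Omega>\<^sub>1"
  obtain r where r: "r > 0" "\<And>u x. \<bar>u - t\<bar> < r \<Longrightarrow> norm x < r \<Longrightarrow> (u, x) \<in> \<Omega>"
    using open_axis_box[OF \<Omega>(1) \<Omega>(2)[OF t]] by metis
  obtain s where s: "s > 0" "ball t s \<subseteq> \<Omega>\<^sub>1" using \<Omega>(3) t by (meson openE)
  define \<omega> :: "(real, 'n) vec" where "\<omega> = axis undefined 1"
  have \<omega>: "norm \<omega> = 1" by (simp add: \<omega>_def)
  let ?g = "\<lambda>A z. Complex (coef (f (Re z, Im z *\<^sub>R \<omega>)) A) (- coef (cvec \<omega> * f (Re z, Im z *\<^sub>R \<omega>)) A)"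
  have "?g A holomorphic_on ball (of_real t) (min r s)" for A
    by (rule slice_monogenic_components_holomorphic[OF f \<omega> open_ball])
      (rule r(2), auto dest!: complex_ball_box simp: \<omega> simp del: mem_ball)
  then show "\<exists>r>0. \<forall>A. \<exists>h. h holomorphic_on ball (complex_of_real t) r \<and>
      (\<forall>x\<in>ball t r. coef (if x \<in> \<Omega>\<^sub>1 then f (x, 0) else 0) A = Re (h (of_real x)))"
    using r(1) s by (intro exI[of _ "min r s"] conjI allI exI[of _ "?g A" for A]) auto
qed simp

text \<open>
  On each slice the coordinates of the difference are real parts of holomorphic functions that vanish
  on a real interval; the identity theorem applies on a disk whose size does not depend on the slice.
\<close>
lemma slice_monogenic_unique:
  fixes f :: "'n::{finite,linorder} pvec \<Rightarrow> 'n clifford"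
  assumes f: "slice_monogenic \<Omega> f" and g: "slice_monogenic \<Omega>' g"
    and \<Omega>: "open \<Omega>" "\<And>t. t \<in> \<Omega>\<^sub>1 \<Longrightarrow> (t, 0) \<in> \<Omega>" "open \<Omega>'" "\<And>t. t \<in> \<Omega>\<^sub>1 \<Longrightarrow> (t, 0) \<in> \<Omega>'"
    and \<Omega>\<^sub>1: "open \<Omega>\<^sub>1" and eq: "\<And>t. t \<in> \<Omega>\<^sub>1 \<Longrightarrow> f (t, 0) = g (t, 0)"
  shows "near \<Omega>\<^sub>1 (\<lambda>p. f p = g p)"
proof -
  define h where "h p = f p + g p * (- 1)" for p
  have h: "slice_monogenic (\<Omega> \<inter> \<Omega>') h"
    unfolding h_def by (rule slice_monogenic_add_mult_right[OF f g])
  have "\<exists>U. open U \<and> (t, 0) \<in> U \<and> (\<forall>p\<in>U. h p = 0)" if t: "t \<in> \<Omega>\<^sub>1" for t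
  proof -
    obtain r where r: "r > 0" "\<And>u x. \<bar>u - t\<bar> < r \<Longrightarrow> norm x < r \<Longrightarrow> (u, x) \<in> \<Omega> \<inter> \<Omega>'"
      using open_axis_box[OF open_Int[OF \<Omega>(1,3)]] \<Omega>(2,4)[OF t] by (metis IntI)
    obtain s where s: "s > 0" "ball t s \<subseteq> \<Omega>\<^sub>1" using \<Omega>\<^sub>1 t by (meson openE)
    define e where "e = min r s"
    have e: "e > 0" "e \<le> r" "e \<le> s" using r s by (auto simp: e_def)
    have zero: "h (u, v *\<^sub>R \<omega>) = 0" if \<omega>: "norm \<omega> = 1" and uv: "Complex u v \<in> ball (of_real t) e" for u v \<omega>
    proof (rule clifford_eqI)
      fix A
      let ?g = "\<lambda>z. Complex (coef (h (Re z, Im z *\<^sub>R \<omega>)) A) (- coef (cvec \<omega> * h (Re z, Im z *\<^sub>R \<omega>)) A)"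
      have "?g (Complex u v) = 0"
      proof (rule analytic_continuation[where f = ?g and S = "ball (of_real t) e"
            and U = "of_real ` ball t e" and \<xi> = "of_real t"])
        show "?g holomorphic_on ball (of_real t) e"
          by (rule slice_monogenic_components_holomorphic[OF h \<omega> open_ball])
            (rule r(2), use e in \<open>auto dest!: complex_ball_box simp: \<omega> simp del: mem_ball\<close>)
        show "complex_of_real ` ball t e \<subseteq> ball (of_real t) e"
          by (auto simp: dist_norm simp flip: of_real_diff)
        have "t islimpt ball t e" using e by (simp add: islimpt_ball)
        then show "complex_of_real t islimpt of_real ` ball t e"
          unfolding islimpt_approachable by (auto simp: dist_norm simp flip: of_real_diff)
        fix z assume "z \<in> complex_of_real ` ball t e"
        then obtain x where x: "z = of_real x" "x \<in> \<Omega>\<^sub>1" using s e(3) by (force simp: subset_iff)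
        then show "?g z = 0" using eq[of x] by (simp add: h_def complex_eq_iff)
      qed (use e uv in auto)
      then show "coef (h (u, v *\<^sub>R \<omega>)) A = coef 0 A" by (simp add: complex_eq_iff)
    qed
    define U where "U = {p :: 'n pvec. \<bar>fst p - t\<bar> < e / 2 \<and> norm (snd p) < e / 2}"
    show ?thesis
    proof (intro exI[of _ U] conjI ballI)
      show "open U" unfolding U_def by (intro open_Collect_conj open_Collect_less continuous_intros)
      show "(t, 0) \<in> U" using e by (simp add: U_def)
      fix p assume p: "p \<in> U"
      obtain \<omega> where \<omega>: "norm \<omega> = 1" "snd p = norm (snd p) *\<^sub>R \<omega>"
        by (rule obtain_direction[of "snd p"])
      have "Complex (fst p) (norm (snd p)) \<in> ball (of_real t) e"
        using p by (intro Complex_in_ball) (simp add: U_def)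
      from zero[OF \<omega>(1) this] show "h p = 0" using \<omega>(2) by (metis prod.collapse)
    qed
  qed
  then obtain U where U: "\<And>t. t \<in> \<Omega>\<^sub>1 \<Longrightarrow> open (U t) \<and> (t, 0) \<in> U t \<and> (\<forall>p\<in>U t. h p = 0)" by metis
  show ?thesis
    unfolding near_def
  proof (intro exI[of _ "\<Union>t\<in>\<Omega>\<^sub>1. U t"] conjI ballI)
    fix p assume "p \<in> (\<Union>t\<in>\<Omega>\<^sub>1. U t)"
    with U have "h p = 0" by auto
    then show "f p = g p" by (simp add: h_def)
  qed (use U in auto)
qed

section \<open>Power series in several variables\<close>

definition multi_indices :: "'b set \<Rightarrow> nat \<Rightarrow> ('b \<Rightarrow> nat) set"
  where "multi_indices B k = {\<alpha> \<in> B \<rightarrow>\<^sub>E UNIV. sum \<alpha> B = k}"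

lemma finite_multi_indices:
  assumes "finite B"
  shows "finite (multi_indices B k)"
proof (rule finite_subset)
  show "multi_indices B k \<subseteq> B \<rightarrow>\<^sub>E {..k}"
  proof
    fix \<alpha> assume \<alpha>: "\<alpha> \<in> multi_indices B k"
    have "\<alpha> b \<le> k" if "b \<in> B" for b
      using \<alpha> member_le_sum[of b B \<alpha>] that assms by (simp add: multi_indices_def)
    then show "\<alpha> \<in> B \<rightarrow>\<^sub>E {..k}" using \<alpha> by (auto simp: multi_indices_def PiE_iff)
  qed
qed (simp add: finite_PiE assms)

text \<open>
  The multinomial coefficient as the number of words with letters in \<open>B\<close> in which every letter \<open>b\<close>
  occurs \<open>\<alpha> b\<close> times. In this form the multinomial theorem is the expansion of a product of sums.
\<close>
definition multinomial :: "'b set \<Rightarrow> ('b \<Rightarrow> nat) \<Rightarrow> nat"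
  where "multinomial B \<alpha> = card {w \<in> {..<sum \<alpha> B} \<rightarrow>\<^sub>E B. (\<lambda>b\<in>B. card {i. i < sum \<alpha> B \<and> w i = b}) = \<alpha>}"

lemma power_sum_multinomial:
  fixes x :: "'b \<Rightarrow> 'c::comm_semiring_1"
  assumes B: "finite B"
  shows "(\<Sum>b\<in>B. x b) ^ k = (\<Sum>\<alpha>\<in>multi_indices B k. of_nat (multinomial B \<alpha>) * (\<Prod>b\<in>B. x b ^ \<alpha> b))"
proof -
  define cnt where "cnt w = (\<lambda>b\<in>B. card {i. i < k \<and> w i = b})" for w :: "nat \<Rightarrow> 'b"
  have cnt: "(\<Prod>i<k. x (w i)) = (\<Prod>b\<in>B. x b ^ cnt w b)" if w: "w \<in> {..<k} \<rightarrow>\<^sub>E B" for w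
  proof -
    have "(\<Prod>i<k. x (w i)) = (\<Prod>b\<in>B. \<Prod>i\<in>{i \<in> {..<k}. w i = b}. x (w i))"
      using w B by (subst prod.group) auto
    also have "\<dots> = (\<Prod>b\<in>B. x b ^ cnt w b)"
      by (rule prod.cong) (simp_all add: cnt_def lessThan_def)
    finally show ?thesis .
  qed
  have sum_cnt: "sum (cnt w) B = k" if w: "w \<in> {..<k} \<rightarrow>\<^sub>E B" for w
  proof -
    have "sum (cnt w) B = (\<Sum>b\<in>B. \<Sum>i\<in>{i \<in> {..<k}. w i = b}. 1)"
      by (rule sum.cong) (simp_all add: cnt_def lessThan_def)
    also have "\<dots> = (\<Sum>i<k. 1)" using w B by (subst sum.group) auto
    finally show ?thesis by simp
  qed
  have fin: "finite ({..<k} \<rightarrow>\<^sub>E B)" by (simp add: finite_PiE B)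
  have "(\<Sum>b\<in>B. x b) ^ k = (\<Prod>i<k. \<Sum>b\<in>B. x b)" by simp
  also have "\<dots> = (\<Sum>w\<in>{..<k} \<rightarrow>\<^sub>E B. \<Prod>i<k. x (w i))" by (rule prod_sum_PiE) (use B in auto)
  also have "\<dots> = (\<Sum>w\<in>{..<k} \<rightarrow>\<^sub>E B. \<Prod>b\<in>B. x b ^ cnt w b)" by (rule sum.cong) (simp_all add: cnt)
  also have "\<dots> = (\<Sum>\<alpha>\<in>multi_indices B k. \<Sum>w\<in>{w \<in> {..<k} \<rightarrow>\<^sub>E B. cnt w = \<alpha>}. \<Prod>b\<in>B. x b ^ cnt w b)"
  proof (rule sum.group[symmetric, OF fin finite_multi_indices[OF B]])
    show "cnt ` ({..<k} \<rightarrow>\<^sub>E B) \<subseteq> multi_indices B k"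
    proof (rule image_subsetI)
      fix w assume "w \<in> {..<k} \<rightarrow>\<^sub>E B"
      from sum_cnt[OF this] show "cnt w \<in> multi_indices B k"
        by (simp add: multi_indices_def) (simp add: cnt_def)
    qed
  qed
  also have "\<dots> = (\<Sum>\<alpha>\<in>multi_indices B k. of_nat (multinomial B \<alpha>) * (\<Prod>b\<in>B. x b ^ \<alpha> b))"
  proof (rule sum.cong[OF refl])
    fix \<alpha> assume \<alpha>: "\<alpha> \<in> multi_indices B k"
    then have "multinomial B \<alpha> = card {w \<in> {..<k} \<rightarrow>\<^sub>E B. cnt w = \<alpha>}"
      by (simp add: multinomial_def multi_indices_def cnt_def)
    then show "(\<Sum>w\<in>{w \<in> {..<k} \<rightarrow>\<^sub>E B. cnt w = \<alpha>}. \<Prod>b\<in>B. x b ^ cnt w b) =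
        of_nat (multinomial B \<alpha>) * (\<Prod>b\<in>B. x b ^ \<alpha> b)"
      by simp
  qed
  finally show ?thesis .
qed

lemma has_sum_multi_indices:
  "((\<lambda>(k, \<alpha>). f \<alpha>) has_sum s) (Sigma UNIV (multi_indices B)) \<longleftrightarrow> (f has_sum s) (B \<rightarrow>\<^sub>E UNIV)"
  by (rule has_sum_reindex_bij_witness[where j = snd and i = "\<lambda>\<alpha>. (sum \<alpha> B, \<alpha>)"])
    (auto simp: multi_indices_def)

lemma has_sum_homogeneous:
  fixes f :: "('b \<Rightarrow> nat) \<Rightarrow> 'c::euclidean_space"
  assumes "(f has_sum s) (B \<rightarrow>\<^sub>E UNIV)" "finite B"
  shows "(\<lambda>k. \<Sum>\<alpha>\<in>multi_indices B k. f \<alpha>) sums s"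
proof -
  have "((\<lambda>(k, \<alpha>). f \<alpha>) has_sum s) (Sigma UNIV (multi_indices B))"
    using assms(1) by (simp only: has_sum_multi_indices)
  then have "((\<lambda>k. \<Sum>\<alpha>\<in>multi_indices B k. f \<alpha>) has_sum s) UNIV"
    by (rule has_sum_SigmaD) (auto intro!: has_sum_finite finite_multi_indices assms(2))
  then show ?thesis by (rule has_sum_imp_sums)
qed

text \<open>
  Absolute summability makes the family of all monomials summable, and grouping it by degree
  identifies its sum.
\<close>
lemma homogeneous_has_sum:
  fixes f :: "('b \<Rightarrow> nat) \<Rightarrow> 'c::banach"
  assumes sums: "(\<lambda>k. \<Sum>\<alpha>\<in>multi_indices B k. f \<alpha>) sums s" and B: "finite B"
    and summable: "summable (\<lambda>k. \<Sum>\<alpha>\<in>multi_indices B k. norm (f \<alpha>))"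
  shows "(f has_sum s) (B \<rightarrow>\<^sub>E UNIV)"
proof -
  note fin = finite_multi_indices[OF B]
  have "(\<lambda>p. norm ((\<lambda>(k, \<alpha>). f \<alpha>) p)) summable_on Sigma UNIV (multi_indices B)"
  proof (subst Infinite_Sum.abs_summable_on_Sigma_iff, intro conjI ballI)
    have "(\<lambda>k. norm (\<Sum>\<alpha>\<in>multi_indices B k. norm (f \<alpha>))) summable_on UNIV"
      using summable by (intro summable_nonneg_imp_summable_on) (auto simp: sum_nonneg)
    then show "(\<lambda>k. norm (\<Sum>\<^sub>\<infinity>\<alpha>\<in>multi_indices B k. norm ((\<lambda>(k, \<alpha>). f \<alpha>) (k, \<alpha>)))) summable_on UNIV"
      using fin by simp
  qed (use fin in auto)
  then have "(\<lambda>(k, \<alpha>). f \<alpha>) summable_on Sigma UNIV (multi_indices B)"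
    by (rule abs_summable_summable)
  then obtain s' where s': "((\<lambda>(k, \<alpha>). f \<alpha>) has_sum s') (Sigma UNIV (multi_indices B))"
    by (auto simp: summable_on_def)
  have "((\<lambda>k. \<Sum>\<alpha>\<in>multi_indices B k. f \<alpha>) has_sum s') UNIV"
    using s' by (rule has_sum_SigmaD) (auto intro!: has_sum_finite fin)
  then have "s' = s" using has_sum_imp_sums sums sums_unique2 by blast
  with s' show ?thesis by (simp only: has_sum_multi_indices)
qed

lemma summable_on_norm_euclidean:
  fixes f :: "'a \<Rightarrow> 'b::euclidean_space"
  assumes "f summable_on A"
  shows "(\<lambda>x. norm (f x)) summable_on A"
proof (rule Infinite_Sum.abs_summable_on_comparison_test')
  have "(\<lambda>x. f x \<bullet> b) summable_on A" for b
    using assms by (rule summable_on_bounded_linear[OF bounded_linear_inner_left])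
  then have abs: "(\<lambda>x. \<bar>f x \<bullet> b\<bar>) summable_on A" for b
    using summable_on_iff_abs_summable_on_real by force
  have "(\<lambda>x. \<Sum>b\<in>B. \<bar>f x \<bullet> b\<bar>) summable_on A" if "finite B" for B
    using that by induction (auto intro: summable_on_add abs)
  then show "(\<lambda>x. \<Sum>b\<in>Basis. \<bar>f x \<bullet> b\<bar>) summable_on A"
    by simp
  show "norm (f x) \<le> (\<Sum>b\<in>Basis. \<bar>f x \<bullet> b\<bar>)" for x by (rule norm_le_l1)
qed

text \<open>
  The terms of degree at least two are \<open>O(\<parallel>y\<parallel>\<^sup>2)\<close>, by comparison with a geometric series.
\<close>
lemma has_derivative_homogeneous_series:
  fixes F :: "'a::euclidean_space \<Rightarrow> 'b::banach"
  assumes r: "r > 0" and sums: "\<And>y. norm y < r \<Longrightarrow> (\<lambda>k. Q k y) sums F (p + y)"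
    and bound: "\<And>k y. norm y < r \<Longrightarrow> norm (Q k y) \<le> M * (K * norm y) ^ k"
    and Q0: "\<And>y. Q 0 y = Q 0 0" and Q1: "linear (Q 1)" and K: "K > 0"
  shows "(F has_derivative Q 1) (at p)"
proof (rule has_derivativeI_sandwich)
  define e where "e = min r (1 / (2 * K))"
  show "e > 0" using r K by (simp add: e_def)
  show "bounded_linear (Q 1)" using Q1 by (rule linear_conv_bounded_linear[THEN iffD1])
  have M: "M \<ge> 0"
    using order_trans[OF norm_ge_zero bound[of 0 0]] r by simp
  have Qk: "Q (Suc k) 0 = 0" for k using bound[of 0 "Suc k"] r by simp
  have "(\<lambda>k. Q k 0) sums (\<Sum>k\<in>{0}. Q k 0)"
    by (rule sums_finite) (auto simp: Qk gr0_conv_Suc)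
  then have F_p: "F p = Q 0 0" using sums_unique2[OF _ sums[of 0]] r by simp
  show "norm ((F x - F p) - Q 1 (x - p)) / norm (x - p) \<le> 2 * M * K\<^sup>2 * norm (x - p)"
    if "x \<noteq> p" "dist x p < e" for x
  proof -
    define y where "y = x - p"
    have y: "norm y < r" "K * norm y < 1 / 2" "y \<noteq> 0"
      using that K by (auto simp: y_def e_def dist_norm field_simps)
    have Kn: "0 \<le> K * norm y" using K by simp
    have "(\<lambda>k. Q (k + 2) y) sums (F (p + y) - (\<Sum>k<2. Q k y))"
      using sums[OF y(1)] by (subst sums_iff_shift) simp
    then have s: "(\<lambda>k. Q (k + 2) y) sums ((F x - F p) - Q 1 (x - p))"
      using Q0[of y] by (simp add: F_p y_def numeral_2_eq_2 algebra_simps)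
    have g: "(\<lambda>k. (K * norm y) ^ k) sums (1 / (1 - K * norm y))"
      using y Kn by (intro geometric_sums) simp
    have g2: "(\<lambda>k. M * (K * norm y)\<^sup>2 * (K * norm y) ^ k) sums (M * (K * norm y)\<^sup>2 * (1 / (1 - K * norm y)))"
      by (rule sums_mult[OF g])
    have "norm ((F x - F p) - Q 1 (x - p)) \<le> M * (K * norm y)\<^sup>2 * (1 / (1 - K * norm y))"
      unfolding sums_unique[OF s] sums_unique[OF g2]
    proof (rule norm_suminf_le[OF _ sums_summable[OF g2]])
      show "norm (Q (k + 2) y) \<le> M * (K * norm y)\<^sup>2 * (K * norm y) ^ k" for k
        using bound[OF y(1), of "k + 2"] by (simp only: power_add mult_ac)
    qed
    also have "\<dots> \<le> M * (K * norm y)\<^sup>2 * 2"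
      using y M by (intro mult_left_mono) (auto simp: field_simps)
    finally show ?thesis
      using y by (simp add: y_def[symmetric] field_simps power2_eq_square)
  qed
  show "((\<lambda>x. 2 * M * K\<^sup>2 * norm (x - p)) \<longlongrightarrow> 0) (at p within UNIV)"
    by (auto intro!: tendsto_eq_intros)
qed

definition analytic_at_point :: "('a::euclidean_space \<Rightarrow> 'b::real_normed_vector) \<Rightarrow> 'a \<Rightarrow> bool"
  where "analytic_at_point F p \<longleftrightarrow> (\<exists>r>0. \<exists>c :: ('a \<Rightarrow> nat) \<Rightarrow> 'b. \<forall>x\<in>ball p r.
    ((\<lambda>\<alpha>. (\<Prod>b\<in>Basis. ((x - p) \<bullet> b) ^ \<alpha> b) *\<^sub>R c \<alpha>) has_sum F x) (Basis \<rightarrow>\<^sub>E UNIV))"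

lemma real_analytic_on_iff: "real_analytic_on F S \<longleftrightarrow> (\<forall>p\<in>S. analytic_at_point F p)"
  by (simp add: real_analytic_on_def analytic_at_point_def)

lemma analytic_at_point_add:
  assumes "analytic_at_point F p" "analytic_at_point G p"
  shows "analytic_at_point (\<lambda>x. F x + G x) p"
proof -
  obtain r c where F: "r > 0" "\<And>x. x \<in> ball p r \<Longrightarrow>
      ((\<lambda>\<alpha>. (\<Prod>b\<in>Basis. ((x - p) \<bullet> b) ^ \<alpha> b) *\<^sub>R c \<alpha>) has_sum F x) (Basis \<rightarrow>\<^sub>E UNIV)"
    using assms(1) unfolding analytic_at_point_def by blast
  obtain s d where G: "s > 0" "\<And>x. x \<in> ball p s \<Longrightarrow>
      ((\<lambda>\<alpha>. (\<Prod>b\<in>Basis. ((x - p) \<bullet> b) ^ \<alpha> b) *\<^sub>R d \<alpha>) has_sum G x) (Basis \<rightarrow>\<^sub>E UNIV)"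
    using assms(2) unfolding analytic_at_point_def by blast
  show ?thesis
    unfolding analytic_at_point_def
    using has_sum_add[OF F(2) G(2)] F(1) G(1)
    by (intro exI[of _ "min r s"] conjI exI[of _ "\<lambda>\<alpha>. c \<alpha> + d \<alpha>"]) (auto simp: scaleR_add_right)
qed

lemma analytic_at_point_bounded_linear:
  assumes "analytic_at_point F p" "bounded_linear h"
  shows "analytic_at_point (\<lambda>x. h (F x)) p"
proof -
  obtain r c where F: "r > 0" "\<And>x. x \<in> ball p r \<Longrightarrow>
      ((\<lambda>\<alpha>. (\<Prod>b\<in>Basis. ((x - p) \<bullet> b) ^ \<alpha> b) *\<^sub>R c \<alpha>) has_sum F x) (Basis \<rightarrow>\<^sub>E UNIV)"
    using assms(1) unfolding analytic_at_point_def by blast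
  interpret h: bounded_linear h by fact
  show ?thesis
    unfolding analytic_at_point_def
    using has_sum_bounded_linear[OF assms(2) F(2)] F(1)
    by (intro exI[of _ r] conjI exI[of _ "\<lambda>\<alpha>. h (c \<alpha>)"]) (auto simp: h.scaleR o_def)
qed

text \<open>
  Summability at the single point \<open>z = (e, \<dots>, e)\<close> bounds the homogeneous part of degree \<open>k\<close> by
  \<open>M (\<parallel>y\<parallel> / e)\<^sup>k\<close>.
\<close>
lemma analytic_at_point_differentiable:
  fixes F :: "'a::euclidean_space \<Rightarrow> 'b::euclidean_space"
  assumes "analytic_at_point F p"
  shows "F differentiable at p"
proof -
  obtain r c where r: "r > 0" and F: "\<And>x. x \<in> ball p r \<Longrightarrow>
      ((\<lambda>\<alpha>. (\<Prod>b\<in>Basis. ((x - p) \<bullet> b) ^ \<alpha> b) *\<^sub>R c \<alpha>) has_sum F x) (Basis \<rightarrow>\<^sub>E UNIV)"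
    using assms(1) unfolding analytic_at_point_def by blast
  define Q where "Q k y = (\<Sum>\<alpha>\<in>multi_indices Basis k. (\<Prod>b\<in>Basis. (y \<bullet> b) ^ \<alpha> b) *\<^sub>R c \<alpha>)" for k y
  have sums: "(\<lambda>k. Q k y) sums F (p + y)" if "norm y < r" for y
    using has_sum_homogeneous[OF F[of "p + y"]] that by (simp add: Q_def dist_norm)
  define e where "e = r / (2 * DIM('a))"
  have e: "e > 0" using r by (simp add: e_def)
  define z :: 'a where "z = (\<Sum>b\<in>Basis. e *\<^sub>R b)"
  have "norm z \<le> (\<Sum>b\<in>Basis. \<bar>z \<bullet> b\<bar>)" by (rule norm_le_l1)
  also have "\<dots> = r / 2" using r e by (simp add: z_def e_def inner_sum_left_Basis)
  also have "\<dots> < r" using r by simp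
  finally have "((\<lambda>\<alpha>. (\<Prod>b\<in>Basis. (z \<bullet> b) ^ \<alpha> b) *\<^sub>R c \<alpha>) has_sum F (p + z)) (Basis \<rightarrow>\<^sub>E UNIV)"
    using F[of "p + z"] by (simp add: dist_norm)
  then have S: "(\<lambda>\<alpha>. norm ((\<Prod>b\<in>Basis. (z \<bullet> b) ^ \<alpha> b) *\<^sub>R c \<alpha>)) summable_on (Basis \<rightarrow>\<^sub>E UNIV)"
    by (intro summable_on_norm_euclidean) (auto simp: summable_on_def)
  define M where "M = (\<Sum>\<^sub>\<infinity>\<alpha>\<in>Basis \<rightarrow>\<^sub>E UNIV. norm ((\<Prod>b\<in>Basis. (z \<bullet> b) ^ \<alpha> b) *\<^sub>R c \<alpha>))"
  have M: "(\<Sum>\<alpha>\<in>multi_indices Basis k. e ^ k * norm (c \<alpha>)) \<le> M" for k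
  proof -
    have "(\<Sum>\<alpha>\<in>multi_indices Basis k. e ^ k * norm (c \<alpha>)) =
        (\<Sum>\<alpha>\<in>multi_indices Basis k. norm ((\<Prod>b\<in>Basis. (z \<bullet> b) ^ \<alpha> b) *\<^sub>R c \<alpha>))"
      using e by (intro sum.cong)
        (auto simp: z_def inner_sum_left_Basis multi_indices_def abs_mult power_sum abs_prod)
    also have "\<dots> \<le> M"
      unfolding M_def by (rule finite_sum_le_infsum[OF S]) (auto simp: finite_multi_indices, auto simp: multi_indices_def)
    finally show ?thesis .
  qed
  have "(F has_derivative Q 1) (at p)"
  proof (rule has_derivative_homogeneous_series[where Q = Q and p = p, OF r sums])
    show "norm (Q k y) \<le> M * (1 / e * norm y) ^ k" if "norm y < r" for k y
    proof -
      have "norm (Q k y) \<le> (\<Sum>\<alpha>\<in>multi_indices Basis k. norm y ^ k * norm (c \<alpha>))"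
        unfolding Q_def
      proof (rule sum_norm_le)
        fix \<alpha> :: "'a \<Rightarrow> nat" assume \<alpha>: "\<alpha> \<in> multi_indices Basis k"
        have "\<bar>\<Prod>b\<in>Basis. (y \<bullet> b) ^ \<alpha> b\<bar> \<le> (\<Prod>b\<in>Basis. norm y ^ \<alpha> b)"
          unfolding abs_prod power_abs by (intro prod_mono) (auto intro!: power_mono Basis_le_norm)
        also have "\<dots> = norm y ^ k" using \<alpha> by (simp add: multi_indices_def flip: power_sum)
        finally show "norm ((\<Prod>b\<in>Basis. (y \<bullet> b) ^ \<alpha> b) *\<^sub>R c \<alpha>) \<le> norm y ^ k * norm (c \<alpha>)"
          by (simp add: mult_right_mono)
      qed
      also have "\<dots> = (1 / e * norm y) ^ k * (\<Sum>\<alpha>\<in>multi_indices Basis k. e ^ k * norm (c \<alpha>))"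
        using e by (simp add: sum_distrib_left power_mult_distrib power_divide field_simps)
      also have "\<dots> \<le> (1 / e * norm y) ^ k * M"
        using e by (intro mult_left_mono M) auto
      finally show ?thesis by (simp add: mult.commute)
    qed
    show "Q 0 y = Q 0 0" for y
      unfolding Q_def by (intro sum.cong refl) (auto simp: multi_indices_def)
    show "linear (Q 1)"
    proof -
      have "linear (\<lambda>y. (\<Prod>b\<in>Basis. (y \<bullet> b) ^ \<alpha> b) *\<^sub>R c \<alpha>)" if \<alpha>: "\<alpha> \<in> multi_indices Basis 1" for \<alpha>
      proof -
        obtain b where b: "b \<in> Basis" "\<alpha> b = 1" "\<And>b'. b' \<in> Basis \<Longrightarrow> b' \<noteq> b \<Longrightarrow> \<alpha> b' = 0"
          using \<alpha> sum_eq_1_iff[of Basis \<alpha>] by (auto simp: multi_indices_def)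
        have "(\<Prod>b\<in>Basis. (y \<bullet> b) ^ \<alpha> b) = y \<bullet> b" for y
        proof -
          have "(\<Prod>b'\<in>Basis. (y \<bullet> b') ^ \<alpha> b') = (\<Prod>b'\<in>Basis. if b' = b then y \<bullet> b else 1)"
            using b by (intro prod.cong) auto
          then show ?thesis using b by simp
        qed
        then show ?thesis by (simp add: linear_iff inner_add_left scaleR_add_left)
      qed
      then show ?thesis unfolding Q_def by (intro linear_compose_sum) auto
    qed
  qed (use e in auto)
  then show ?thesis by (auto simp: differentiable_def)
qed

lemma (in finite_measure) norm_integral_le:
  fixes g :: "'a \<Rightarrow> 'b::{banach, second_countable_topology}"
  assumes "integrable M g" "\<And>\<omega>. \<omega> \<in> space M \<Longrightarrow> norm (g \<omega>) \<le> B"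
  shows "norm (\<integral>\<omega>. g \<omega> \<partial>M) \<le> B * measure M (space M)"
proof -
  have "norm (\<integral>\<omega>. g \<omega> \<partial>M) \<le> (\<integral>\<omega>. norm (g \<omega>) \<partial>M)" by (rule integral_norm_bound)
  also have "\<dots> \<le> (\<integral>\<omega>. B \<partial>M)"
    using assms by (intro integral_mono) auto
  finally show ?thesis by (simp add: mult.commute)
qed

text \<open>
  Integrals of ridge functions \<open>G(y, \<omega>) = \<Sum>\<^sub>k L\<^sub>k(\<omega>)((ev \<omega> y)\<^sup>k)\<close>, where \<open>ev \<omega>\<close> is a complex linear form in
  \<open>y\<close>. The multinomial theorem turns \<open>(ev \<omega> y)\<^sup>k\<close> into monomials in \<open>y\<close> with coefficients depending on
  \<open>\<omega>\<close>, and these are integrated one by one. As \<open>ev \<omega>\<close> is at most one on the basis, the bound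
  \<open>C K\<^sup>k\<close> on \<open>L\<^sub>k\<close> makes the monomials of degree \<open>k\<close> contribute at most a multiple of
  \<open>(K \<Sum>\<^sub>b |y\<^sub>b|)\<^sup>k\<close>, which gives absolute convergence for small \<open>y\<close>.
\<close>
lemma ridge_integral:
  fixes ev :: "'w \<Rightarrow> 'a::euclidean_space \<Rightarrow> complex"
    and L :: "nat \<Rightarrow> 'w \<Rightarrow> complex \<Rightarrow> 'b::euclidean_space" and F :: "'a \<Rightarrow> 'b"
  assumes "finite_measure M"
    and ev: "\<And>\<omega>. \<omega> \<in> space M \<Longrightarrow> linear (ev \<omega>)"
      "\<And>\<omega> b. \<omega> \<in> space M \<Longrightarrow> b \<in> Basis \<Longrightarrow> cmod (ev \<omega> b) \<le> 1"
    and L: "\<And>k \<omega>. \<omega> \<in> space M \<Longrightarrow> linear (L k \<omega>)"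
      "\<And>k \<omega> z. \<omega> \<in> space M \<Longrightarrow> norm (L k \<omega> z) \<le> C * K ^ k * cmod z"
    and int: "\<And>k \<alpha>. integrable M (\<lambda>\<omega>. L k \<omega> (\<Prod>b\<in>Basis. ev \<omega> b ^ \<alpha> b))"
    and pos: "r > 0" "K > 0" "C \<ge> 0"
    and sums: "\<And>y \<omega>. norm y < r \<Longrightarrow> \<omega> \<in> space M \<Longrightarrow> (\<lambda>k. L k \<omega> (ev \<omega> y ^ k)) sums G y \<omega>"
    and F: "\<And>y. norm y < r \<Longrightarrow> F (p + y) = (\<integral>\<omega>. G y \<omega> \<partial>M)"
  shows "analytic_at_point F p" "(F has_derivative (\<lambda>y. \<integral>\<omega>. L 1 \<omega> (ev \<omega> y) \<partial>M)) (at p)"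
proof -
  interpret finite_measure M by fact
  define \<mu> where "\<mu> = measure M (space M)"
  have \<mu>: "\<mu> \<ge> 0" by (simp add: \<mu>_def)
  define m where "m \<alpha> \<omega> = (\<Prod>b\<in>Basis. ev \<omega> b ^ \<alpha> b)" for \<alpha> and \<omega>
  define c where "c \<alpha> = of_nat (multinomial Basis \<alpha>) *\<^sub>R (\<integral>\<omega>. L (sum \<alpha> Basis) \<omega> (m \<alpha> \<omega>) \<partial>M)" for \<alpha>
  define mono where "mono y \<alpha> = (\<Prod>b\<in>Basis. (y \<bullet> b) ^ \<alpha> b)" for y :: 'a and \<alpha>
  define Q where "Q k y = (\<integral>\<omega>. L k \<omega> (ev \<omega> y ^ k) \<partial>M)" for k y
  define N where "N y = (\<Sum>b\<in>Basis. \<bar>y \<bullet> b\<bar>)" for y :: 'a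
  have N_nonneg: "N y \<ge> 0" for y by (simp add: N_def sum_nonneg)
  have N_le: "N y \<le> DIM('a) * norm y" for y
    unfolding N_def using sum_bounded_above[of Basis "\<lambda>b. \<bar>y \<bullet> b\<bar>" "norm y"] Basis_le_norm by auto
  have ev_eq: "ev \<omega> y = (\<Sum>b\<in>Basis. (y \<bullet> b) *\<^sub>R ev \<omega> b)" if \<omega>: "\<omega> \<in> space M" for \<omega> y
    by (subst euclidean_representation[of y, symmetric])
      (simp only: linear_sum[OF ev(1)[OF \<omega>]] linear_cmul[OF ev(1)[OF \<omega>]])
  have ev_le: "cmod (ev \<omega> y) \<le> N y" if \<omega>: "\<omega> \<in> space M" for \<omega> y
    unfolding ev_eq[OF \<omega>, of y] N_def
  proof (rule sum_norm_le)
    fix b :: 'a assume "b \<in> Basis"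
    from mult_left_le[OF ev(2)[OF \<omega> this], of "\<bar>y \<bullet> b\<bar>"]
    show "cmod ((y \<bullet> b) *\<^sub>R ev \<omega> b) \<le> \<bar>y \<bullet> b\<bar>" by simp
  qed
  have expand: "L k \<omega> (ev \<omega> y ^ k) =
      (\<Sum>\<alpha>\<in>multi_indices Basis k. (mono y \<alpha> * of_nat (multinomial Basis \<alpha>)) *\<^sub>R L k \<omega> (m \<alpha> \<omega>))"
    if \<omega>: "\<omega> \<in> space M" for k \<omega> y
  proof -
    have "ev \<omega> y ^ k = (\<Sum>\<alpha>\<in>multi_indices Basis k. of_nat (multinomial Basis \<alpha>) *
        (\<Prod>b\<in>Basis. ((y \<bullet> b) *\<^sub>R ev \<omega> b) ^ \<alpha> b))"
      unfolding ev_eq[OF \<omega>, of y] by (rule power_sum_multinomial) simp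
    also have "\<dots> = (\<Sum>\<alpha>\<in>multi_indices Basis k. (mono y \<alpha> * of_nat (multinomial Basis \<alpha>)) *\<^sub>R m \<alpha> \<omega>)"
      by (intro sum.cong refl)
        (simp add: scaleR_conv_of_real power_mult_distrib prod.distrib mono_def m_def mult_ac)
    finally show ?thesis
      by (simp only: linear_sum[OF L(1)[OF \<omega>]] linear_cmul[OF L(1)[OF \<omega>]])
  qed
  have int_m: "integrable M (\<lambda>\<omega>. L k \<omega> (m \<alpha> \<omega>))" for k \<alpha>
    using int[of k \<alpha>] by (simp add: m_def)
  have int_ev: "integrable M (\<lambda>\<omega>. L k \<omega> (ev \<omega> y ^ k))" for k y
    by (subst Bochner_Integration.integrable_cong[OF refl expand]) (auto intro!: int_m)
  have Q_eq: "Q k y = (\<Sum>\<alpha>\<in>multi_indices Basis k. mono y \<alpha> *\<^sub>R c \<alpha>)" for k y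
  proof -
    have "Q k y = (\<Sum>\<alpha>\<in>multi_indices Basis k. (mono y \<alpha> * of_nat (multinomial Basis \<alpha>)) *\<^sub>R
        (\<integral>\<omega>. L k \<omega> (m \<alpha> \<omega>) \<partial>M))"
      unfolding Q_def
      by (subst Bochner_Integration.integral_cong[OF refl expand]) (auto simp: int_m)
    then show ?thesis by (simp add: c_def multi_indices_def)
  qed
  have L_ev: "norm (L k \<omega> (ev \<omega> y ^ k)) \<le> C * (K * N y) ^ k" if \<omega>: "\<omega> \<in> space M" for k \<omega> y
  proof -
    have "norm (L k \<omega> (ev \<omega> y ^ k)) \<le> C * K ^ k * cmod (ev \<omega> y) ^ k"
      using L(2)[OF \<omega>, of k "ev \<omega> y ^ k"] by (simp add: norm_power)
    also have "\<dots> \<le> C * K ^ k * N y ^ k"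
      using pos ev_le[OF \<omega>] by (intro mult_left_mono power_mono) auto
    finally show ?thesis by (simp add: power_mult_distrib mult_ac)
  qed
  have Q_bound: "norm (Q k y) \<le> C * (K * N y) ^ k * \<mu>" for k y
    unfolding Q_def \<mu>_def by (rule norm_integral_le[OF int_ev L_ev])
  \<comment> \<open>Small enough for \<open>K N(y) < 1\<close>, where \<open>N\<close> is the sum norm.\<close>
  define s where "s = min r (1 / (2 * K * DIM('a)))"
  have s: "s > 0" "s \<le> r" using pos by (simp_all add: s_def)
  have KN: "\<bar>K * N y\<bar> < 1" if "norm y < s" for y
  proof -
    have "K * N y \<le> K * (DIM('a) * norm y)" using pos N_le by (intro mult_left_mono) auto
    also have "\<dots> < K * (DIM('a) * (1 / (2 * K * DIM('a))))"
      using that pos by (intro mult_strict_left_mono) (auto simp: s_def)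
    also have "\<dots> = 1 / 2" using pos by (simp add: field_simps)
    finally show ?thesis using pos N_nonneg[of y] by simp
  qed
  have Q_sums: "(\<lambda>k. Q k y) sums F (p + y)" if y: "norm y < s" for y
  proof -
    have geo: "summable (\<lambda>k. C * (K * N y) ^ k)"
      using KN[OF y] by (intro summable_mult summable_geometric) simp
    have "(\<lambda>k. Q k y) sums (\<integral>\<omega>. (\<Sum>k. L k \<omega> (ev \<omega> y ^ k)) \<partial>M)"
      unfolding Q_def
    proof (rule sums_integral[OF int_ev])
      show "AE \<omega> in M. summable (\<lambda>k. norm (L k \<omega> (ev \<omega> y ^ k)))"
        by (intro AE_I2 summable_comparison_test_ev[OF _ geo] always_eventually allI) (simp add: L_ev)
      have "norm (\<integral>\<omega>. norm (L k \<omega> (ev \<omega> y ^ k)) \<partial>M) \<le> C * (K * N y) ^ k * \<mu>" for k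
        unfolding \<mu>_def by (rule norm_integral_le) (auto intro: integrable_norm int_ev L_ev)
      then show "summable (\<lambda>k. \<integral>\<omega>. norm (L k \<omega> (ev \<omega> y ^ k)) \<partial>M)"
        by (intro summable_comparison_test_ev[OF _ summable_mult2[OF geo, of \<mu>]] always_eventually) simp
    qed
    also have "(\<integral>\<omega>. (\<Sum>k. L k \<omega> (ev \<omega> y ^ k)) \<partial>M) = (\<integral>\<omega>. G y \<omega> \<partial>M)"
      using sums[of y] y s by (intro Bochner_Integration.integral_cong refl) (simp add: sums_iff)
    also have "\<dots> = F (p + y)" using F[of y] y s by simp
    finally show ?thesis .
  qed
  show "analytic_at_point F p"
    unfolding analytic_at_point_def
  proof (intro exI[of _ s] exI[of _ c] conjI ballI s)
    fix x assume "x \<in> ball p s"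
    then have y: "norm (x - p) < s" by (simp add: dist_norm norm_minus_commute)
    have "((\<lambda>\<alpha>. mono (x - p) \<alpha> *\<^sub>R c \<alpha>) has_sum F (p + (x - p))) (Basis \<rightarrow>\<^sub>E UNIV)"
    proof (rule homogeneous_has_sum)
      show "(\<lambda>k. \<Sum>\<alpha>\<in>multi_indices Basis k. mono (x - p) \<alpha> *\<^sub>R c \<alpha>) sums F (p + (x - p))"
        using Q_sums[OF y] by (simp only: Q_eq)
      have c_le: "norm (c \<alpha>) \<le> multinomial Basis \<alpha> * (C * K ^ k * \<mu>)" if "\<alpha> \<in> multi_indices Basis k" for \<alpha> k
      proof -
        have "norm (\<integral>\<omega>. L k \<omega> (m \<alpha> \<omega>) \<partial>M) \<le> C * K ^ k * \<mu>"
          unfolding \<mu>_def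
        proof (rule norm_integral_le[OF int_m])
          fix \<omega> assume \<omega>: "\<omega> \<in> space M"
          have "cmod (m \<alpha> \<omega>) \<le> 1"
            unfolding m_def prod_norm[symmetric] norm_power
            by (intro prod_le_1) (auto intro: power_le_one ev(2)[OF \<omega>])
          then have "C * K ^ k * cmod (m \<alpha> \<omega>) \<le> C * K ^ k * 1"
            using pos by (intro mult_left_mono) auto
          then show "norm (L k \<omega> (m \<alpha> \<omega>)) \<le> C * K ^ k"
            using L(2)[OF \<omega>, of k "m \<alpha> \<omega>"] by simp
        qed
        then show ?thesis using that by (simp add: c_def multi_indices_def mult_left_mono)
      qed
      have le: "(\<Sum>\<alpha>\<in>multi_indices Basis k. norm (mono (x - p) \<alpha> *\<^sub>R c \<alpha>)) \<le> C * \<mu> * (K * N (x - p)) ^ k" for k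
      proof -
        have "(\<Sum>\<alpha>\<in>multi_indices Basis k. norm (mono (x - p) \<alpha> *\<^sub>R c \<alpha>)) \<le>
            (\<Sum>\<alpha>\<in>multi_indices Basis k. \<bar>mono (x - p) \<alpha>\<bar> * (multinomial Basis \<alpha> * (C * K ^ k * \<mu>)))"
          using c_le by (intro sum_mono) (simp add: mult_left_mono)
        also have "\<dots> = C * K ^ k * \<mu> * (\<Sum>\<alpha>\<in>multi_indices Basis k.
            multinomial Basis \<alpha> * (\<Prod>b\<in>Basis. \<bar>(x - p) \<bullet> b\<bar> ^ \<alpha> b))"
          by (simp add: mono_def abs_prod power_abs sum_distrib_left mult_ac)
        also have "\<dots> = C * K ^ k * \<mu> * N (x - p) ^ k"
          unfolding N_def by (subst power_sum_multinomial) simp_all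
        finally show ?thesis by (simp add: power_mult_distrib mult_ac)
      qed
      show "summable (\<lambda>k. \<Sum>\<alpha>\<in>multi_indices Basis k. norm (mono (x - p) \<alpha> *\<^sub>R c \<alpha>))"
      proof (rule summable_comparison_test_ev)
        show "summable (\<lambda>k. C * \<mu> * (K * N (x - p)) ^ k)"
          using KN[OF y] by (intro summable_mult summable_geometric) simp
        show "\<forall>\<^sub>F k in sequentially. norm (\<Sum>\<alpha>\<in>multi_indices Basis k. norm (mono (x - p) \<alpha> *\<^sub>R c \<alpha>)) \<le>
            C * \<mu> * (K * N (x - p)) ^ k"
          using le by (intro always_eventually allI) (simp add: sum_nonneg)
      qed
    qed simp
    then show "((\<lambda>\<alpha>. (\<Prod>b\<in>Basis. ((x - p) \<bullet> b) ^ \<alpha> b) *\<^sub>R c \<alpha>) has_sum F x) (Basis \<rightarrow>\<^sub>E UNIV)"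
      by (simp add: mono_def)
  qed
  have "(F has_derivative Q 1) (at p)"
  proof (rule has_derivative_homogeneous_series[where Q = Q and p = p, OF s(1) Q_sums])
    show "norm (Q k y) \<le> (C * \<mu>) * ((K * DIM('a)) * norm y) ^ k" for k y
    proof -
      have "C * (K * N y) ^ k * \<mu> \<le> C * (K * (DIM('a) * norm y)) ^ k * \<mu>"
        using pos N_nonneg N_le \<mu> by (intro mult_left_mono mult_right_mono power_mono) auto
      with Q_bound[of k y] show ?thesis by (simp add: mult_ac)
    qed
    show "K * DIM('a) > 0" using pos by simp
    show "Q 0 y = Q 0 0" for y by (simp add: Q_def)
    show "linear (Q 1)"
    proof (rule linearI)
      have int1: "integrable M (\<lambda>\<omega>. L 1 \<omega> (ev \<omega> y))" for y using int_ev[of 1 y] by simp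
      have *: "Q 1 (x + y) = (\<integral>\<omega>. L 1 \<omega> (ev \<omega> x) + L 1 \<omega> (ev \<omega> y) \<partial>M)" for x y
        unfolding Q_def
        by (intro Bochner_Integration.integral_cong refl) (simp add: linear_add[OF ev(1)] linear_add[OF L(1)])
      show "Q 1 (x + y) = Q 1 x + Q 1 y" for x y
        unfolding * by (simp add: Q_def int1[simplified])
      have *: "Q 1 (a *\<^sub>R x) = (\<integral>\<omega>. a *\<^sub>R L 1 \<omega> (ev \<omega> x) \<partial>M)" for a x
        unfolding Q_def
        by (intro Bochner_Integration.integral_cong refl) (simp add: linear_cmul[OF ev(1)] linear_cmul[OF L(1)])
      show "Q 1 (a *\<^sub>R x) = a *\<^sub>R Q 1 x" for a x
        unfolding * by (simp add: Q_def)
    qed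
  qed
  then show "(F has_derivative (\<lambda>y. \<integral>\<omega>. L 1 \<omega> (ev \<omega> y) \<partial>M)) (at p)"
    by (simp add: Q_def[abs_def])
qed

section \<open>The average of a slice extension over all planes\<close>

lemma continuous_on_cplx:
  fixes g :: "(real, 'n::{finite,linorder}) vec \<Rightarrow> complex"
  assumes "continuous_on S g"
  shows "continuous_on S (\<lambda>\<omega>. cplx \<omega> (g \<omega>))"
  unfolding cplx_def
  by (intro continuous_intros assms bounded_linear.continuous_on[OF bounded_linear_cvec])

lemma integral_sphere_cong:
  fixes g :: "(real, 'n::{finite,linorder}) vec \<Rightarrow> 'b::{banach, second_countable_topology}"
  assumes "\<And>\<omega>. norm \<omega> = 1 \<Longrightarrow> g \<omega> = h \<omega>"
  shows "(\<integral>\<omega>. g \<omega> \<partial>sphere_measure) = (\<integral>\<omega>. h \<omega> \<partial>sphere_measure)"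
  using assms by (intro Bochner_Integration.integral_cong refl) simp

text \<open>
  The symbol of \<open>\<partial>\<^sub>x\<^sub>0 + \<Sum>\<^sub>j e\<^sub>j \<partial>\<^sub>x\<^sub>j\<close> applied to a derivative \<open>D\<close>.
\<close>
abbreviation dirac :: "('n::{finite,linorder} pvec \<Rightarrow> 'n clifford) \<Rightarrow> 'n clifford"
  where "dirac D \<equiv> D (1, 0) + (\<Sum>j\<in>UNIV. gen j * D (0, axis j 1))"

text \<open>
  Around \<open>z = x\<^sub>0 + \<i> \<langle>x, \<omega>\<rangle>\<close> the plane wave is a power series in \<open>y\<^sub>0 + \<i> \<langle>y, \<omega>\<rangle>\<close> with coefficients bounded
  uniformly in \<open>\<omega>\<close> by Cauchy's inequality, so \<open>ridge_integral\<close> applies. In the Dirac derivative the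
  coordinate directions contribute \<open>\<Sum>\<^sub>j e\<^sub>j \<omega>\<^sub>j H' \<omega> = \<omega> H' \<omega> = - H'\<close>, which cancels the derivative in
  \<open>x\<^sub>0\<close> for every single \<open>\<omega>\<close>.
\<close>
lemma plane_wave_average_monogenic:
  fixes f :: "real \<Rightarrow> 'n::{finite,linorder} clifford" and x :: "(real, 'n) vec"
  defines "F \<equiv> \<lambda>p. \<integral>\<omega>. slice_ext f (fst p, (snd p \<bullet> \<omega>) *\<^sub>R \<omega>) \<partial>sphere_measure"
  assumes H: "hol_ext f t (2 * r) H" and x: "\<bar>x\<^sub>0 - t\<bar> < r" "norm x < r"
  shows "analytic_at_point F (x\<^sub>0, x)"
    and "\<exists>D. (F has_derivative D) (at (x\<^sub>0, x)) \<and> dirac D = 0"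
proof -
  define q where "q = \<bar>x\<^sub>0 - t\<bar> + norm x"
  \<comment> \<open>The points \<open>z \<omega>\<close> lie within \<open>q\<close> of \<open>t\<close>; half of their minimal distance to the boundary of the disk.\<close>
  define \<delta> where "\<delta> = (2 * r - q) / 2"
  have \<delta>: "\<delta> > 0" "q + 2 * \<delta> = 2 * r"
    using x by (simp add: \<delta>_def q_def, simp add: \<delta>_def field_simps)
  define z where "z \<omega> = Complex x\<^sub>0 (x \<bullet> \<omega>)" for \<omega>
  define ev where "ev \<omega> y = Complex (fst y) (snd y \<bullet> \<omega>)" for \<omega> and y :: "'n pvec"
  have z_dist: "dist (of_real t) (z \<omega>) \<le> q" if "norm \<omega> = 1" for \<omega>
  proof -
    have "dist (of_real t) (z \<omega>) = cmod (Complex (x\<^sub>0 - t) (x \<bullet> \<omega>))"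
      by (simp add: z_def dist_norm cmod_def power2_commute)
    also have "\<dots> \<le> \<bar>x\<^sub>0 - t\<bar> + \<bar>x \<bullet> \<omega>\<bar>" using cmod_le[of "Complex (x\<^sub>0 - t) (x \<bullet> \<omega>)"] by simp
    also have "\<dots> \<le> q" using Cauchy_Schwarz_ineq2[of x \<omega>] that by (simp add: q_def)
    finally show ?thesis .
  qed
  have sub: "cball (z \<omega>) \<delta> \<subseteq> cball (of_real t) (q + \<delta>)" if "norm \<omega> = 1" for \<omega>
  proof
    fix w assume "w \<in> cball (z \<omega>) \<delta>"
    then show "w \<in> cball (of_real t) (q + \<delta>)"
      using z_dist[OF that] dist_triangle[of "of_real t" w "z \<omega>"] by simp
  qed
  have sub2: "cball (of_real t) (q + \<delta>) \<subseteq> ball (complex_of_real t) (2 * r)"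
    using \<delta> by auto
  have z_in: "z \<omega> \<in> ball (of_real t) (2 * r)" if "norm \<omega> = 1" for \<omega>
    using sub[OF that] sub2 \<delta> by (meson centre_in_cball less_imp_le subsetD)
  have hol: "H A holomorphic_on ball (of_real t) (2 * r)" for A
    using H by (simp add: hol_ext_def)
  have "\<exists>B. \<forall>w\<in>cball (of_real t) (q + \<delta>). cmod (H A w) \<le> B" for A
  proof -
    have "continuous_on (cball (of_real t) (q + \<delta>)) (H A)"
      using holomorphic_on_imp_continuous_on[OF hol] sub2 by (rule continuous_on_subset)
    then have "bounded (H A ` cball (of_real t) (q + \<delta>))"
      by (intro compact_imp_bounded compact_continuous_image compact_cball)
    then show ?thesis by (auto simp: bounded_iff)
  qed
  then obtain B where B: "\<And>A w. w \<in> cball (of_real t) (q + \<delta>) \<Longrightarrow> cmod (H A w) \<le> B A"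
    by metis
  have B_nonneg: "B A \<ge> 0" for A
    using order_trans[OF norm_ge_zero B[of "of_real t" A]] x \<delta> by (simp add: q_def)
  have cauchy: "cmod ((deriv ^^ k) (H A) (z \<omega>) / fact k) \<le> B A / \<delta> ^ k" if \<omega>: "norm \<omega> = 1" for k A \<omega>
  proof -
    have "cmod ((deriv ^^ k) (H A) (z \<omega>)) \<le> fact k * B A / \<delta> ^ k"
    proof (rule Cauchy_inequality)
      show "H A holomorphic_on ball (z \<omega>) \<delta>"
        by (rule holomorphic_on_subset[OF hol]) (use sub[OF \<omega>] sub2 ball_subset_cball in blast)
      show "continuous_on (cball (z \<omega>) \<delta>) (H A)"
        by (rule continuous_on_subset[OF holomorphic_on_imp_continuous_on[OF hol]])
          (use sub[OF \<omega>] sub2 in blast)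
      show "cmod (H A w) \<le> B A" if "cmod (z \<omega> - w) = \<delta>" for w
        by (rule B) (use sub[OF \<omega>] that in \<open>auto simp: dist_norm\<close>)
    qed (fact \<delta>)
    then show ?thesis by (simp add: norm_divide field_simps)
  qed
  obtain C0 where C0: "C0 > 0" "\<And>(\<omega> :: (real, 'n) vec) z a. norm \<omega> = 1 \<Longrightarrow>
      norm (cplx \<omega> z * a) \<le> C0 * cmod z * norm a"
    using cplx_mult_bound by metis
  define L where "L k \<omega> w = (\<Sum>A\<in>UNIV. cplx \<omega> ((deriv ^^ k) (H A) (z \<omega>) / fact k * w) * blade A)"
    for k \<omega> w
  define C where "C = (\<Sum>A\<in>UNIV. C0 * B A * norm (blade A :: 'n clifford))"
  have cont_L: "continuous_on (sphere 0 1) (\<lambda>\<omega>. L k \<omega> (g \<omega>))" if "continuous_on (sphere 0 1) g" for k g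
    unfolding L_def
  proof (intro continuous_on_sum bounded_linear.continuous_on[OF bounded_linear_clifford_mult_left]
        continuous_on_cplx continuous_on_mult continuous_on_divide continuous_on_const that ballI)
    fix A
    have "continuous_on (ball (of_real t) (2 * r)) ((deriv ^^ k) (H A))"
      by (intro holomorphic_on_imp_continuous_on holomorphic_higher_deriv hol open_ball)
    then show "continuous_on (sphere 0 1) (\<lambda>\<omega>. (deriv ^^ k) (H A) (z \<omega>))"
      by (rule continuous_on_compose2)
        (use z_in in \<open>auto simp: z_def Complex_eq intro!: continuous_intros\<close>)
  qed simp
  have L_lin: "linear (L k \<omega>)" for k \<omega>
    by (rule linearI) (simp_all only: L_def distrib_left cplx_add distrib_right sum.distrib
        mult_scaleR_right cplx_scaleR mult_scaleR_left scaleR_sum_right)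
  have L_le: "norm (L k \<omega> w) \<le> C * (1 / \<delta>) ^ k * cmod w" if \<omega>: "norm \<omega> = 1" for k \<omega> w
  proof -
    have "norm (L k \<omega> w) \<le> (\<Sum>A\<in>UNIV. C0 * (B A / \<delta> ^ k * cmod w) * norm (blade A :: 'n clifford))"
      unfolding L_def
    proof (rule sum_norm_le)
      fix A
      have "norm (cplx \<omega> ((deriv ^^ k) (H A) (z \<omega>) / fact k * w) * blade A) \<le>
          C0 * (cmod ((deriv ^^ k) (H A) (z \<omega>) / fact k) * cmod w) * norm (blade A :: 'n clifford)"
        using C0(2)[OF \<omega>] by (simp only: norm_mult[symmetric])
      also have "\<dots> \<le> C0 * (B A / \<delta> ^ k * cmod w) * norm (blade A :: 'n clifford)"
        using cauchy[OF \<omega>] C0(1) by (intro mult_right_mono mult_left_mono) auto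
      finally show "norm (cplx \<omega> ((deriv ^^ k) (H A) (z \<omega>) / fact k * w) * blade A) \<le>
          C0 * (B A / \<delta> ^ k * cmod w) * norm (blade A :: 'n clifford)" .
    qed
    also have "\<dots> = C * (1 / \<delta>) ^ k * cmod w"
      unfolding C_def sum_distrib_right power_divide by (intro sum.cong refl) (simp add: mult_ac)
    finally show ?thesis .
  qed
  have ev_le: "cmod (ev \<omega> y) \<le> norm y" if "norm \<omega> = 1" for \<omega> y
  proof -
    have "(snd y \<bullet> \<omega>)\<^sup>2 \<le> (norm (snd y))\<^sup>2"
      using Cauchy_Schwarz_ineq2[of "snd y" \<omega>] that
      by (intro power2_le_iff_abs_le[THEN iffD2]) simp_all
    then show ?thesis
      by (cases y) (simp add: ev_def cmod_def norm_Pair)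
  qed
  have ev_lin: "linear (ev \<omega>)" for \<omega>
    by (rule linearI) (simp_all add: ev_def inner_add_left complex_eq_iff)
  have ridge: "analytic_at_point F (x\<^sub>0, x) \<and>
      (F has_derivative (\<lambda>y. \<integral>\<omega>. L 1 \<omega> (ev \<omega> y) \<partial>sphere_measure)) (at (x\<^sub>0, x))"
  proof (intro conjI)
    note * = ridge_integral[where M = sphere_measure and ev = ev and L = L and C = C and K = "1 / \<delta>" and r = \<delta>
        and G = "\<lambda>y \<omega>. plane_wave H \<omega> (z \<omega> + ev \<omega> y)" and F = F and p = "(x\<^sub>0, x)",
        OF sphere.finite_measure_axioms]
    have 1: "cmod (ev \<omega> b) \<le> 1" if "\<omega> \<in> space sphere_measure" "b \<in> Basis" for \<omega> b
      using ev_le[of \<omega> b] that by simp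
    have 2: "integrable sphere_measure (\<lambda>\<omega>. L k \<omega> (\<Prod>b\<in>Basis. ev \<omega> b ^ \<alpha> b))" for k \<alpha>
      by (intro integrable_sphere_continuous cont_L) (auto simp: ev_def Complex_eq intro!: continuous_intros)
    have 3: "C \<ge> 0" unfolding C_def using C0 B_nonneg by (intro sum_nonneg mult_nonneg_nonneg) auto
    have 4: "(\<lambda>k. L k \<omega> (ev \<omega> y ^ k)) sums plane_wave H \<omega> (z \<omega> + ev \<omega> y)"
      if y: "norm y < \<delta>" and "\<omega> \<in> space sphere_measure" for y \<omega>
    proof -
      have \<omega>: "norm \<omega> = 1" using that by simp
      have "H A holomorphic_on ball (z \<omega>) \<delta>" for A
        by (rule holomorphic_on_subset[OF hol]) (use sub[OF \<omega>] sub2 ball_subset_cball in blast)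
      from holomorphic_power_series[OF this, of "z \<omega> + ev \<omega> y"]
      have "(\<lambda>k. (deriv ^^ k) (H A) (z \<omega>) / fact k * ev \<omega> y ^ k) sums H A (z \<omega> + ev \<omega> y)" for A
        using ev_le[OF \<omega>, of y] y by (simp add: dist_norm)
      then show ?thesis
        unfolding L_def plane_wave_def
        by (intro sums_sum bounded_linear.sums[OF bounded_linear_clifford_mult_left]
            bounded_linear.sums[OF bounded_linear_cplx])
    qed
    have 5: "F ((x\<^sub>0, x) + y) = (\<integral>\<omega>. plane_wave H \<omega> (z \<omega> + ev \<omega> y) \<partial>sphere_measure)"
      if y: "norm y < \<delta>" for y
      unfolding F_def
    proof (rule integral_sphere_cong)
      fix \<omega> :: "(real, 'n) vec" assume \<omega>: "norm \<omega> = 1"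
      have "\<bar>fst y\<bar> \<le> norm y" "norm (snd y) \<le> norm y"
        using norm_fst_le[of "fst y" "snd y"] norm_snd_le[of "snd y" "fst y"] by simp_all
      moreover have "\<bar>(x + snd y) \<bullet> \<omega>\<bar> \<le> norm x + norm (snd y)"
        using Cauchy_Schwarz_ineq2[of "x + snd y" \<omega>] \<omega> norm_triangle_ineq[of x "snd y"] by simp
      ultimately have "\<bar>(x\<^sub>0 + fst y) - t\<bar> + \<bar>(x + snd y) \<bullet> \<omega>\<bar> < 2 * r"
        using y \<delta> by (simp add: q_def)
      from slice_ext_eq_plane_wave[OF H \<omega> this]
      show "slice_ext f (fst ((x\<^sub>0, x) + y), (snd ((x\<^sub>0, x) + y) \<bullet> \<omega>) *\<^sub>R \<omega>) =
          plane_wave H \<omega> (z \<omega> + ev \<omega> y)"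
        by (simp add: z_def ev_def inner_add_left plus_complex.code)
    qed
    show "analytic_at_point F (x\<^sub>0, x)"
      by (rule *(1)) (use ev_lin L_lin L_le 1 2 3 4 5 \<delta>(1) in auto)
    show "(F has_derivative (\<lambda>y. \<integral>\<omega>. L 1 \<omega> (ev \<omega> y) \<partial>sphere_measure)) (at (x\<^sub>0, x))"
      by (rule *(2)) (use ev_lin L_lin L_le 1 2 3 4 5 \<delta>(1) in auto)
  qed
  then show "analytic_at_point F (x\<^sub>0, x)" by blast
  define D where "D y = (\<integral>\<omega>. L 1 \<omega> (ev \<omega> y) \<partial>sphere_measure)" for y
  have int_L: "integrable sphere_measure (\<lambda>\<omega>. L 1 \<omega> (g \<omega>))" if "continuous_on (sphere 0 1) g" for g
    by (rule integrable_sphere_continuous[OF cont_L[OF that]])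
  have D1: "D (1, 0) = (\<integral>\<omega>. L 1 \<omega> 1 \<partial>sphere_measure)"
    by (simp add: D_def ev_def flip: one_complex.code)
  have ev_axis: "ev \<omega> (0, axis j 1) = (\<omega> $ j) *\<^sub>R \<i>" for \<omega> j
    by (simp add: ev_def complex_eq_iff inner_axis' inner_axis)
  have int_axis: "integrable sphere_measure (\<lambda>\<omega>. L 1 \<omega> (ev \<omega> (0, axis j 1)))" for j
    unfolding ev_axis by (intro int_L continuous_intros)
  have "(\<Sum>j\<in>UNIV. gen j * D (0, axis j 1)) =
      (\<integral>\<omega>. (\<Sum>j\<in>UNIV. gen j * L 1 \<omega> (ev \<omega> (0, axis j 1))) \<partial>sphere_measure)"
    unfolding D_def
    by (simp only: Bochner_Integration.integral_sum[OF
          integrable_bounded_linear[OF bounded_linear_clifford_mult_right int_axis]]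
        integral_bounded_linear[OF bounded_linear_clifford_mult_right int_axis])
  also have "\<dots> = (\<integral>\<omega>. cvec \<omega> * L 1 \<omega> \<i> \<partial>sphere_measure)"
    by (rule integral_sphere_cong)
      (simp add: ev_axis linear_cmul[OF L_lin] cvec_def sum_distrib_right)
  also have "\<dots> = (\<integral>\<omega>. - L 1 \<omega> 1 \<partial>sphere_measure)"
  proof (rule integral_sphere_cong)
    fix \<omega> :: "(real, 'n) vec" assume \<omega>: "norm \<omega> = 1"
    have "cvec \<omega> * (cplx \<omega> (a * \<i>) * b) = - (cplx \<omega> a * b)" for a b
    proof -
      have "cvec \<omega> * (cplx \<omega> (a * \<i>) * b) = cplx \<omega> (\<i> * (a * \<i>)) * b"
        by (simp only: cplx_mult[OF \<omega>, of \<i>] cplx_i mult.assoc)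
      also have "\<i> * (a * \<i>) = - a" by (simp add: complex_eq_iff)
      finally show ?thesis by (simp add: linear_neg[OF linear_cplx])
    qed
    then show "cvec \<omega> * L 1 \<omega> \<i> = - L 1 \<omega> 1"
      by (simp add: L_def sum_distrib_left sum_negf)
  qed
  finally have "dirac D = 0"
    by (simp add: D1)
  with ridge show "\<exists>D. (F has_derivative D) (at (x\<^sub>0, x)) \<and>
      dirac D = 0"
    unfolding D_def by blast
qed

lemma sphere_area_pos: "m > 0 \<Longrightarrow> sphere_area m > 0"
  by (simp add: sphere_area_def Gamma_real_pos)

text \<open>
  By rotation invariance every coordinate has the same moments, so an arbitrary one is used.
\<close>
definition sphere_moment :: "'n::{finite,linorder} itself \<Rightarrow> nat \<Rightarrow> real"
  where "sphere_moment _ n = (\<integral>\<omega>. (axis undefined 1 \<bullet> \<omega>) ^ n \<partial>(sphere_measure :: (real, 'n) vec measure))"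

lemma integral_inner_power:
  fixes x :: "(real, 'n::{finite,linorder}) vec"
  shows "(\<integral>\<omega>. (x \<bullet> \<omega>) ^ n \<partial>sphere_measure) = norm x ^ n * sphere_moment TYPE('n) n"
proof -
  let ?e = "axis undefined 1 :: (real, 'n) vec"
  obtain T where T: "orthogonal_transformation T" "T (norm x *\<^sub>R ?e) = x"
    using orthogonal_transformation_exists[of "norm x *\<^sub>R ?e" x] by auto
  have "(\<integral>\<omega>. (x \<bullet> \<omega>) ^ n \<partial>sphere_measure) = (\<integral>\<omega>. (x \<bullet> T \<omega>) ^ n \<partial>sphere_measure)"
    by (rule integral_sphere_orthogonal[OF T(1), symmetric]) (intro continuous_intros)
  also have "\<dots> = (\<integral>\<omega>. norm x ^ n * (?e \<bullet> \<omega>) ^ n \<partial>sphere_measure)"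
  proof (rule integral_sphere_cong)
    fix \<omega>
    have "x \<bullet> T \<omega> = T (norm x *\<^sub>R ?e) \<bullet> T \<omega>" by (simp only: T(2))
    also have "\<dots> = norm x * (?e \<bullet> \<omega>)"
      using T(1) by (simp only: orthogonal_transformation_def inner_scaleR_left)
    finally show "(x \<bullet> T \<omega>) ^ n = norm x ^ n * (?e \<bullet> \<omega>) ^ n" by (simp add: power_mult_distrib)
  qed
  finally show ?thesis by (simp add: sphere_moment_def)
qed

text \<open>
  The integral is a vector fixed by the orthogonal map \<open>T\<close> that fixes \<open>x\<close> and reverses its orthogonal
  complement, hence it is a multiple of \<open>x\<close>; the factor is found by pairing with \<open>x\<close>.
\<close>
lemma integral_inner_power_vector:
  fixes x :: "(real, 'n::{finite,linorder}) vec"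
  assumes "n > 0"
  shows "(\<integral>\<omega>. (x \<bullet> \<omega>) ^ n *\<^sub>R \<omega> \<partial>sphere_measure) =
    (norm x ^ (n - 1) * sphere_moment TYPE('n) (n + 1)) *\<^sub>R x"
proof (cases "x = 0")
  case True
  then show ?thesis using assms by (simp add: power_0_left)
next
  case False
  let ?V = "\<integral>\<omega>. (x \<bullet> \<omega>) ^ n *\<^sub>R \<omega> \<partial>sphere_measure"
  \<comment> \<open>The reflection in the line spanned by \<open>x\<close>.\<close>
  define T where "T v = (2 * (v \<bullet> x) / (norm x)\<^sup>2) *\<^sub>R x - v" for v
  have lin: "linear T"
    by (rule linearI) (simp_all add: T_def inner_add_left algebra_simps add_divide_distrib)
  have T: "orthogonal_transformation T"
    unfolding orthogonal_transformation_def
    using False by (auto simp: lin T_def inner_diff inner_commute power2_norm_eq_inner field_simps)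
  have x_T: "x \<bullet> T \<omega> = x \<bullet> \<omega>" for \<omega>
    using False by (simp add: T_def inner_diff inner_commute power2_norm_eq_inner)
  have cont: "continuous_on (sphere 0 1) (\<lambda>\<omega>. (x \<bullet> \<omega>) ^ n *\<^sub>R \<omega>)"
    by (intro continuous_intros)
  note int = integrable_sphere_continuous[OF cont]
  have bl: "bounded_linear T" using lin by (rule linear_conv_bounded_linear[THEN iffD1])
  have "?V = (\<integral>\<omega>. T ((x \<bullet> \<omega>) ^ n *\<^sub>R \<omega>) \<partial>sphere_measure)"
    using integral_sphere_orthogonal[OF T cont] by (simp add: x_T linear_cmul[OF lin])
  also have "\<dots> = T ?V" by (rule integral_bounded_linear[OF bl int])
  finally have "2 *\<^sub>R ?V = (2 * (?V \<bullet> x) / (norm x)\<^sup>2) *\<^sub>R x"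
    by (simp add: T_def scaleR_2 algebra_simps)
  then have "?V = ((?V \<bullet> x) / (norm x)\<^sup>2) *\<^sub>R x"
    by (metis (no_types, lifting) scaleR_cancel_left scaleR_scaleR times_divide_eq_right zero_neq_numeral)
  moreover have "?V \<bullet> x = (\<integral>\<omega>. (x \<bullet> \<omega>) ^ (n + 1) \<partial>sphere_measure)"
    using integral_bounded_linear[OF bounded_linear_inner_left int, of x]
    by (simp add: inner_commute mult.commute)
  moreover have "norm x ^ (n + 1) / (norm x)\<^sup>2 = norm x ^ (n - 1)"
    using assms False by (cases n) (simp_all add: power2_eq_square)
  ultimately show ?thesis
    by (simp only: integral_inner_power times_divide_eq_left[symmetric])
qed

lemma cvec_power_even: "cvec x ^ (2 * k) = ((- 1) ^ k * norm x ^ (2 * k)) *\<^sub>R 1"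
proof -
  have "cvec x ^ (2 * k) = (- ((norm x)\<^sup>2 *\<^sub>R 1)) ^ k"
    by (simp add: power_mult power2_eq_square cvec_square)
  also have "\<dots> = ((- ((norm x)\<^sup>2)) ^ k) *\<^sub>R 1"
    by (induction k) simp_all
  finally show ?thesis by (simp add: power_minus[of "(norm x)\<^sup>2"] power_mult)
qed

lemma cvec_power_odd: "cvec x ^ (2 * k + 1) = ((- 1) ^ k * norm x ^ (2 * k)) *\<^sub>R cvec x"
  by (simp only: power_add power_one_right cvec_power_even mult_scaleR_left mult_1_left)

text \<open>
  Even powers of \<open>\<omega>\<close> are \<open>\<plusminus> 1\<close> and odd ones \<open>\<plusminus> \<omega>\<close>, with the same signs as for the direction of \<open>x\<close>. Both
  cases reduce to an even moment, of order \<open>n\<close> or \<open>n + 1\<close>.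
\<close>
lemma average_plane_wave_power:
  fixes x :: "(real, 'n::{finite,linorder}) vec"
  shows "(\<integral>\<omega>. (x \<bullet> \<omega>) ^ n *\<^sub>R cvec \<omega> ^ n \<partial>sphere_measure) =
    sphere_moment TYPE('n) (2 * ((n + 1) div 2)) *\<^sub>R cvec x ^ n"
proof (cases "even n")
  case True
  then obtain k where k: "n = 2 * k" by blast
  have "(\<integral>\<omega>. (x \<bullet> \<omega>) ^ n *\<^sub>R cvec \<omega> ^ n \<partial>sphere_measure) =
      (\<integral>\<omega>. ((- 1) ^ k * (x \<bullet> \<omega>) ^ n) *\<^sub>R 1 \<partial>sphere_measure)"
    by (rule integral_sphere_cong) (simp add: k cvec_power_even)
  also have "\<dots> = ((- 1) ^ k * (\<integral>\<omega>. (x \<bullet> \<omega>) ^ n \<partial>sphere_measure)) *\<^sub>R 1"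
    by (subst integral_scaleR_left) (simp_all add: integrable_sphere_continuous continuous_intros)
  finally show ?thesis by (simp add: integral_inner_power k cvec_power_even)
next
  case False
  then obtain k where k: "n = 2 * k + 1" by (elim oddE)
  have "(\<integral>\<omega>. (x \<bullet> \<omega>) ^ n *\<^sub>R cvec \<omega> ^ n \<partial>sphere_measure) =
      (\<integral>\<omega>. (- 1) ^ k *\<^sub>R cvec ((x \<bullet> \<omega>) ^ n *\<^sub>R \<omega>) \<partial>sphere_measure)"
    unfolding k cvec_power_odd by (rule integral_sphere_cong) (simp add: cvec_scaleR mult.commute)
  also have "\<dots> = (- 1) ^ k *\<^sub>R cvec (\<integral>\<omega>. (x \<bullet> \<omega>) ^ n *\<^sub>R \<omega> \<partial>sphere_measure)"
    by (simp add: integral_bounded_linear[OF bounded_linear_cvec] integrable_sphere_continuous continuous_intros)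
  also have "\<dots> = (- 1) ^ k *\<^sub>R cvec ((norm x ^ (n - 1) * sphere_moment TYPE('n) (n + 1)) *\<^sub>R x)"
    by (subst integral_inner_power_vector) (simp_all add: k)
  also have "\<dots> = sphere_moment TYPE('n) (2 * ((n + 1) div 2)) *\<^sub>R cvec x ^ n"
    unfolding k cvec_power_odd by (simp add: cvec_scaleR mult_ac)
  finally show ?thesis .
qed

text \<open>
  The Taylor series of the holomorphic extensions converges absolutely inside its disk; this is the
  majorant for integrating the slice series term by term.
\<close>
lemma summable_norm_nth_vderiv:
  fixes f :: "real \<Rightarrow> 'n::{finite,linorder} clifford"
  assumes H: "hol_ext f t r H" and s: "\<bar>u - t\<bar> + s < r" "s \<ge> 0"
  shows "summable (\<lambda>j. s ^ j * norm (nth_vderiv j f u /\<^sub>R fact j))"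
proof -
  define \<rho> where "\<rho> = (s + (r - \<bar>u - t\<bar>)) / 2"
  have \<rho>: "s < \<rho>" "\<rho> < r - \<bar>u - t\<bar>" "\<rho> > 0" using s by (auto simp: \<rho>_def field_simps)
  have sm: "summable (\<lambda>j. norm ((deriv ^^ j) (H A) (of_real u) / fact j * of_real s ^ j))" for A
  proof (rule powser_insidea)
    have "of_real u + of_real \<rho> \<in> ball (complex_of_real u) (r - \<bar>u - t\<bar>)"
      using \<rho> by (simp add: dist_norm)
    from sums_summable[OF holomorphic_power_series[OF hol_ext_centre_ball[OF H] this]]
    show "summable (\<lambda>j. (deriv ^^ j) (H A) (of_real u) / fact j * of_real \<rho> ^ j)" by simp
    show "norm (complex_of_real s) < norm (complex_of_real \<rho>)" using s \<rho> by simp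
  qed
  have sm': "summable (\<lambda>j. \<Sum>A\<in>UNIV. norm ((deriv ^^ j) (H A) (of_real u) / fact j * of_real s ^ j) *
      norm (blade A :: 'n clifford))"
    by (intro summable_sum summable_mult2 sm)
  show ?thesis
  proof (rule summable_comparison_test_ev[OF always_eventually sm'], rule allI)
    fix j
    have u: "u \<in> ball t r" using s by (simp add: dist_real_def abs_minus_commute)
    have c: "\<bar>coef (nth_vderiv j f u) A\<bar> = cmod ((deriv ^^ j) (H A) (of_real u))" for A
      using hol_ext_nth_vderiv[OF H, of j] u by (simp add: hol_ext_def)
    have "norm (nth_vderiv j f u) \<le> (\<Sum>A\<in>UNIV. \<bar>coef (nth_vderiv j f u) A\<bar> * norm (blade A :: 'n clifford))"
      by (subst (1) clifford_expansion[of "nth_vderiv j f u"]) (intro sum_norm_le, simp)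
    then have "s ^ j / fact j * norm (nth_vderiv j f u) \<le>
        s ^ j / fact j * (\<Sum>A\<in>UNIV. \<bar>coef (nth_vderiv j f u) A\<bar> * norm (blade A :: 'n clifford))"
      using s by (intro mult_left_mono) auto
    also have "\<dots> = (\<Sum>A\<in>UNIV. norm ((deriv ^^ j) (H A) (of_real u) / fact j * of_real s ^ j) *
      norm (blade A :: 'n clifford))"
      unfolding sum_distrib_left c using s
      by (intro sum.cong refl) (simp add: norm_mult norm_divide norm_power mult_ac)
    finally show "norm (s ^ j * norm (nth_vderiv j f u /\<^sub>R fact j)) \<le> \<dots>"
      using s by (simp add: divide_inverse mult_ac)
  qed
qed

lemma power_scaleR: "(r *\<^sub>R (a :: 'a::real_algebra_1)) ^ n = r ^ n *\<^sub>R a ^ n"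
  by (induction n) simp_all

lemma slice_term_sphere:
  "slice_term f (x\<^sub>0, (x \<bullet> \<omega>) *\<^sub>R \<omega>) j = ((x \<bullet> \<omega>) ^ j *\<^sub>R cvec \<omega> ^ j) * (nth_vderiv j f x\<^sub>0 /\<^sub>R fact j)"
  by (simp add: slice_term_def cvec_scaleR power_scaleR)

text \<open>
  The slice series is integrated term by term, with a majorant uniform in \<open>\<omega>\<close> because \<open>|\<langle>x, \<omega>\<rangle>| \<le> |x|\<close>.
\<close>
lemma dual_radon_series:
  fixes f :: "real \<Rightarrow> 'n::{finite,linorder} clifford" and x :: "(real, 'n) vec"
  assumes H: "hol_ext f t r H" and x: "\<bar>x\<^sub>0 - t\<bar> + norm x < r"
  shows "(\<lambda>j. cvec x ^ j * ((sphere_moment TYPE('n) (2 * ((j + 1) div 2)) / (sphere_area CARD('n) * fact j))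
      *\<^sub>R nth_vderiv j f x\<^sub>0)) sums dual_radon (slice_ext f) (x\<^sub>0, x)"
proof -
  define d where "d j = nth_vderiv j f x\<^sub>0 /\<^sub>R fact j" for j
  define P where "P j \<omega> = (x \<bullet> \<omega>) ^ j *\<^sub>R cvec \<omega> ^ j" for j and \<omega> :: "(real, 'n) vec"
  have P: "P j \<omega> = cplx \<omega> ((\<i> * of_real (x \<bullet> \<omega>)) ^ j)" if "norm \<omega> = 1" for j \<omega>
    using cvec_scaleR_power[OF that, of "x \<bullet> \<omega>" j] by (simp add: P_def cvec_scaleR power_scaleR)
  have cont: "continuous_on (sphere 0 1) (P j)" for j
  proof (subst continuous_on_cong[OF refl P])
    show "continuous_on (sphere 0 1) (\<lambda>\<omega>. cplx \<omega> ((\<i> * complex_of_real (x \<bullet> \<omega>)) ^ j))"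
      by (intro continuous_on_cplx continuous_intros)
  qed simp
  have int: "integrable sphere_measure (P j)" for j
    by (rule integrable_sphere_continuous[OF cont])
  have int': "integrable sphere_measure (\<lambda>\<omega>. P j \<omega> * d j)" for j
    by (rule integrable_bounded_linear[OF bounded_linear_clifford_mult_left int])
  have P_average: "integral\<^sup>L sphere_measure (P j) = sphere_moment TYPE('n) (2 * ((j + 1) div 2)) *\<^sub>R cvec x ^ j" for j
    using average_plane_wave_power[of x j] by (simp only: P_def[abs_def])
  obtain C where C: "C > 0" "\<And>(\<omega> :: (real, 'n) vec) z a. norm \<omega> = 1 \<Longrightarrow>
      norm (cplx \<omega> z * a) \<le> C * cmod z * norm a"
    using cplx_mult_bound by metis
  have le: "norm (P j \<omega> * d j) \<le> C * (norm x ^ j * norm (d j))" if "norm \<omega> = 1" for j \<omega>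
  proof -
    have "norm (P j \<omega> * d j) \<le> C * \<bar>x \<bullet> \<omega>\<bar> ^ j * norm (d j)"
      using C(2)[OF that, of "(\<i> * of_real (x \<bullet> \<omega>)) ^ j" "d j"] by (simp add: P[OF that] norm_power norm_mult)
    also have "\<dots> \<le> C * norm x ^ j * norm (d j)"
      using C(1) Cauchy_Schwarz_ineq2[of x \<omega>] that by (intro mult_right_mono mult_left_mono power_mono) auto
    finally show ?thesis by simp
  qed
  have sm: "summable (\<lambda>j. C * (norm x ^ j * norm (d j)))"
    unfolding d_def by (intro summable_mult summable_norm_nth_vderiv[OF H x]) simp
  have "(\<lambda>j. \<integral>\<omega>. P j \<omega> * d j \<partial>sphere_measure) sums (\<integral>\<omega>. (\<Sum>j. P j \<omega> * d j) \<partial>sphere_measure)"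
  proof (rule sums_integral[OF int'])
    show "AE \<omega> in sphere_measure. summable (\<lambda>j. norm (P j \<omega> * d j))"
      by (intro AE_I2 summable_comparison_test_ev[OF _ sm] always_eventually allI) (simp add: le)
    have "norm (\<integral>\<omega>. norm (P j \<omega> * d j) \<partial>sphere_measure) \<le>
        C * (norm x ^ j * norm (d j)) * measure (sphere_measure :: (real, 'n) vec measure) (space sphere_measure)" for j
      by (rule sphere.norm_integral_le) (use integrable_norm[OF int'] le in auto)
    then show "summable (\<lambda>j. \<integral>\<omega>. norm (P j \<omega> * d j) \<partial>sphere_measure)"
      by (intro summable_comparison_test_ev[OF _ summable_mult2[OF sm]] always_eventually allI)
  qed
  also have "(\<integral>\<omega>. (\<Sum>j. P j \<omega> * d j) \<partial>sphere_measure) =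
      (\<integral>\<omega>. slice_ext f (x\<^sub>0, (x \<bullet> \<omega>) *\<^sub>R \<omega>) \<partial>sphere_measure)"
    by (simp only: slice_ext_def slice_term_sphere P_def d_def)
  also have "(\<lambda>j. \<integral>\<omega>. P j \<omega> * d j \<partial>sphere_measure) =
      (\<lambda>j. sphere_moment TYPE('n) (2 * ((j + 1) div 2)) *\<^sub>R cvec x ^ j * d j)"
    by (simp only: integral_bounded_linear[OF bounded_linear_clifford_mult_left int] P_average)
  finally have "(\<lambda>j. (1 / sphere_area CARD('n)) *\<^sub>R (sphere_moment TYPE('n) (2 * ((j + 1) div 2)) *\<^sub>R cvec x ^ j * d j))
      sums dual_radon (slice_ext f) (x\<^sub>0, x)"
    unfolding dual_radon_def prod.case by (rule sums_scaleR_right)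
  then show ?thesis by (simp add: d_def divide_inverse mult_ac)
qed

text \<open>
  A power \<open>x\<^sup>j\<close> depends on the direction \<open>\<omega>\<close> of \<open>x\<close> only through the factor \<open>\<omega>\<close> that occurs for odd \<open>j\<close>.
  The values at \<open>\<plusminus> |x| e\<close> for one fixed unit vector \<open>e\<close> therefore determine those at all \<open>x\<close> of the same
  length: \<open>A\<close> is the even part along \<open>e\<close>, and \<open>B\<close> is the odd part with the factor \<open>e\<close> removed. Defined in
  this way \<open>A\<close> and \<open>B\<close> have the required parity on the whole plane.
\<close>
lemma axial_form_of_series:
  fixes F :: "'n::{finite,linorder} pvec \<Rightarrow> 'n clifford"
  assumes series: "\<And>x\<^sub>0 x. (x\<^sub>0, x) \<in> \<Omega> \<Longrightarrow> (\<lambda>j. cvec x ^ j * g j x\<^sub>0) sums F (x\<^sub>0, x)"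
    and sym: "\<And>x\<^sub>0 x y. (x\<^sub>0, x) \<in> \<Omega> \<Longrightarrow> norm y = norm x \<Longrightarrow> (x\<^sub>0, y) \<in> \<Omega>"
  shows "\<exists>A B :: real \<Rightarrow> real \<Rightarrow> 'n clifford.
    (\<forall>u v. A u (- v) = A u v \<and> B u (- v) = - B u v) \<and>
    (\<forall>(x\<^sub>0, x)\<in>\<Omega>. F (x\<^sub>0, x) = A x\<^sub>0 (norm x) + cvec (x /\<^sub>R norm x) * B x\<^sub>0 (norm x))"
proof -
  define e :: "(real, 'n) vec" where "e = axis undefined 1"
  have e: "norm e = 1" by (simp add: e_def)
  define A where "A u v = (1 / 2) *\<^sub>R (F (u, v *\<^sub>R e) + F (u, (- v) *\<^sub>R e))" for u v
  define B where "B u v = - ((1 / 2) *\<^sub>R (cvec e * (F (u, v *\<^sub>R e) - F (u, (- v) *\<^sub>R e))))" for u v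
  have "A u (- v) = A u v" "B u (- v) = - B u v" for u v
    by (simp_all add: A_def B_def algebra_simps)
  moreover have "F (x\<^sub>0, x) = A x\<^sub>0 (norm x) + cvec (x /\<^sub>R norm x) * B x\<^sub>0 (norm x)" if x: "(x\<^sub>0, x) \<in> \<Omega>" for x\<^sub>0 x
  proof (cases "x = 0")
    case True
    then show ?thesis by (simp add: A_def scaleR_2[symmetric])
  next
    case False
    define n where "n = norm x"
    have n: "n > 0" using False by (simp add: n_def)
    define E where "E = cvec (n *\<^sub>R e)"
    have pos: "(\<lambda>j. E ^ j * g j x\<^sub>0) sums F (x\<^sub>0, n *\<^sub>R e)"
      unfolding E_def by (rule series[OF sym[OF x]]) (simp add: e n_def)
    have "(\<lambda>j. cvec ((- n) *\<^sub>R e) ^ j * g j x\<^sub>0) sums F (x\<^sub>0, (- n) *\<^sub>R e)"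
      by (rule series[OF sym[OF x]]) (simp add: e n_def)
    moreover have "cvec ((- n) *\<^sub>R e) = - E" by (simp only: E_def cvec_scaleR) simp
    ultimately have neg: "(\<lambda>j. (- E) ^ j * g j x\<^sub>0) sums F (x\<^sub>0, (- n) *\<^sub>R e)" by (simp only:)
    have ee: "cvec e * cvec e = - 1" using cvec_square[of e] e by simp
    let ?w = "cvec (x /\<^sub>R n)"
    \<comment> \<open>In every degree the power is the even part plus \<open>\<omega>\<close> times the odd part with \<open>e\<close> removed.\<close>
    have pw: "cvec x ^ j = (1 / 2) *\<^sub>R (E ^ j + (- E) ^ j) + ?w * - ((1 / 2) *\<^sub>R (cvec e * (E ^ j - (- E) ^ j)))" for j
    proof (cases "even j")
      case True
      then obtain k where k: "j = 2 * k" by blast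
      have "cvec x ^ j = E ^ j"
        unfolding k E_def cvec_power_even using n by (simp add: n_def e)
      moreover have "(- E) ^ j = E ^ j" using True by simp
      ultimately show ?thesis by (simp add: scaleR_2[symmetric])
    next
      case False
      then obtain k where k: "j = 2 * k + 1" by (elim oddE)
      have E: "E ^ j = ((- 1) ^ k * n ^ (2 * k)) *\<^sub>R n *\<^sub>R cvec e"
        unfolding k E_def cvec_power_odd using n by (simp add: n_def e cvec_scaleR)
      have "(- E) ^ j = - (E ^ j)" using False by simp
      then have "(1 / 2) *\<^sub>R (E ^ j + (- E) ^ j) + ?w * - ((1 / 2) *\<^sub>R (cvec e * (E ^ j - (- E) ^ j))) =
          - (?w * (cvec e * E ^ j))"
        by (simp add: scaleR_2[symmetric])
      also have "\<dots> = ((- 1) ^ k * n ^ (2 * k)) *\<^sub>R n *\<^sub>R ?w" by (simp add: E ee)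
      also have "n *\<^sub>R ?w = cvec x" using n by (simp flip: cvec_scaleR)
      also have "((- 1) ^ k * n ^ (2 * k)) *\<^sub>R cvec x = cvec x ^ j" unfolding k cvec_power_odd n_def ..
      finally show ?thesis ..
    qed
    have "(\<lambda>j. (1 / 2) *\<^sub>R (E ^ j * g j x\<^sub>0 + (- E) ^ j * g j x\<^sub>0) +
        ?w * - ((1 / 2) *\<^sub>R (cvec e * (E ^ j * g j x\<^sub>0 - (- E) ^ j * g j x\<^sub>0)))) sums
        (A x\<^sub>0 n + ?w * B x\<^sub>0 n)"
      unfolding A_def B_def
      by (intro sums_add sums_diff sums_minus sums_scaleR_right pos neg
          bounded_linear.sums[OF bounded_linear_clifford_mult_right])
    moreover have "(1 / 2) *\<^sub>R (E ^ j * g j x\<^sub>0 + (- E) ^ j * g j x\<^sub>0) +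
        ?w * - ((1 / 2) *\<^sub>R (cvec e * (E ^ j * g j x\<^sub>0 - (- E) ^ j * g j x\<^sub>0))) = cvec x ^ j * g j x\<^sub>0" for j
      unfolding pw[of j] by (simp add: algebra_simps)
    ultimately have "(\<lambda>j. cvec x ^ j * g j x\<^sub>0) sums (A x\<^sub>0 n + ?w * B x\<^sub>0 n)" by simp
    with series[OF x] show ?thesis unfolding n_def by (rule sums_unique2)
  qed
  ultimately show ?thesis by blast
qed

lemma open_boxes: "open (boxes \<Omega>\<^sub>1 r :: 'n::finite pvec set)"
proof -
  have "boxes \<Omega>\<^sub>1 r = (\<Union>t\<in>\<Omega>\<^sub>1. {p :: 'n pvec. \<bar>fst p - t\<bar> < r t \<and> norm (snd p) < r t})"
    by (auto simp: boxes_def)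
  then show ?thesis by (auto intro!: open_Collect_conj open_Collect_less continuous_intros)
qed

lemma axially_monogenic_dual_radon:
  fixes f :: "real \<Rightarrow> 'n::{finite,linorder} clifford"
  assumes H: "\<And>t. t \<in> \<Omega>\<^sub>1 \<Longrightarrow> hol_ext f t (2 * r t) (H t)"
  shows "axially_monogenic (boxes \<Omega>\<^sub>1 r) (dual_radon (slice_ext f))"
  unfolding axially_monogenic_def
proof (intro conjI)
  define J where "J p = (\<integral>\<omega>. slice_ext f (fst p, (snd p \<bullet> \<omega>) *\<^sub>R \<omega>) \<partial>sphere_measure)" for p :: "'n pvec"
  define \<sigma> where "\<sigma> = 1 / sphere_area CARD('n)"
  have F: "dual_radon (slice_ext f) = (\<lambda>p. \<sigma> *\<^sub>R J p)"
    by (simp add: fun_eq_iff dual_radon_def J_def \<sigma>_def)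
  have J: "analytic_at_point J p \<and>
      (\<exists>D. (J has_derivative D) (at p) \<and> dirac D = 0)"
    if p_in: "p \<in> boxes \<Omega>\<^sub>1 r" for p
  proof -
    obtain u x t where p: "p = (u, x)" and t: "t \<in> \<Omega>\<^sub>1" "\<bar>u - t\<bar> < r t" "norm x < r t"
      using p_in by (auto simp: boxes_def)
    show ?thesis
      unfolding J_def[abs_def] p using plane_wave_average_monogenic[OF H[OF t(1)] t(2,3)] by blast
  qed
  show "real_analytic_on (dual_radon (slice_ext f)) (boxes \<Omega>\<^sub>1 r)"
    unfolding F real_analytic_on_iff
    using J by (blast intro: analytic_at_point_bounded_linear bounded_linear_scaleR_right)
  show "\<forall>p\<in>boxes \<Omega>\<^sub>1 r. dirac (frechet_derivative (dual_radon (slice_ext f)) (at p)) = 0"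
  proof
    fix p :: "'n pvec" assume "p \<in> boxes \<Omega>\<^sub>1 r"
    then obtain D where D: "(J has_derivative D) (at p)" "dirac D = 0"
      using J by blast
    have "(dual_radon (slice_ext f) has_derivative (\<lambda>y. \<sigma> *\<^sub>R D y)) (at p)"
      unfolding F by (intro has_derivative_scaleR_right D)
    from frechet_derivative_at[OF this, symmetric]
    have "dirac (frechet_derivative (dual_radon (slice_ext f)) (at p)) =
      \<sigma> *\<^sub>R (dirac D)"
      by (simp add: scaleR_add_right scaleR_sum_right)
    then show "dirac (frechet_derivative (dual_radon (slice_ext f)) (at p)) = 0"
      by (simp add: D(2))
  qed
  show "\<exists>A B :: real \<Rightarrow> real \<Rightarrow> 'n clifford. (\<forall>u v. A u (- v) = A u v \<and> B u (- v) = - B u v) \<and>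
      (\<forall>(x\<^sub>0, x)\<in>boxes \<Omega>\<^sub>1 r. dual_radon (slice_ext f) (x\<^sub>0, x) =
        A x\<^sub>0 (norm x) + cvec (x /\<^sub>R norm x) * B x\<^sub>0 (norm x))"
  proof (rule axial_form_of_series)
    fix x\<^sub>0 and x :: "(real, 'n) vec" assume "(x\<^sub>0, x) \<in> boxes \<Omega>\<^sub>1 r"
    then obtain t where t: "t \<in> \<Omega>\<^sub>1" "\<bar>x\<^sub>0 - t\<bar> + norm x < 2 * r t" by (force simp: boxes_def)
    from dual_radon_series[OF H[OF t(1)] t(2)]
    show "(\<lambda>j. cvec x ^ j * ((sphere_moment TYPE('n) (2 * ((j + 1) div 2)) / (sphere_area CARD('n) * fact j))
      *\<^sub>R nth_vderiv j f x\<^sub>0)) sums dual_radon (slice_ext f) (x\<^sub>0, x)" .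
  qed (auto simp: boxes_def)
qed

lemma dual_radon_axis:
  assumes "f (t, 0) = a"
  shows "dual_radon f (t, 0 :: (real, 'n::{finite,linorder}) vec) = a"
  using assms sphere_area_pos[of "CARD('n)"]
  by (simp add: dual_radon_def measure_sphere_measure)

lemma is_GCK_dual_radon:
  fixes f :: "real \<Rightarrow> 'n::{finite,linorder} clifford"
  assumes f: "f \<in> analytic_tensor \<Omega>\<^sub>1" and \<Omega>\<^sub>1: "open \<Omega>\<^sub>1" "connected \<Omega>\<^sub>1" "\<Omega>\<^sub>1 \<noteq> {}"
    and r: "\<And>t. t \<in> \<Omega>\<^sub>1 \<Longrightarrow> r t > 0" "\<And>t u. t \<in> \<Omega>\<^sub>1 \<Longrightarrow> \<bar>u - t\<bar> < r t \<Longrightarrow> u \<in> \<Omega>\<^sub>1"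
    and H: "\<And>t. t \<in> \<Omega>\<^sub>1 \<Longrightarrow> hol_ext f t (2 * r t) (H t)"
  shows "is_GCK \<Omega>\<^sub>1 f (dual_radon (slice_ext f))"
  unfolding is_GCK_def
proof (intro conjI)
  show "\<exists>\<Omega>. axial_slice_nbhd \<Omega>\<^sub>1 \<Omega> \<and> axially_monogenic \<Omega> (dual_radon (slice_ext f))"
  proof (intro exI[of _ "boxes \<Omega>\<^sub>1 r"] conjI)
    show "axial_slice_nbhd \<Omega>\<^sub>1 (boxes \<Omega>\<^sub>1 r :: 'n pvec set)"
      by (rule axial_slice_nbhd_boxes[OF \<Omega>\<^sub>1(2,3)]) (fact r)+
    show "axially_monogenic (boxes \<Omega>\<^sub>1 r) (dual_radon (slice_ext f))"
      by (rule axially_monogenic_dual_radon) (fact H)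
  qed
  define c where "c j = sphere_moment TYPE('n) (2 * ((j + 1) div 2)) / (sphere_area CARD('n) * fact j)" for j
  show "\<exists>g. (\<forall>j. g j \<in> analytic_tensor \<Omega>\<^sub>1) \<and>
      near \<Omega>\<^sub>1 (\<lambda>(x\<^sub>0, x). (\<lambda>j. cvec x ^ j * g j x\<^sub>0) sums dual_radon (slice_ext f) (x\<^sub>0, x))"
  proof (intro exI conjI allI)
    show "(\<lambda>t. if t \<in> \<Omega>\<^sub>1 then c j *\<^sub>R nth_vderiv j f t else 0) \<in> analytic_tensor \<Omega>\<^sub>1" for j
      by (rule nth_vderiv_analytic[OF f \<Omega>\<^sub>1(1)])
    show "near \<Omega>\<^sub>1 (\<lambda>(x\<^sub>0, x). (\<lambda>j. cvec x ^ j * (if x\<^sub>0 \<in> \<Omega>\<^sub>1 then c j *\<^sub>R nth_vderiv j f x\<^sub>0 else 0))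
        sums dual_radon (slice_ext f) (x\<^sub>0, x))"
      unfolding near_def
    proof (intro exI[of _ "boxes \<Omega>\<^sub>1 r"] conjI open_boxes ballI)
      show "(t, 0) \<in> boxes \<Omega>\<^sub>1 r" if "t \<in> \<Omega>\<^sub>1" for t
        using that r(1)[OF that] by (auto simp: boxes_def intro!: bexI[of _ t])
      fix p :: "'n pvec" assume "p \<in> boxes \<Omega>\<^sub>1 r"
      then obtain u x t where p: "p = (u, x)" and t: "t \<in> \<Omega>\<^sub>1" "\<bar>u - t\<bar> < r t" "norm x < r t"
        by (auto simp: boxes_def)
      have u: "u \<in> \<Omega>\<^sub>1" using r(2)[OF t(1,2)] .
      have "(\<lambda>j. cvec x ^ j * (c j *\<^sub>R nth_vderiv j f u)) sums dual_radon (slice_ext f) (u, x)"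
        unfolding c_def by (rule dual_radon_series[OF H[OF t(1)]]) (use t in simp)
      then show "case p of (x\<^sub>0, x) \<Rightarrow> (\<lambda>j. cvec x ^ j * (if x\<^sub>0 \<in> \<Omega>\<^sub>1 then c j *\<^sub>R nth_vderiv j f x\<^sub>0 else 0))
        sums dual_radon (slice_ext f) (x\<^sub>0, x)"
        using u by (simp add: p)
    qed
  qed
  show "\<forall>t\<in>\<Omega>\<^sub>1. dual_radon (slice_ext f) (t, 0) = f t"
    by (simp add: dual_radon_axis slice_ext_axis)
qed

section \<open>Axially monogenic functions are determined by the real axis\<close>

lemma power_series_zero:
  fixes c :: "nat \<Rightarrow> real"
  assumes e: "e > 0" and sums: "\<And>s. \<bar>s\<bar> < e \<Longrightarrow> (\<lambda>n. c n * s ^ n) sums 0"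
  shows "c n = 0"
proof (cases "n = 0")
  case True
  have "(\<lambda>n. c n * 0 ^ n) sums 0" by (rule sums) (use e in simp)
  then show ?thesis using True by simp
next
  case False
  show ?thesis
  proof (rule ccontr)
    assume nz: "c n \<noteq> 0"
    show False
    proof (rule powser_0_nonzero[of e 0 c "\<lambda>_. 0" n, OF e _ refl nz])
      show "(\<lambda>n. c n * (x - 0) ^ n) sums 0" if "norm (x - 0) < e" for x
        using sums[of x] that by simp
      show "n > 0" using False by simp
      fix s :: real assume "s > 0" "\<And>z :: real. z \<in> cball 0 s - {0} \<Longrightarrow> (0 :: real) \<noteq> 0"
      from this(2)[of s] this(1) show False by simp
    qed
  qed
qed

lemma double_series_rows:
  fixes p :: "nat \<Rightarrow> nat \<Rightarrow> real"
  assumes sums: "\<And>s. \<bar>s\<bar> < e \<Longrightarrow> ((\<lambda>(i, j). p i j * s ^ i * v ^ j) has_sum f s) UNIV" and e: "e > 0"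
  obtains C where "\<And>i. ((\<lambda>j. p i j * v ^ j) has_sum C i) UNIV"
    "\<And>s. \<bar>s\<bar> < e \<Longrightarrow> (\<lambda>i. C i * s ^ i) sums f s"
proof -
  define C where "C i = (\<Sum>\<^sub>\<infinity>j. p i j * v ^ j)" for i
  have C: "((\<lambda>j. p i j * v ^ j) has_sum C i) UNIV" for i
  proof -
    define s where "s = e / 2"
    have s: "s > 0" "\<bar>s\<bar> < e" using e by (auto simp: s_def)
    have "(\<lambda>(i, j). p i j * s ^ i * v ^ j) summable_on Sigma UNIV (\<lambda>_. UNIV)"
      using sums[OF s(2)] by (auto simp: summable_on_def)
    then have "(\<lambda>j. p i j * s ^ i * v ^ j) summable_on UNIV"
      by (rule summable_on_SigmaD1[where x = i]) simp_all
    then have "(\<lambda>j. (1 / s ^ i) * (p i j * s ^ i * v ^ j)) summable_on UNIV"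
      by (rule summable_on_cmult_right)
    then show ?thesis using s by (simp add: C_def)
  qed
  have "(\<lambda>i. C i * s ^ i) sums f s" if "\<bar>s\<bar> < e" for s
  proof (rule has_sum_imp_sums, rule has_sum_SigmaD)
    show "((\<lambda>(i, j). p i j * s ^ i * v ^ j) has_sum f s) (Sigma UNIV (\<lambda>_. UNIV))"
      using sums[OF that] by simp
    show "((\<lambda>j. case (i, j) of (i, j) \<Rightarrow> p i j * s ^ i * v ^ j) has_sum C i * s ^ i) UNIV" for i
      using has_sum_cmult_left[OF C[of i], of "s ^ i"] by (simp add: mult_ac)
  qed
  with C show ?thesis by (rule that)
qed

lemma double_series_zero:
  fixes p :: "nat \<Rightarrow> nat \<Rightarrow> real"
  assumes e: "e > 0"
    and sums: "\<And>s v. \<bar>s\<bar> < e \<Longrightarrow> \<bar>v\<bar> < e \<Longrightarrow> ((\<lambda>(i, j). p i j * s ^ i * v ^ j) has_sum 0) UNIV"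
  shows "p i j = 0"
proof (rule power_series_zero[OF e])
  fix v :: real assume v: "\<bar>v\<bar> < e"
  obtain C where C: "\<And>i. ((\<lambda>j. p i j * v ^ j) has_sum C i) UNIV"
    "\<And>s. \<bar>s\<bar> < e \<Longrightarrow> (\<lambda>i. C i * s ^ i) sums 0"
    using double_series_rows[where f = "\<lambda>_. 0", OF sums[OF _ v] e] by blast
  have "C i = 0" by (rule power_series_zero[OF e C(2)])
  with C(1)[of i] show "(\<lambda>j. p i j * v ^ j) sums 0" by (simp add: has_sum_imp_sums)
qed

text \<open>
  Rearranged by rows the double series is a power series in \<open>s\<close>, which may be differentiated termwise;
  the factors \<open>i + 1\<close> are absorbed by moving to a point \<open>t\<close> with \<open>|s| < t < e\<close>, so the derived double
  series is summable as well.
\<close>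
lemma double_series_deriv:
  fixes p :: "nat \<Rightarrow> nat \<Rightarrow> real"
  assumes sums: "\<And>s. \<bar>s\<bar> < e \<Longrightarrow> ((\<lambda>(i, j). p i j * s ^ i * v ^ j) has_sum f s) UNIV"
    and s: "\<bar>s\<bar> < e" and D: "(f has_field_derivative D) (at s)"
  shows "((\<lambda>(i, j). (real (i + 1) * p (i + 1) j) * s ^ i * v ^ j) has_sum D) UNIV"
proof -
  have e: "e > 0" using s by simp
  obtain C where C: "\<And>i. ((\<lambda>j. p i j * v ^ j) has_sum C i) UNIV"
    "\<And>s. \<bar>s\<bar> < e \<Longrightarrow> (\<lambda>i. C i * s ^ i) sums f s"
    using double_series_rows[OF sums e] by blast
  have sums_D: "(\<lambda>i. diffs C i * s ^ i) sums D"
    by (rule termdiffs_sums_strong[OF _ D]) (use C(2) s in auto)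
  define t where "t = (\<bar>s\<bar> + e) / 2"
  have t: "\<bar>s\<bar> < t" "\<bar>t\<bar> < e" "t > 0" using s by (auto simp: t_def)
  have "(\<lambda>n. of_nat n * (\<bar>s\<bar> / t) ^ n) \<longlonglongrightarrow> 0"
    by (rule powser_times_n_limit_0) (use t in simp)
  then have "Bseq (\<lambda>n. of_nat n * (\<bar>s\<bar> / t) ^ n)" by (rule convergent_imp_Bseq[OF convergentI])
  then obtain K where K: "K > 0" "\<And>n. \<bar>of_nat n * (\<bar>s\<bar> / t) ^ n\<bar> \<le> K"
    unfolding Bseq_def by auto
  \<comment> \<open>The sequence \<open>i (|s| / t)\<^sup>i\<close> is bounded by \<open>K\<close>, and \<open>(|s| / t)\<^sup>i\<close> by one.\<close>
  have nK: "real (i + 1) * \<bar>s\<bar> ^ i \<le> (K + 1) * t ^ i" for i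
  proof -
    have "real i * (\<bar>s\<bar> / t) ^ i \<le> K" using K(2)[of i] by simp
    moreover have "(\<bar>s\<bar> / t) ^ i \<le> 1" using t by (intro power_le_one) auto
    ultimately have "real (i + 1) * (\<bar>s\<bar> / t) ^ i \<le> K + 1" by (simp add: algebra_simps)
    then have "real (i + 1) * (\<bar>s\<bar> / t) ^ i * t ^ i \<le> (K + 1) * t ^ i" using t by (intro mult_right_mono) auto
    then show ?thesis using t by (simp add: power_divide)
  qed
  have "(\<lambda>(i, j). p i j * t ^ i * v ^ j) summable_on UNIV"
    using sums[OF t(2)] by (auto simp: summable_on_def)
  then have "(\<lambda>x. norm ((\<lambda>(i, j). p i j * t ^ i * v ^ j) x)) summable_on UNIV"
    using summable_on_iff_abs_summable_on_real by blast
  then have "(\<lambda>x. norm ((\<lambda>(i, j). p i j * t ^ i * v ^ j) x)) summable_on range (map_prod Suc id)"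
    by (rule summable_on_subset) simp
  then have "(\<lambda>x. norm ((\<lambda>(i, j). p i j * t ^ i * v ^ j) (map_prod Suc id x))) summable_on UNIV"
    by (subst (asm) summable_on_reindex) (auto simp: o_def inj_on_def)
  then have *: "(\<lambda>(i, j). ((K + 1) / t) * \<bar>p (Suc i) j * t ^ Suc i * v ^ j\<bar>) summable_on UNIV"
    by (subst case_prod_unfold, intro summable_on_cmult_right) (simp add: case_prod_unfold)
  have "(\<lambda>x. norm ((\<lambda>(i, j). (real (i + 1) * p (i + 1) j) * s ^ i * v ^ j) x)) summable_on UNIV"
  proof (rule Infinite_Sum.abs_summable_on_comparison_test'[OF *])
    fix x :: "nat \<times> nat"
    obtain i j where x: "x = (i, j)" by (cases x)
    have "(real (i + 1) * \<bar>s\<bar> ^ i) * (\<bar>p (Suc i) j\<bar> * \<bar>v\<bar> ^ j) \<le> ((K + 1) * t ^ i) * (\<bar>p (Suc i) j\<bar> * \<bar>v\<bar> ^ j)"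
      by (intro mult_right_mono nK) auto
    also have "\<dots> = ((K + 1) / t) * \<bar>p (Suc i) j * t ^ Suc i * v ^ j\<bar>"
      using t by (simp add: abs_mult power_abs)
    finally show "norm ((\<lambda>(i, j). (real (i + 1) * p (i + 1) j) * s ^ i * v ^ j) x) \<le>
        (case x of (i, j) \<Rightarrow> ((K + 1) / t) * \<bar>p (Suc i) j * t ^ Suc i * v ^ j\<bar>)"
      by (simp add: x abs_mult power_abs mult_ac)
  qed
  then have "(\<lambda>(i, j). (real (i + 1) * p (i + 1) j) * s ^ i * v ^ j) summable_on UNIV"
    by (rule abs_summable_summable)
  then obtain T where T: "((\<lambda>(i, j). (real (i + 1) * p (i + 1) j) * s ^ i * v ^ j) has_sum T) UNIV"
    by (auto simp: summable_on_def)
  have "((\<lambda>i. diffs C i * s ^ i) has_sum T) UNIV"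
  proof (rule has_sum_SigmaD)
    show "((\<lambda>(i, j). (real (i + 1) * p (i + 1) j) * s ^ i * v ^ j) has_sum T) (Sigma UNIV (\<lambda>_. UNIV))"
      using T by simp
    show "((\<lambda>j. case (i, j) of (i, j) \<Rightarrow> (real (i + 1) * p (i + 1) j) * s ^ i * v ^ j) has_sum diffs C i * s ^ i) UNIV" for i
      using has_sum_cmult_right[OF C(1)[of "Suc i"], of "real (i + 1) * s ^ i"] by (simp add: diffs_def mult_ac)
  qed
  then have "T = D" using has_sum_imp_sums sums_D sums_unique2 by blast
  with T show ?thesis by simp
qed

lemma double_series_shift:
  fixes c :: "nat \<Rightarrow> nat \<Rightarrow> real"
  assumes "((\<lambda>(i, j). c i j * s ^ i * v ^ j) has_sum X) UNIV"
  shows "((\<lambda>(i, j). (if j = 0 then 0 else c i (j - 1)) * s ^ i * v ^ j) has_sum v * X) UNIV"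
proof -
  let ?f = "\<lambda>(i, j). (if j = 0 then 0 else c i (j - 1)) * s ^ i * v ^ j"
  have "((\<lambda>x. v * (\<lambda>(i, j). c i j * s ^ i * v ^ j) x) has_sum v * X) UNIV"
    by (rule has_sum_cmult_right[OF assms])
  also have "(\<lambda>x. v * (\<lambda>(i, j). c i j * s ^ i * v ^ j) x) = ?f \<circ> map_prod id Suc"
    by (auto simp: fun_eq_iff)
  finally have comp: "(?f \<circ> map_prod id Suc has_sum v * X) UNIV" .
  have "inj (map_prod id Suc :: nat \<times> nat \<Rightarrow> _)" by (auto simp: inj_on_def)
  from has_sum_reindex[OF this] comp have "(?f has_sum v * X) (range (map_prod id Suc))" by blast
  then show ?thesis
  proof (rule has_sum_cong_neutral[THEN iffD1, rotated -1])
    fix x :: "nat \<times> nat" assume "x \<in> UNIV - range (map_prod id Suc)"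
    moreover have "(i, Suc j) \<in> range (map_prod id Suc)" for i j :: nat by (auto intro: image_eqI[of _ _ "(i, j)"])
    ultimately have "snd x = 0" by (cases x; cases "snd x") auto
    then show "?f x = 0" by (auto simp: case_prod_unfold)
  qed auto
qed

lemma double_series_swap:
  "((\<lambda>(i, j). c i j) has_sum X) (UNIV :: (nat \<times> nat) set) \<longleftrightarrow> ((\<lambda>(i, j). c j i) has_sum X) UNIV"
  by (rule has_sum_reindex_bij_witness[where i = prod.swap and j = prod.swap]) auto

text \<open>
  In the plane spanned by the real axis and one coordinate direction only the multi-indices supported
  on these two coordinates survive.
\<close>
lemma axial_double_series:
  fixes F :: "'n::{finite,linorder} pvec \<Rightarrow> 'n clifford"
  assumes "analytic_at_point F (t, 0)"
  obtains \<epsilon> d where "\<epsilon> > 0" "\<And>s v. \<bar>s\<bar> < \<epsilon> \<Longrightarrow> \<bar>v\<bar> < \<epsilon> \<Longrightarrow>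
    ((\<lambda>(i, j). (s ^ i * v ^ j) *\<^sub>R d i j) has_sum F (t + s, v *\<^sub>R axis k 1)) UNIV"
proof -
  obtain r c where r: "r > 0" and F: "\<And>x. x \<in> ball (t, 0) r \<Longrightarrow>
      ((\<lambda>\<alpha>. (\<Prod>b\<in>Basis. ((x - (t, 0)) \<bullet> b) ^ \<alpha> b) *\<^sub>R c \<alpha>) has_sum F x) (Basis \<rightarrow>\<^sub>E UNIV)"
    using assms(1) unfolding analytic_at_point_def by blast
  define b1 :: "'n pvec" where "b1 = (1, 0)"
  define b2 :: "'n pvec" where "b2 = (0, axis k 1)"
  have b: "b1 \<in> Basis" "b2 \<in> Basis" "b1 \<noteq> b2"
    by (auto simp: b1_def b2_def Basis_prod_def Basis_vec_def)
  define ix where "ix = (\<lambda>(i, j). \<lambda>b\<in>Basis. if b = b1 then i else if b = b2 then j else 0 :: nat)"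
  have inj: "inj ix"
  proof (rule injI)
    fix x y assume "ix x = ix y"
    then have "ix x b1 = ix y b1" "ix x b2 = ix y b2" by simp_all
    then show "x = y" using b by (cases x; cases y) (auto simp: ix_def)
  qed
  show ?thesis
  proof (rule that[of "r / 2" "\<lambda>i j. c (ix (i, j))"])
    show "r / 2 > 0" using r by simp
    fix s v :: real assume sv: "\<bar>s\<bar> < r / 2" "\<bar>v\<bar> < r / 2"
    define y :: "'n pvec" where "y = (s, v *\<^sub>R axis k 1)"
    have "norm y \<le> \<bar>s\<bar> + \<bar>v\<bar>" using norm_Pair_le[of s "v *\<^sub>R axis k 1 :: (real, 'n) vec"] by (simp add: y_def)
    then have "(t, 0) + y \<in> ball (t, 0) r" using sv by (simp add: dist_norm)
    from F[OF this] have sum: "((\<lambda>\<alpha>. (\<Prod>b\<in>Basis. (y \<bullet> b) ^ \<alpha> b) *\<^sub>R c \<alpha>) has_sum F ((t, 0) + y)) (Basis \<rightarrow>\<^sub>E UNIV)"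
      by simp
    have yb: "y \<bullet> b1 = s" "y \<bullet> b2 = v" by (simp_all add: y_def b1_def b2_def inner_axis_axis)
    have y0: "y \<bullet> b = 0" if "b \<in> Basis" "b \<noteq> b1" "b \<noteq> b2" for b
      using that by (auto simp: Basis_prod_def y_def b1_def b2_def Basis_vec_def inner_axis_axis split: if_splits)
    have "((\<lambda>\<alpha>. (\<Prod>b\<in>Basis. (y \<bullet> b) ^ \<alpha> b) *\<^sub>R c \<alpha>) has_sum F ((t, 0) + y)) (range ix)"
      using sum
    proof (rule has_sum_cong_neutral[THEN iffD1, rotated -1])
      fix \<alpha> assume \<alpha>: "\<alpha> \<in> (Basis \<rightarrow>\<^sub>E UNIV) - range ix"
      have "\<exists>b\<in>Basis - {b1, b2}. \<alpha> b \<noteq> 0"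
      proof (rule ccontr)
        assume "\<not> ?thesis"
        then have "\<alpha> = ix (\<alpha> b1, \<alpha> b2)"
          using \<alpha> by (auto simp: ix_def fun_eq_iff PiE_iff extensional_def)
        with \<alpha> show False by blast
      qed
      then obtain b where "b \<in> Basis" "b \<noteq> b1" "b \<noteq> b2" "\<alpha> b \<noteq> 0" by blast
      then have "(\<Prod>b\<in>Basis. (y \<bullet> b) ^ \<alpha> b) = 0"
        using y0[of b] by (intro prod_zero) (auto simp: power_0_left)
      then show "(\<Prod>b\<in>Basis. (y \<bullet> b) ^ \<alpha> b) *\<^sub>R c \<alpha> = 0" by simp
    next
      fix \<alpha> assume "\<alpha> \<in> range ix - (Basis \<rightarrow>\<^sub>E UNIV)"
      then show "(\<Prod>b\<in>Basis. (y \<bullet> b) ^ \<alpha> b) *\<^sub>R c \<alpha> = 0" by (auto simp: ix_def)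
    qed auto
    then have "(((\<lambda>\<alpha>. (\<Prod>b\<in>Basis. (y \<bullet> b) ^ \<alpha> b) *\<^sub>R c \<alpha>) \<circ> ix) has_sum F ((t, 0) + y)) UNIV"
      using has_sum_reindex[OF inj] by blast
    also have "(\<lambda>\<alpha>. (\<Prod>b\<in>Basis. (y \<bullet> b) ^ \<alpha> b) *\<^sub>R c \<alpha>) \<circ> ix = (\<lambda>(i, j). (s ^ i * v ^ j) *\<^sub>R c (ix (i, j)))"
    proof -
      have "(\<Prod>b\<in>Basis. (y \<bullet> b) ^ ix (i, j) b) = s ^ i * v ^ j" for i j
      proof -
        have "(\<Prod>b\<in>Basis. (y \<bullet> b) ^ ix (i, j) b) = (\<Prod>b\<in>{b1, b2}. (y \<bullet> b) ^ ix (i, j) b)"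
          by (rule prod.mono_neutral_right) (use b in \<open>auto simp: ix_def\<close>)
        then show ?thesis using b by (simp add: yb ix_def)
      qed
      then show ?thesis by (auto simp: fun_eq_iff)
    qed
    finally show "((\<lambda>(i, j). (s ^ i * v ^ j) *\<^sub>R c (ix (i, j))) has_sum F (t + s, v *\<^sub>R axis k 1)) UNIV"
      by (simp add: y_def)
  qed
qed

lemma gen_square: "gen j * gen j = - 1"
  using cvec_square[of "axis j 1"] by (simp add: cvec_axis)

lemma gen_square_left: "gen j * (gen j * a) = - a"
  by (simp add: gen_square flip: mult.assoc)

text \<open>
  The Vekua equation of an axially symmetric function on the line \<open>\<real> e\<^sub>k\<close>. Rotating \<open>e\<^sub>k\<close> towards \<open>e\<^sub>j\<close> keeps
  \<open>|x|\<close> fixed and changes only the direction in the axial form, so the derivative of \<open>F\<close> in the direction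
  \<open>e\<^sub>j\<close> is \<open>e\<^sub>j b / v\<close>, where \<open>e\<^sub>k b\<close> is the odd part of \<open>F\<close> along \<open>e\<^sub>k\<close>. The \<open>m - 1\<close> tangential directions
  add up to \<open>- (m - 1) b / v\<close>. Multiplication by \<open>v\<close> gives an equation without denominators.
\<close>
lemma axial_dirac:
  fixes F :: "'n::{finite,linorder} pvec \<Rightarrow> 'n clifford"
  assumes \<Omega>: "open \<Omega>" "(x\<^sub>0, v *\<^sub>R axis k 1) \<in> \<Omega>" "(x\<^sub>0, (- v) *\<^sub>R axis k 1) \<in> \<Omega>" and v: "v \<noteq> 0"
    and D: "(F has_derivative D) (at (x\<^sub>0, v *\<^sub>R axis k 1))"
      "dirac D = 0"
    and form: "\<And>x\<^sub>0 x. (x\<^sub>0, x) \<in> \<Omega> \<Longrightarrow> F (x\<^sub>0, x) = A x\<^sub>0 (norm x) + cvec (x /\<^sub>R norm x) * B x\<^sub>0 (norm x)"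
  shows "v *\<^sub>R D (1, 0) + v *\<^sub>R (gen k * D (0, axis k 1)) +
    ((real CARD('n) - 1) / 2) *\<^sub>R (gen k * (F (x\<^sub>0, v *\<^sub>R axis k 1) - F (x\<^sub>0, (- v) *\<^sub>R axis k 1))) = 0"
proof -
  define sg where "sg = v / \<bar>v\<bar>"
  have sg: "sg * sg = 1" using v by (simp add: sg_def)
  define b where "b = sg *\<^sub>R B x\<^sub>0 \<bar>v\<bar>"
  have lin: "linear D" using D(1) by (rule has_derivative_linear)
  have cv: "cvec ((v *\<^sub>R axis k 1) /\<^sub>R \<bar>v\<bar>) = sg *\<^sub>R gen k" "cvec (((- v) *\<^sub>R axis k 1) /\<^sub>R \<bar>v\<bar>) = - (sg *\<^sub>R gen k)"
    using cvec_scaleR[of "v / \<bar>v\<bar>" "axis k 1"] cvec_scaleR[of "(- v) / \<bar>v\<bar>" "axis k 1"]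
    by (simp_all add: sg_def cvec_axis divide_inverse mult.commute)
  have "F (x\<^sub>0, v *\<^sub>R axis k 1) = A x\<^sub>0 \<bar>v\<bar> + (sg *\<^sub>R gen k) * B x\<^sub>0 \<bar>v\<bar>"
    "F (x\<^sub>0, (- v) *\<^sub>R axis k 1) = A x\<^sub>0 \<bar>v\<bar> - (sg *\<^sub>R gen k) * B x\<^sub>0 \<bar>v\<bar>"
    using form[OF \<Omega>(2)] form[OF \<Omega>(3)] cv by simp_all
  then have diff: "F (x\<^sub>0, v *\<^sub>R axis k 1) - F (x\<^sub>0, (- v) *\<^sub>R axis k 1) = 2 *\<^sub>R (gen k * b)"
    by (simp only: b_def scaleR_2 mult_scaleR_left mult_scaleR_right) simp
  have tangential: "v *\<^sub>R D (0, axis j 1) = gen j * b" if j: "j \<noteq> k" for j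
  proof -
    \<comment> \<open>The curve that rotates the direction, starting at the given point.\<close>
    define \<gamma> :: "real \<Rightarrow> 'n pvec" where "\<gamma> \<theta> = (x\<^sub>0, (v * cos \<theta>) *\<^sub>R axis k 1 + (v * sin \<theta>) *\<^sub>R axis j 1)" for \<theta>
    have \<gamma>0: "\<gamma> 0 = (x\<^sub>0, v *\<^sub>R axis k 1)" by (simp add: \<gamma>_def)
    have "(\<gamma> has_derivative (\<lambda>h. h *\<^sub>R (0, v *\<^sub>R axis j 1))) (at 0)"
      unfolding \<gamma>_def[abs_def] by (auto intro!: derivative_eq_intros simp: fun_eq_iff)
    then have 1: "((\<lambda>\<theta>. F (\<gamma> \<theta>)) has_derivative (\<lambda>h. D (h *\<^sub>R (0, v *\<^sub>R axis j 1)))) (at 0)"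
      by (rule has_derivative_compose) (simp add: \<gamma>0 D)
    have "((\<lambda>\<theta>. A x\<^sub>0 \<bar>v\<bar> + cos \<theta> *\<^sub>R (gen k * b) + sin \<theta> *\<^sub>R (gen j * b)) has_derivative
        (\<lambda>h. h *\<^sub>R (gen j * b))) (at 0)"
      by (auto intro!: derivative_eq_intros simp: fun_eq_iff)
    then have 2: "((\<lambda>\<theta>. F (\<gamma> \<theta>)) has_derivative (\<lambda>h. h *\<^sub>R (gen j * b))) (at 0)"
    proof (rule has_derivative_transform_within_open)
      have "continuous_on UNIV \<gamma>" unfolding \<gamma>_def[abs_def] by (intro continuous_intros)
      then show "open (\<gamma> -` \<Omega>)" by (rule open_vimage[OF \<Omega>(1)])
      show "0 \<in> \<gamma> -` \<Omega>" using \<Omega>(2) by (simp add: \<gamma>0)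
      fix \<theta> assume "\<theta> \<in> \<gamma> -` \<Omega>"
      then have in_\<Omega>: "(x\<^sub>0, (v * cos \<theta>) *\<^sub>R axis k 1 + (v * sin \<theta>) *\<^sub>R axis j 1) \<in> \<Omega>"
        by (simp add: \<gamma>_def)
      let ?x = "(v * cos \<theta>) *\<^sub>R axis k 1 + (v * sin \<theta>) *\<^sub>R axis j 1 :: (real, 'n) vec"
      have "(norm ?x)\<^sup>2 = (v * cos \<theta>)\<^sup>2 + (v * sin \<theta>)\<^sup>2"
        unfolding power2_norm_eq_inner using j
        by (simp add: inner_add_left inner_add_right inner_axis_axis power2_eq_square)
      also have "\<dots> = v\<^sup>2" by (simp add: power_mult_distrib flip: distrib_left)
      finally have "norm ?x = \<bar>v\<bar>" by (metis abs_norm_cancel real_sqrt_abs)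
      then have "F (\<gamma> \<theta>) = A x\<^sub>0 \<bar>v\<bar> + cvec (?x /\<^sub>R \<bar>v\<bar>) * B x\<^sub>0 \<bar>v\<bar>"
        using form[OF in_\<Omega>] by (simp add: \<gamma>_def)
      also have "cvec (?x /\<^sub>R \<bar>v\<bar>) = (sg * cos \<theta>) *\<^sub>R gen k + (sg * sin \<theta>) *\<^sub>R gen j"
        by (simp add: cvec_add cvec_scaleR cvec_axis sg_def scaleR_add_right divide_inverse mult_ac)
      finally show "A x\<^sub>0 \<bar>v\<bar> + cos \<theta> *\<^sub>R (gen k * b) + sin \<theta> *\<^sub>R (gen j * b) = F (\<gamma> \<theta>)"
        by (simp add: b_def distrib_right mult_ac)
    qed
    from has_derivative_unique[OF 1 2] have "D (1 *\<^sub>R (0, v *\<^sub>R axis j 1)) = 1 *\<^sub>R (gen j * b)"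
      by (rule fun_cong)
    moreover have "D (0, v *\<^sub>R axis j 1) = v *\<^sub>R D (0, axis j 1)"
      using linear_cmul[OF lin, of v "(0, axis j 1)"] by simp
    ultimately show ?thesis by simp
  qed
  have "v *\<^sub>R (\<Sum>j\<in>UNIV. gen j * D (0, axis j 1)) =
      v *\<^sub>R (gen k * D (0, axis k 1)) + (\<Sum>j\<in>UNIV - {k}. gen j * (v *\<^sub>R D (0, axis j 1)))"
    by (simp add: sum.remove[of UNIV k] scaleR_add_right scaleR_sum_right)
  also have "(\<Sum>j\<in>UNIV - {k}. gen j * (v *\<^sub>R D (0, axis j 1))) = (\<Sum>j\<in>UNIV - {k}. - b)"
    by (rule sum.cong) (simp_all add: tangential gen_square_left del: mult_scaleR_right)
  also have "\<dots> = - ((real CARD('n) - 1) *\<^sub>R b)"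
    by (simp add: sum_constant_scaleR card_Diff_subset of_nat_diff Suc_leI scaleR_conv_of_real)
  finally have "v *\<^sub>R (dirac D) =
      v *\<^sub>R D (1, 0) + v *\<^sub>R (gen k * D (0, axis k 1)) - (real CARD('n) - 1) *\<^sub>R b"
    by (simp add: scaleR_add_right)
  then show ?thesis
    unfolding diff by (simp add: D(2) gen_square_left)
qed


text \<open>
  Let \<open>d i j\<close> be the coefficient of \<open>s\<^sup>i v\<^sup>j\<close> in the expansion of \<open>F (t + s, v e\<^sub>k)\<close>. The Vekua equation gives
  \<open>(i + 1) d\<^sub>i\<^sub>+\<^sub>1\<^sub>,\<^sub>j\<^sub>-\<^sub>1 + (j + (m - 1) [j odd]) e\<^sub>k d\<^sub>i\<^sub>,\<^sub>j = 0\<close> for \<open>j > 0\<close>. The real factor is positive and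
  \<open>e\<^sub>k\<close> is invertible, so all coefficients vanish if those with \<open>j = 0\<close> do. Thus \<open>F\<close> is zero along \<open>e\<^sub>k\<close>, and
  the axial form carries this to all directions.
\<close>
lemma axially_monogenic_zero_near_axis:
  fixes F :: "'n::{finite,linorder} pvec \<Rightarrow> 'n clifford"
  assumes F: "axially_monogenic \<Omega> F" and \<Omega>: "open \<Omega>" "(t, 0) \<in> \<Omega>"
    and zero: "\<delta> > 0" "\<And>u. \<bar>u - t\<bar> < \<delta> \<Longrightarrow> F (u, 0) = 0"
  shows "\<exists>\<epsilon>>0. \<forall>u x. \<bar>u - t\<bar> < \<epsilon> \<longrightarrow> norm x < \<epsilon> \<longrightarrow> F (u, x) = 0"
proof -
  define k :: 'n where "k = undefined"
  have an: "analytic_at_point F p" if "p \<in> \<Omega>" for p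
    using F that by (auto simp: axially_monogenic_def real_analytic_on_iff)
  obtain A B where form: "\<And>x\<^sub>0 x. (x\<^sub>0, x) \<in> \<Omega> \<Longrightarrow>
      F (x\<^sub>0, x) = A x\<^sub>0 (norm x) + cvec (x /\<^sub>R norm x) * B x\<^sub>0 (norm x)"
    using F unfolding axially_monogenic_def by blast
  obtain \<epsilon>\<^sub>0 d where \<epsilon>\<^sub>0: "\<epsilon>\<^sub>0 > 0" and ser: "\<And>s v. \<bar>s\<bar> < \<epsilon>\<^sub>0 \<Longrightarrow> \<bar>v\<bar> < \<epsilon>\<^sub>0 \<Longrightarrow>
      ((\<lambda>(i, j). (s ^ i * v ^ j) *\<^sub>R d i j) has_sum F (t + s, v *\<^sub>R axis k 1)) UNIV"
    using axial_double_series[OF an[OF \<Omega>(2)], of k] by blast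
  obtain r where r: "r > 0" "\<And>u x. \<bar>u - t\<bar> < r \<Longrightarrow> norm x < r \<Longrightarrow> (u, x) \<in> \<Omega>"
    using open_axis_box[OF \<Omega>] by metis
  define \<epsilon> where "\<epsilon> = Min {\<epsilon>\<^sub>0, r, \<delta>}"
  have \<epsilon>: "\<epsilon> > 0" "\<epsilon> \<le> \<epsilon>\<^sub>0" "\<epsilon> \<le> r" "\<epsilon> \<le> \<delta>" using \<epsilon>\<^sub>0 r(1) zero(1) by (auto simp: \<epsilon>_def)
  have serL: "((\<lambda>(i, j). L (d i j) * s ^ i * v ^ j) has_sum L (F (t + s, v *\<^sub>R axis k 1))) UNIV"
    if L: "bounded_linear L" and "\<bar>s\<bar> < \<epsilon>" "\<bar>v\<bar> < \<epsilon>" for L :: "'n clifford \<Rightarrow> real" and s v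
  proof -
    have "((L \<circ> (\<lambda>(i, j). (s ^ i * v ^ j) *\<^sub>R d i j)) has_sum L (F (t + s, v *\<^sub>R axis k 1))) UNIV"
      using has_sum_bounded_linear[OF L ser[of s v]] that \<epsilon> by (simp add: o_def)
    also have "L \<circ> (\<lambda>(i, j). (s ^ i * v ^ j) *\<^sub>R d i j) = (\<lambda>(i, j). L (d i j) * s ^ i * v ^ j)"
      by (auto simp: fun_eq_iff linear_cmul[OF bounded_linear.linear[OF L]])
    finally show ?thesis .
  qed
  have recursion: "(if j = 0 then 0 else real (i + 1) * coef (d (i + 1) (j - 1)) X) +
      (if j = 0 then 0 else real j * coef (gen k * d i j) X) +
      (real CARD('n) - 1) / 2 * (1 - (- 1) ^ j) * coef (gen k * d i j) X = 0" (is "?c i j = 0") for i j X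
  proof (rule double_series_zero[where p = ?c, OF \<epsilon>(1)])
    fix s v :: real assume s: "\<bar>s\<bar> < \<epsilon>" and v: "\<bar>v\<bar> < \<epsilon>"
    let ?p = "\<lambda>i j. coef (d i j) X" and ?q = "\<lambda>i j. coef (gen k * d i j) X"
    define \<phi> where "\<phi> s v = coef (F (t + s, v *\<^sub>R axis k 1)) X" for s v
    define \<psi> where "\<psi> s v = coef (gen k * F (t + s, v *\<^sub>R axis k 1)) X" for s v
    have L': "bounded_linear (\<lambda>x. coef (gen k * x) X)"
      by (rule bounded_linear_compose[OF bounded_linear_coef bounded_linear_clifford_mult_right])
    have \<phi>: "((\<lambda>(i, j). ?p i j * s ^ i * v ^ j) has_sum \<phi> s v) UNIV" if "\<bar>s\<bar> < \<epsilon>" "\<bar>v\<bar> < \<epsilon>" for s v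
      unfolding \<phi>_def by (rule serL[OF bounded_linear_coef that])
    have \<psi>: "((\<lambda>(i, j). ?q i j * s ^ i * v ^ j) has_sum \<psi> s v) UNIV" if "\<bar>s\<bar> < \<epsilon>" "\<bar>v\<bar> < \<epsilon>" for s v
      unfolding \<psi>_def by (rule serL[OF L' that])
    show "((\<lambda>(i, j). ?c i j * s ^ i * v ^ j) has_sum 0) UNIV"
    \<comment> \<open>The equation is only available off the axis; at \<open>v = 0\<close> all terms vanish because \<open>?c i 0 = 0\<close>.\<close>
    proof (cases "v = 0")
      case True
      then have "(\<lambda>(i, j). ?c i j * s ^ i * v ^ j) = (\<lambda>_. 0)" by (auto simp: fun_eq_iff power_0_left)
      then show ?thesis by (simp only: has_sum_0_simp)
    next
      case False
      define P where "P = (t + s, v *\<^sub>R axis k 1 :: (real, 'n) vec)"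
      have in_\<Omega>: "P \<in> \<Omega>" "(t + s, (- v) *\<^sub>R axis k 1) \<in> \<Omega>"
        using s v \<epsilon> by (auto simp: P_def intro!: r(2))
      have "F differentiable at P" by (rule analytic_at_point_differentiable[OF an[OF in_\<Omega>(1)]])
      then obtain D where D: "(F has_derivative D) (at P)" by (auto simp: differentiable_def)
      have dirac: "dirac D = 0"
      proof -
        have "dirac (frechet_derivative F (at P)) = 0"
          using F in_\<Omega>(1) unfolding axially_monogenic_def by blast
        then show ?thesis unfolding frechet_derivative_at[OF D, symmetric] .
      qed
      have lin: "linear D" using D by (rule has_derivative_linear)
      have pde: "v *\<^sub>R D (1, 0) + v *\<^sub>R (gen k * D (0, axis k 1)) + ((real CARD('n) - 1) / 2) *\<^sub>R
          (gen k * (F (t + s, v *\<^sub>R axis k 1) - F (t + s, (- v) *\<^sub>R axis k 1))) = 0"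
        using axial_dirac[OF \<Omega>(1) in_\<Omega>[unfolded P_def] False D[unfolded P_def] dirac form] by simp
      have pde: "v * coef (D (1, 0)) X + v * coef (gen k * D (0, axis k 1)) X +
          (real CARD('n) - 1) / 2 * (\<psi> s v - \<psi> s (- v)) = 0"
        using arg_cong[OF pde, of "\<lambda>x. coef x X"] by (simp add: \<psi>_def right_diff_distrib)
      have "((\<lambda>s. F (t + s, v *\<^sub>R axis k 1)) has_derivative (\<lambda>h. D (h, 0))) (at s)"
        by (rule has_derivative_compose[where f = "\<lambda>s. (t + s, v *\<^sub>R axis k 1)" and g = F])
          (auto intro!: derivative_eq_intros D[unfolded P_def])
      from bounded_linear.has_derivative[OF bounded_linear_coef this, of X]
      have "((\<lambda>s. \<phi> s v) has_field_derivative coef (D (1, 0)) X) (at s)"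
        unfolding has_field_derivative_def \<phi>_def
      proof (rule has_derivative_eq_rhs)
        have D_h: "D (h, 0) = h *\<^sub>R D (1, 0)" for h using linear_cmul[OF lin, of h "(1, 0)"] by simp
        show "(\<lambda>h. coef (D (h, 0)) X) = (*) (coef (D (1, 0)) X)"
          by (rule ext) (subst D_h, simp)
      qed
      from double_series_shift[OF double_series_deriv[OF \<phi>[OF _ v] s this]]
      have S1: "((\<lambda>(i, j). (if j = 0 then 0 else real (i + 1) * ?p (i + 1) (j - 1)) * s ^ i * v ^ j)
          has_sum v * coef (D (1, 0)) X) UNIV" .
      have "((\<lambda>v. F (t + s, v *\<^sub>R axis k 1)) has_derivative (\<lambda>h. D (0, h *\<^sub>R axis k 1))) (at v)"
        by (rule has_derivative_compose[where f = "\<lambda>v. (t + s, v *\<^sub>R axis k 1)" and g = F])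
          (auto intro!: derivative_eq_intros D[unfolded P_def])
      from bounded_linear.has_derivative[OF L' this]
      have der: "(\<psi> s has_field_derivative coef (gen k * D (0, axis k 1)) X) (at v)"
        unfolding has_field_derivative_def \<psi>_def[abs_def]
      proof (rule has_derivative_eq_rhs)
        have D_h: "D (0, h *\<^sub>R axis k 1) = h *\<^sub>R D (0, axis k 1)" for h
          using linear_cmul[OF lin, of h "(0, axis k 1)"] by simp
        show "(\<lambda>h. coef (gen k * D (0, h *\<^sub>R axis k 1)) X) = (*) (coef (gen k * D (0, axis k 1)) X)"
          by (rule ext) (subst D_h, simp)
      qed
      have "((\<lambda>(j, i). ?q i j * v ^ j * s ^ i) has_sum \<psi> s v) UNIV" if "\<bar>v\<bar> < \<epsilon>" for v
        using \<psi>[OF s that] by (subst double_series_swap) (simp add: mult_ac)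
      from double_series_deriv[OF this v der]
      have "((\<lambda>(j, i). real (j + 1) * ?q i (j + 1) * v ^ j * s ^ i) has_sum coef (gen k * D (0, axis k 1)) X) UNIV" .
      then have "((\<lambda>(i, j). real (j + 1) * ?q i (j + 1) * s ^ i * v ^ j) has_sum coef (gen k * D (0, axis k 1)) X) UNIV"
        by (subst double_series_swap) (simp add: mult_ac)
      from double_series_shift[OF this]
      have S2: "((\<lambda>(i, j). (if j = 0 then 0 else real j * ?q i j) * s ^ i * v ^ j)
          has_sum v * coef (gen k * D (0, axis k 1)) X) UNIV"
        by (rule has_sum_cong[THEN iffD1, rotated]) auto
      have "((\<lambda>x. (case x of (i, j) \<Rightarrow> ?q i j * s ^ i * v ^ j) - (case x of (i, j) \<Rightarrow> ?q i j * s ^ i * (- v) ^ j))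
          has_sum (\<psi> s v - \<psi> s (- v))) UNIV"
        using has_sum_add[OF \<psi>[OF s v] has_sum_uminusI[OF \<psi>[OF s, of "- v"]]] v by simp
      from has_sum_add[OF has_sum_add[OF S1 S2] has_sum_cmult_right[OF this, of "(real CARD('n) - 1) / 2"]]
      show ?thesis
        unfolding pde
        by (rule has_sum_cong[THEN iffD1, rotated]) (auto simp: algebra_simps power_minus[of v])
    qed
  qed
  have d_zero: "d i j = 0" for i j
  proof (induction j arbitrary: i)
    case 0
    show ?case
    proof (rule clifford_eqI)
      fix X
      have "(\<lambda>i. coef (d i 0) X * s ^ i) sums 0" if s: "\<bar>s\<bar> < \<epsilon>" for s
      proof (rule has_sum_imp_sums, rule has_sum_SigmaD)
        show "((\<lambda>(i, j). coef (d i j) X * s ^ i * 0 ^ j) has_sum 0) (Sigma UNIV (\<lambda>_. UNIV))"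
          using serL[OF bounded_linear_coef[of X] s, of 0] zero(2)[of "t + s"] s \<epsilon> by simp
        show "((\<lambda>j. case (i, j) of (i, j) \<Rightarrow> coef (d i j) X * s ^ i * 0 ^ j) has_sum coef (d i 0) X * s ^ i) UNIV" for i
          by (rule has_sum_finite_neutralI[where B = "{0}"]) (auto simp: power_0_left)
      qed
      from power_series_zero[OF \<epsilon>(1) this] show "coef (d i 0) X = coef 0 X" by simp
    qed
  next
    case (Suc j)
    have "gen k * d i (Suc j) = 0"
    proof (rule clifford_eqI)
      fix X
      have "(real (Suc j) + (real CARD('n) - 1) / 2 * (1 - (- 1) ^ Suc j)) * coef (gen k * d i (Suc j)) X = 0"
        using recursion[of "Suc j" i X] Suc.IH[of "i + 1"] by (simp add: algebra_simps)
      moreover have "real (Suc j) + (real CARD('n) - 1) / 2 * (1 - (- 1) ^ Suc j) > 0"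
      proof (rule add_pos_nonneg)
        have "real CARD('n) - 1 \<ge> 0" by (simp add: Suc_leI)
        then show "(real CARD('n) - 1) / 2 * (1 - (- 1) ^ Suc j) \<ge> 0"
          by (cases "even j") auto
      qed simp
      ultimately show "coef (gen k * d i (Suc j)) X = coef 0 X" by simp
    qed
    then show ?case using gen_square_left[of k "d i (Suc j)"] by simp
  qed
  have axis_zero: "F (u, v *\<^sub>R axis k 1) = 0" if "\<bar>u - t\<bar> < \<epsilon>" "\<bar>v\<bar> < \<epsilon>" for u v
    using ser[of "u - t" v] that \<epsilon> by (auto simp: d_zero case_prod_unfold dest: has_sum_unique[OF has_sum_0_simp])
  show ?thesis
  proof (intro exI[of _ \<epsilon>] conjI allI impI \<epsilon>(1))
    fix u and x :: "(real, 'n) vec" assume u: "\<bar>u - t\<bar> < \<epsilon>" and x: "norm x < \<epsilon>"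
    define n where "n = norm x"
    show "F (u, x) = 0"
    proof (cases "x = 0")
      case True
      then show ?thesis using axis_zero[OF u, of 0] \<epsilon> by simp
    next
      case False
      then have n: "n > 0" "n < \<epsilon>" using x by (simp_all add: n_def)
      have "(u, n *\<^sub>R axis k 1) \<in> \<Omega>" "(u, (- n) *\<^sub>R axis k 1) \<in> \<Omega>" "(u, x) \<in> \<Omega>"
        using u n x \<epsilon> by (auto intro!: r(2))
      note f = this[THEN form]
      have "cvec ((n *\<^sub>R axis k 1) /\<^sub>R n) = gen k" "cvec (((- n) *\<^sub>R axis k 1) /\<^sub>R n) = - gen k"
        using n cvec_scaleR[of "- 1" "axis k 1"] by (simp_all add: cvec_axis)
      then have "A u n + gen k * B u n = 0" "A u n - gen k * B u n = 0"
        using f(1,2) axis_zero[OF u, of n] axis_zero[OF u, of "- n"] n by simp_all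
      then have "2 *\<^sub>R A u n = 0" "gen k * B u n = A u n"
        by (simp_all add: scaleR_2)
      then have A: "A u n = 0" and "gen k * B u n = 0" by simp_all
      then have "B u n = 0" using gen_square_left[of k "B u n"] by simp
      with A f(3) show ?thesis by (simp add: n_def)
    qed
  qed
qed

lemma axially_monogenic_analytic: "axially_monogenic \<Omega> F \<Longrightarrow> p \<in> \<Omega> \<Longrightarrow> analytic_at_point F p"
  by (simp add: axially_monogenic_def real_analytic_on_iff)

lemma axially_monogenicD:
  assumes "axially_monogenic \<Omega> F" "p \<in> \<Omega>"
  obtains D where "(F has_derivative D) (at p)" "dirac D = 0"
proof -
  have "(F has_derivative frechet_derivative F (at p)) (at p)"
    using analytic_at_point_differentiable[OF axially_monogenic_analytic[OF assms]] frechet_derivative_works by blast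
  moreover have "dirac (frechet_derivative F (at p)) = 0"
    using assms unfolding axially_monogenic_def by blast
  ultimately show ?thesis by (rule that)
qed

lemma axially_monogenic_add_mult_right:
  fixes F G :: "'n::{finite,linorder} pvec \<Rightarrow> 'n clifford"
  assumes F: "axially_monogenic \<Omega> F" and G: "axially_monogenic \<Omega>' G"
  shows "axially_monogenic (\<Omega> \<inter> \<Omega>') (\<lambda>p. F p + G p * c)"
  unfolding axially_monogenic_def
proof (intro conjI ballI)
  show "real_analytic_on (\<lambda>p. F p + G p * c) (\<Omega> \<inter> \<Omega>')"
    unfolding real_analytic_on_iff
    by (intro ballI analytic_at_point_add[OF axially_monogenic_analytic[OF F]
        analytic_at_point_bounded_linear[OF axially_monogenic_analytic[OF G] bounded_linear_clifford_mult_left]]) auto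
  fix p assume p: "p \<in> \<Omega> \<inter> \<Omega>'"
  obtain D where D: "(F has_derivative D) (at p)" "dirac D = 0"
    using axially_monogenicD[OF F, of p] p by blast
  obtain E where E: "(G has_derivative E) (at p)" "dirac E = 0"
    using axially_monogenicD[OF G, of p] p by blast
  have "((\<lambda>p. F p + G p * c) has_derivative (\<lambda>y. D y + E y * c)) (at p)"
    by (intro has_derivative_add D(1) bounded_linear.has_derivative[OF bounded_linear_clifford_mult_left E(1)])
  note fd = frechet_derivative_at[OF this, symmetric]
  have "dirac (\<lambda>y. D y + E y * c) = dirac D + dirac E * c"
    by (simp add: distrib_left distrib_right sum.distrib sum_distrib_right mult.assoc)
  then show "dirac (frechet_derivative (\<lambda>p. F p + G p * c) (at p)) = 0"
    unfolding fd by (simp add: D(2) E(2))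
next
  obtain A B where "\<And>u v. A u (- v) = A u v \<and> B u (- v) = - B u v"
      "\<And>x\<^sub>0 x. (x\<^sub>0, x) \<in> \<Omega> \<Longrightarrow> F (x\<^sub>0, x) = A x\<^sub>0 (norm x) + cvec (x /\<^sub>R norm x) * B x\<^sub>0 (norm x)"
    using F unfolding axially_monogenic_def by blast
  moreover obtain A' B' where "\<And>u v. A' u (- v) = A' u v \<and> B' u (- v) = - B' u v"
      "\<And>x\<^sub>0 x. (x\<^sub>0, x) \<in> \<Omega>' \<Longrightarrow> G (x\<^sub>0, x) = A' x\<^sub>0 (norm x) + cvec (x /\<^sub>R norm x) * B' x\<^sub>0 (norm x)"
    using G unfolding axially_monogenic_def by blast
  ultimately show "\<exists>A B :: real \<Rightarrow> real \<Rightarrow> 'n clifford. (\<forall>u v. A u (- v) = A u v \<and> B u (- v) = - B u v) \<and>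
      (\<forall>(x\<^sub>0, x)\<in>\<Omega> \<inter> \<Omega>'. F (x\<^sub>0, x) + G (x\<^sub>0, x) * c = A x\<^sub>0 (norm x) + cvec (x /\<^sub>R norm x) * B x\<^sub>0 (norm x))"
    by (intro exI[of _ "\<lambda>u v. A u v + A' u v * c"] exI[of _ "\<lambda>u v. B u v + B' u v * c"])
      (auto simp: distrib_left distrib_right mult.assoc)
qed

lemma axially_monogenic_unique:
  fixes F G :: "'n::{finite,linorder} pvec \<Rightarrow> 'n clifford"
  assumes F: "axially_monogenic \<Omega> F" and G: "axially_monogenic \<Omega>' G"
    and \<Omega>: "open \<Omega>" "\<And>t. t \<in> \<Omega>\<^sub>1 \<Longrightarrow> (t, 0) \<in> \<Omega>" "open \<Omega>'" "\<And>t. t \<in> \<Omega>\<^sub>1 \<Longrightarrow> (t, 0) \<in> \<Omega>'"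
    and \<Omega>\<^sub>1: "open \<Omega>\<^sub>1" and eq: "\<And>t. t \<in> \<Omega>\<^sub>1 \<Longrightarrow> F (t, 0) = G (t, 0)"
  shows "near \<Omega>\<^sub>1 (\<lambda>p. F p = G p)"
proof -
  have D: "axially_monogenic (\<Omega> \<inter> \<Omega>') (\<lambda>p. F p + G p * (- 1))"
    by (rule axially_monogenic_add_mult_right[OF F G])
  have "\<exists>\<epsilon>>0. \<forall>u x. \<bar>u - t\<bar> < \<epsilon> \<longrightarrow> norm x < \<epsilon> \<longrightarrow> F (u, x) + G (u, x) * (- 1) = 0" if t: "t \<in> \<Omega>\<^sub>1" for t
  proof -
    obtain \<delta> where \<delta>: "\<delta> > 0" "ball t \<delta> \<subseteq> \<Omega>\<^sub>1" using \<Omega>\<^sub>1 t by (meson openE)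
    have "F (u, 0) + G (u, 0) * (- 1) = 0" if "\<bar>u - t\<bar> < \<delta>" for u
      using eq[of u] \<delta>(2) that by (auto simp: subset_iff dist_real_def abs_minus_commute)
    from axially_monogenic_zero_near_axis[OF D _ _ \<delta>(1) this] \<Omega> t show ?thesis by auto
  qed
  then obtain \<epsilon> where \<epsilon>: "\<And>t. t \<in> \<Omega>\<^sub>1 \<Longrightarrow> \<epsilon> t > 0"
      "\<And>t u x. t \<in> \<Omega>\<^sub>1 \<Longrightarrow> \<bar>u - t\<bar> < \<epsilon> t \<Longrightarrow> norm x < \<epsilon> t \<Longrightarrow> F (u, x) + G (u, x) * (- 1) = 0"
    by metis
  show ?thesis
    unfolding near_def
  proof (intro exI[of _ "boxes \<Omega>\<^sub>1 \<epsilon>"] conjI ballI open_boxes)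
    show "(t, 0) \<in> boxes \<Omega>\<^sub>1 \<epsilon>" if "t \<in> \<Omega>\<^sub>1" for t
      using that \<epsilon>(1)[OF that] by (auto simp: boxes_def intro!: bexI[of _ t])
    fix p :: "'n pvec" assume "p \<in> boxes \<Omega>\<^sub>1 \<epsilon>"
    then show "F p = G p" using \<epsilon>(2) by (force simp: boxes_def)
  qed
qed

lemma axially_monogenic_restriction_analytic:
  fixes F :: "'n::{finite,linorder} pvec \<Rightarrow> 'n clifford"
  assumes F: "axially_monogenic \<Omega> F" and \<Omega>: "\<And>t. t \<in> \<Omega>\<^sub>1 \<Longrightarrow> (t, 0) \<in> \<Omega>" and \<Omega>\<^sub>1: "open \<Omega>\<^sub>1"
  shows "(\<lambda>t. if t \<in> \<Omega>\<^sub>1 then F (t, 0) else 0) \<in> analytic_tensor \<Omega>\<^sub>1"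
  unfolding analytic_tensor_def real_analytic_on_iff
proof (intro CollectI conjI allI ballI)
  fix A t assume t: "t \<in> \<Omega>\<^sub>1"
  obtain \<epsilon> d where \<epsilon>: "\<epsilon> > 0" and ser: "\<And>s v. \<bar>s\<bar> < \<epsilon> \<Longrightarrow> \<bar>v\<bar> < \<epsilon> \<Longrightarrow>
      ((\<lambda>(i, j). (s ^ i * v ^ j) *\<^sub>R d i j) has_sum F (t + s, v *\<^sub>R axis undefined 1)) UNIV"
    using axial_double_series[OF axially_monogenic_analytic[OF F \<Omega>[OF t]], of undefined] by blast
  obtain r where r: "r > 0" "ball t r \<subseteq> \<Omega>\<^sub>1" using \<Omega>\<^sub>1 t by (meson openE)
  show "analytic_at_point (\<lambda>t. coef (if t \<in> \<Omega>\<^sub>1 then F (t, 0) else 0) A) t"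
    unfolding analytic_at_point_def
  proof (intro exI[of _ "min \<epsilon> r"] exI[of _ "\<lambda>\<alpha>. coef (d (\<alpha> 1) 0) A"] conjI ballI)
    show "min \<epsilon> r > 0" using \<epsilon> r by simp
    fix x assume x: "x \<in> ball t (min \<epsilon> r)"
    have "((\<lambda>n. (x - t) ^ n *\<^sub>R d n 0) has_sum F (t + (x - t), 0)) UNIV"
    proof (rule has_sum_SigmaD)
      show "((\<lambda>(i, j). ((x - t) ^ i * 0 ^ j) *\<^sub>R d i j) has_sum F (t + (x - t), 0)) (Sigma UNIV (\<lambda>_. UNIV))"
        using ser[of "x - t" 0] x \<epsilon> by (simp add: dist_real_def abs_minus_commute)
      show "((\<lambda>j. case (i, j) of (i, j) \<Rightarrow> ((x - t) ^ i * 0 ^ j) *\<^sub>R d i j) has_sum (x - t) ^ i *\<^sub>R d i 0) UNIV" for i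
        by (rule has_sum_finite_neutralI[where B = "{0}"]) (auto simp: power_0_left)
    qed
    from has_sum_bounded_linear[OF bounded_linear_coef this, of A]
    show "((\<lambda>\<alpha>. (\<Prod>b\<in>Basis. ((x - t) \<bullet> b) ^ \<alpha> b) *\<^sub>R coef (d (\<alpha> 1) 0) A) has_sum
        coef (if x \<in> \<Omega>\<^sub>1 then F (x, 0) else 0) A) (Basis \<rightarrow>\<^sub>E UNIV)"
      unfolding has_sum_multi_indices_real[of "x - t" "\<lambda>\<alpha>. coef (d (\<alpha> 1) 0) A"] using x r by (auto simp: o_def)
  qed
qed simp

section \<open>Germs and right modules\<close>

lemma near_conj:
  assumes "near \<Omega>\<^sub>1 P" "near \<Omega>\<^sub>1 Q"
  shows "near \<Omega>\<^sub>1 (\<lambda>p. P p \<and> Q p)"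
proof -
  obtain U V where "open U" "\<forall>t\<in>\<Omega>\<^sub>1. (t, 0) \<in> U" "\<forall>p\<in>U. P p"
    "open V" "\<forall>t\<in>\<Omega>\<^sub>1. (t, 0) \<in> V" "\<forall>p\<in>V. Q p"
    using assms unfolding near_def by blast
  then show ?thesis
    unfolding near_def by (intro exI[of _ "U \<inter> V"]) auto
qed

lemma near_mono: "near \<Omega>\<^sub>1 P \<Longrightarrow> (\<And>p. P p \<Longrightarrow> Q p) \<Longrightarrow> near \<Omega>\<^sub>1 Q"
  unfolding near_def by blast

lemma near_True: "(\<And>p. P p) \<Longrightarrow> near \<Omega>\<^sub>1 P"
  unfolding near_def by (intro exI[of _ UNIV]) auto

lemma near_axis: "near \<Omega>\<^sub>1 P \<Longrightarrow> t \<in> \<Omega>\<^sub>1 \<Longrightarrow> P (t, 0)"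
  unfolding near_def by blast

lemma germ_refl: "f \<in> germ \<Omega>\<^sub>1 f"
  by (simp add: germ_def near_True)

lemma germ_eq_iff: "germ \<Omega>\<^sub>1 f = germ \<Omega>\<^sub>1 g \<longleftrightarrow> near \<Omega>\<^sub>1 (\<lambda>p. f p = g p)"
proof
  assume "germ \<Omega>\<^sub>1 f = germ \<Omega>\<^sub>1 g"
  then have "f \<in> germ \<Omega>\<^sub>1 g" using germ_refl[of f \<Omega>\<^sub>1] by simp
  then show "near \<Omega>\<^sub>1 (\<lambda>p. f p = g p)" by (simp add: germ_def)
next
  assume *: "near \<Omega>\<^sub>1 (\<lambda>p. f p = g p)"
  show "germ \<Omega>\<^sub>1 f = germ \<Omega>\<^sub>1 g"
    unfolding germ_def
  proof (rule Collect_cong, rule iffI)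
    show "near \<Omega>\<^sub>1 (\<lambda>p. G p = g p)" if "near \<Omega>\<^sub>1 (\<lambda>p. G p = f p)" for G
      by (rule near_mono[OF near_conj[OF * that]]) simp
    show "near \<Omega>\<^sub>1 (\<lambda>p. G p = f p)" if "near \<Omega>\<^sub>1 (\<lambda>p. G p = g p)" for G
      by (rule near_mono[OF near_conj[OF * that]]) simp
  qed
qed

text \<open>
  Operations on germs are unions over representatives; such a union is a single germ if the result does
  not depend on the representative.
\<close>
lemma germ_UN_lift:
  assumes "\<And>f'. near \<Omega>\<^sub>1 (\<lambda>p. f' p = f p) \<Longrightarrow> G f' = G f"
  shows "(\<Union>f'\<in>germ \<Omega>\<^sub>1 f. G f') = G f"
proof -
  have "(\<Union>f'\<in>germ \<Omega>\<^sub>1 f. G f') = (\<Union>f'\<in>germ \<Omega>\<^sub>1 f. G f)"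
    using assms by (intro SUP_cong refl) (simp add: germ_def)
  also have "\<dots> = G f" by (metis UN_constant empty_iff germ_refl)
  finally show ?thesis .
qed

lemma germ_module_mult:
  "germ \<Omega>\<^sub>1 f \<otimes>\<^bsub>germ_module \<Omega>\<^sub>1 X\<^esub> germ \<Omega>\<^sub>1 g = germ \<Omega>\<^sub>1 (\<lambda>p. f p + g p)"
proof -
  have "(\<Union>g'\<in>germ \<Omega>\<^sub>1 g. germ \<Omega>\<^sub>1 (\<lambda>p. f' p + g' p)) = germ \<Omega>\<^sub>1 (\<lambda>p. f' p + g p)" for f'
    by (rule germ_UN_lift) (auto simp: germ_eq_iff elim: near_mono)
  moreover have "(\<Union>f'\<in>germ \<Omega>\<^sub>1 f. germ \<Omega>\<^sub>1 (\<lambda>p. f' p + g p)) = germ \<Omega>\<^sub>1 (\<lambda>p. f p + g p)"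
    by (rule germ_UN_lift) (auto simp: germ_eq_iff elim: near_mono)
  ultimately show ?thesis by (simp add: germ_module_def)
qed

lemma germ_module_act:
  "act (germ_module \<Omega>\<^sub>1 X) (germ \<Omega>\<^sub>1 f) c = germ \<Omega>\<^sub>1 (\<lambda>p. f p * c)"
proof -
  have "(\<Union>f'\<in>germ \<Omega>\<^sub>1 f. germ \<Omega>\<^sub>1 (\<lambda>p. f' p * c)) = germ \<Omega>\<^sub>1 (\<lambda>p. f p * c)"
    by (rule germ_UN_lift) (auto simp: germ_eq_iff elim: near_mono)
  then show ?thesis by (simp add: germ_module_def)
qed

lemma right_module_iso_transport:
  assumes M: "right_module M" and bij: "bij_betw h (carrier M) (carrier N)"
    and mult: "\<And>x y. x \<in> carrier M \<Longrightarrow> y \<in> carrier M \<Longrightarrow> h (x \<otimes>\<^bsub>M\<^esub> y) = h x \<otimes>\<^bsub>N\<^esub> h y"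
    and one: "h \<one>\<^bsub>M\<^esub> = \<one>\<^bsub>N\<^esub>"
    and act: "\<And>x c. x \<in> carrier M \<Longrightarrow> h (act M x c) = act N (h x) c"
  shows "right_module_iso M N h"
proof -
  interpret comm_group M using M by (simp add: right_module_def)
  have car: "carrier N = h ` carrier M" using bij by (simp add: bij_betw_imp_surj_on)
  have act_closed: "x \<in> carrier M \<Longrightarrow> act M x c \<in> carrier M" for x c
    using M by (simp add: right_module_def)
  have "comm_group N"
  proof (rule comm_groupI)
    fix x assume "x \<in> carrier N"
    then obtain a where "x = h a" "a \<in> carrier M" by (auto simp: car)
    then have "h (inv\<^bsub>M\<^esub> a) \<otimes>\<^bsub>N\<^esub> x = \<one>\<^bsub>N\<^esub>" by (simp add: one flip: mult)
    then show "\<exists>y\<in>carrier N. y \<otimes>\<^bsub>N\<^esub> x = \<one>\<^bsub>N\<^esub>"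
      using \<open>a \<in> carrier M\<close> by (auto simp: car)
  qed (auto simp: car m_ac simp flip: mult one)
  moreover have "right_module N \<longleftrightarrow> comm_group N"
    using M unfolding right_module_def car
    by (auto simp: act_closed simp flip: mult act)
  moreover have "h \<in> iso M N"
    using bij mult by (auto simp: iso_def hom_def car)
  ultimately show ?thesis using M act by (simp add: right_module_iso_def)
qed

lemma right_module_iso_factor:
  assumes h: "right_module_iso M N h" and g: "right_module_iso M P g"
    and r: "\<And>x. x \<in> carrier M \<Longrightarrow> r (h x) = g x"
  shows "right_module_iso N P r"
proof -
  have M: "right_module M" and N: "right_module N" and P: "right_module P"
    using h g by (auto simp: right_module_iso_def)
  interpret comm_group M using M by (simp add: right_module_def)
  have act_closed: "x \<in> carrier M \<Longrightarrow> act M x c \<in> carrier M" for x c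
    using M by (simp add: right_module_def)
  have bij: "bij_betw h (carrier M) (carrier N)" "bij_betw g (carrier M) (carrier P)"
    and mult: "\<And>x y. x \<in> carrier M \<Longrightarrow> y \<in> carrier M \<Longrightarrow> h x \<otimes>\<^bsub>N\<^esub> h y = h (x \<otimes>\<^bsub>M\<^esub> y)"
      "\<And>x y. x \<in> carrier M \<Longrightarrow> y \<in> carrier M \<Longrightarrow> g x \<otimes>\<^bsub>P\<^esub> g y = g (x \<otimes>\<^bsub>M\<^esub> y)"
    and act: "\<And>x c. x \<in> carrier M \<Longrightarrow> act N (h x) c = h (act M x c)"
      "\<And>x c. x \<in> carrier M \<Longrightarrow> act P (g x) c = g (act M x c)"
    using h g by (auto simp: right_module_iso_def iso_def hom_def)
  have car: "carrier N = h ` carrier M" using bij by (simp add: bij_betw_imp_surj_on)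
  have "bij_betw (r \<circ> h) (carrier M) (carrier P)"
    using bij(2) by (rule bij_betw_cong[THEN iffD1, rotated]) (simp add: r)
  then have bij_r: "bij_betw r (carrier N) (carrier P)"
    using bij_betw_comp_iff[OF bij(1)] by blast
  then have "r \<in> iso N P"
    by (auto simp: iso_def hom_def car mult r bij_betw_apply)
  with N P show ?thesis
    by (auto simp: right_module_iso_def car act r act_closed)
qed

lemma zero_analytic_tensor: "(\<lambda>t. 0) \<in> analytic_tensor \<Omega>\<^sub>1"
  by (rule analytic_tensorI) (auto intro!: exI[of _ 1] exI[of _ "\<lambda>_. 0"])

text \<open>
  The common pattern of both extension maps. For a class \<open>M\<close> of functions that is closed under right
  linear combinations, assume that a function of the class is determined near \<open>\<Omega>\<^sub>1\<close> by its restriction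
  to the real axis and that this restriction is analytic. Then any extension operator into the class is
  the inverse of the restriction, and it is linear because sums and multiples of extensions restrict
  correctly. Arbitrary open neighbourhoods are allowed for \<open>M\<close>, since the intersection of two axially
  symmetric slice domains need not be connected.
\<close>
lemma germ_extension_iso:
  fixes E :: "(real \<Rightarrow> 'n::{finite,linorder} clifford) \<Rightarrow> 'n pvec \<Rightarrow> 'n clifford"
    and M :: "'n pvec set \<Rightarrow> ('n pvec \<Rightarrow> 'n clifford) \<Rightarrow> bool"
  assumes add_mult: "\<And>\<Omega> \<Omega>' f g c. M \<Omega> f \<Longrightarrow> M \<Omega>' g \<Longrightarrow> M (\<Omega> \<inter> \<Omega>') (\<lambda>p. f p + g p * c)"
    and unique: "\<And>\<Omega> \<Omega>' f g. M \<Omega> f \<Longrightarrow> M \<Omega>' g \<Longrightarrow> open \<Omega> \<Longrightarrow> (\<And>t. t \<in> \<Omega>\<^sub>1 \<Longrightarrow> (t, 0) \<in> \<Omega>) \<Longrightarrow>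
      open \<Omega>' \<Longrightarrow> (\<And>t. t \<in> \<Omega>\<^sub>1 \<Longrightarrow> (t, 0) \<in> \<Omega>') \<Longrightarrow> (\<And>t. t \<in> \<Omega>\<^sub>1 \<Longrightarrow> f (t, 0) = g (t, 0)) \<Longrightarrow>
      near \<Omega>\<^sub>1 (\<lambda>p. f p = g p)"
    and restrict: "\<And>\<Omega> f. M \<Omega> f \<Longrightarrow> open \<Omega> \<Longrightarrow> (\<And>t. t \<in> \<Omega>\<^sub>1 \<Longrightarrow> (t, 0) \<in> \<Omega>) \<Longrightarrow>
      (\<lambda>t. if t \<in> \<Omega>\<^sub>1 then f (t, 0) else 0) \<in> analytic_tensor \<Omega>\<^sub>1"
    and ext: "\<And>f. f \<in> analytic_tensor \<Omega>\<^sub>1 \<Longrightarrow> \<exists>\<Omega>. axial_slice_nbhd \<Omega>\<^sub>1 \<Omega> \<and> M \<Omega> (E f)"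
      "\<And>f t. E f (t, 0) = f t"
    and h: "\<And>f. f \<in> analytic_tensor \<Omega>\<^sub>1 \<Longrightarrow> h f = germ \<Omega>\<^sub>1 (E f)"
  shows "right_module_iso (analytic_module \<Omega>\<^sub>1)
    (germ_module \<Omega>\<^sub>1 {germ \<Omega>\<^sub>1 f | \<Omega> f. axial_slice_nbhd \<Omega>\<^sub>1 \<Omega> \<and> M \<Omega> f}) h"
proof -
  let ?T = "analytic_tensor \<Omega>\<^sub>1 :: (real \<Rightarrow> 'n clifford) set"
  let ?A = "analytic_module \<Omega>\<^sub>1 :: (real \<Rightarrow> 'n clifford, 'n clifford) rmodule"
  let ?X = "{germ \<Omega>\<^sub>1 f | \<Omega> f. axial_slice_nbhd \<Omega>\<^sub>1 \<Omega> \<and> M \<Omega> f}"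
  have out: "f t = 0" if "f \<in> ?T" "t \<notin> \<Omega>\<^sub>1" for f t
    using that by (simp add: analytic_tensor_def)
  have ext': "\<exists>\<Omega>. open \<Omega> \<and> (\<forall>t\<in>\<Omega>\<^sub>1. (t, 0) \<in> \<Omega>) \<and> M \<Omega> (E f)" if f: "f \<in> ?T" for f
  proof -
    obtain \<Omega> where "axial_slice_nbhd \<Omega>\<^sub>1 \<Omega>" "M \<Omega> (E f)" using ext(1)[OF f] by (elim exE conjE)
    then show ?thesis using axial_slice_nbhd_open[of \<Omega>\<^sub>1 \<Omega>] by (intro exI[of _ \<Omega>]) simp
  qed
  have germ_E: "g \<in> ?T \<and> germ \<Omega>\<^sub>1 F = germ \<Omega>\<^sub>1 (E g)"
    if F: "M \<Omega> F" "open \<Omega>" "\<And>t. t \<in> \<Omega>\<^sub>1 \<Longrightarrow> (t, 0) \<in> \<Omega>"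
      and g: "\<And>t. g t = (if t \<in> \<Omega>\<^sub>1 then F (t, 0) else 0)" for \<Omega> F g
  proof
    have "g = (\<lambda>t. if t \<in> \<Omega>\<^sub>1 then F (t, 0) else 0)" using g by auto
    then show "g \<in> ?T" using restrict[OF F] by simp
    from ext'[OF this] obtain \<Omega>' where "open \<Omega>'" "\<forall>t\<in>\<Omega>\<^sub>1. (t, 0) \<in> \<Omega>'" "M \<Omega>' (E g)"
      by (elim exE conjE)
    then show "germ \<Omega>\<^sub>1 F = germ \<Omega>\<^sub>1 (E g)"
      unfolding germ_eq_iff using F by (intro unique[of \<Omega> F \<Omega>' "E g"]) (auto simp: ext(2) g)
  qed
  have add_times: "(\<lambda>t. f t + g t * c) \<in> ?T \<and>
      germ \<Omega>\<^sub>1 (\<lambda>p. E f p + E g p * c) = germ \<Omega>\<^sub>1 (E (\<lambda>t. f t + g t * c))"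
    if f: "f \<in> ?T" and g: "g \<in> ?T" for f g c
  proof -
    obtain \<Omega> \<Omega>' where "open \<Omega>" "\<forall>t\<in>\<Omega>\<^sub>1. (t, 0) \<in> \<Omega>" "M \<Omega> (E f)" "open \<Omega>'" "\<forall>t\<in>\<Omega>\<^sub>1. (t, 0) \<in> \<Omega>'" "M \<Omega>' (E g)"
      using ext'[OF f] ext'[OF g] by (elim exE conjE)
    then show ?thesis
      by (intro germ_E[of "\<Omega> \<inter> \<Omega>'"] add_mult) (auto simp: ext(2) out f g)
  qed
  have plus: "(\<lambda>t. f t + g t) \<in> ?T \<and> germ \<Omega>\<^sub>1 (\<lambda>p. E f p + E g p) = germ \<Omega>\<^sub>1 (E (\<lambda>t. f t + g t))"
    if "f \<in> ?T" "g \<in> ?T" for f g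
    using add_times[OF that, of 1] by simp
  have times: "(\<lambda>t. f t * c) \<in> ?T \<and> germ \<Omega>\<^sub>1 (\<lambda>p. E f p * c) = germ \<Omega>\<^sub>1 (E (\<lambda>t. f t * c))"
    if "f \<in> ?T" for f c
    using add_times[OF that that, of "c - 1"] by (simp add: right_diff_distrib)
  note zero = zero_analytic_tensor[of \<Omega>\<^sub>1, where ?'a = 'n]
  have group: "comm_group ?A"
  proof (rule comm_groupI)
    fix f assume "f \<in> carrier ?A"
    then have f: "f \<in> ?T" by (simp add: analytic_module_def)
    show "\<exists>g\<in>carrier ?A. g \<otimes>\<^bsub>?A\<^esub> f = \<one>\<^bsub>?A\<^esub>"
      using times[OF f, of "- 1"] by (intro bexI[of _ "\<lambda>t. f t * (- 1)"]) (simp_all add: analytic_module_def)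
  qed (auto simp: analytic_module_def plus zero add_ac)
  then have A: "right_module ?A"
    using times plus by (auto simp: right_module_def analytic_module_def algebra_simps)
  show ?thesis
  proof (rule right_module_iso_transport[OF A])
    have "inj_on h ?T"
    proof (rule inj_onI)
      fix f g assume fg: "f \<in> ?T" "g \<in> ?T" "h f = h g"
      then have "near \<Omega>\<^sub>1 (\<lambda>p. E f p = E g p)" by (simp add: h germ_eq_iff)
      then have in_\<Omega>\<^sub>1: "f t = g t" if "t \<in> \<Omega>\<^sub>1" for t using near_axis[OF _ that] by (fastforce simp: ext(2))
      show "f = g"
      proof
        show "f t = g t" for t using in_\<Omega>\<^sub>1[of t] out[OF fg(1), of t] out[OF fg(2), of t] by (cases "t \<in> \<Omega>\<^sub>1") simp_all
      qed
    qed
    moreover have "h ` ?T = ?X"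
    proof (intro equalityI subsetI)
      fix \<phi> assume "\<phi> \<in> h ` ?T"
      then obtain f where f: "f \<in> ?T" "\<phi> = germ \<Omega>\<^sub>1 (E f)" using h by auto
      obtain \<Omega> where "axial_slice_nbhd \<Omega>\<^sub>1 \<Omega>" "M \<Omega> (E f)" using ext(1)[OF f(1)] by (elim exE conjE)
      then show "\<phi> \<in> ?X" using f(2) by auto
    next
      fix \<phi> assume "\<phi> \<in> ?X"
      then obtain \<Omega> F where \<phi>: "\<phi> = germ \<Omega>\<^sub>1 F" and "axial_slice_nbhd \<Omega>\<^sub>1 \<Omega>" "M \<Omega> F" by auto
      then have "(\<lambda>t. if t \<in> \<Omega>\<^sub>1 then F (t, 0) else 0) \<in> ?T \<and>
          germ \<Omega>\<^sub>1 F = germ \<Omega>\<^sub>1 (E (\<lambda>t. if t \<in> \<Omega>\<^sub>1 then F (t, 0) else 0))"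
        by (intro germ_E[of \<Omega>]) (auto dest: axial_slice_nbhd_open)
      then show "\<phi> \<in> h ` ?T" using h \<phi> by (simp add: image_iff) metis
    qed
    ultimately show "bij_betw h (carrier ?A) (carrier (germ_module \<Omega>\<^sub>1 ?X))"
      by (simp add: bij_betw_def analytic_module_def germ_module_def)
    fix f assume "f \<in> carrier ?A"
    then have f: "f \<in> ?T" by (simp add: analytic_module_def)
    show "h (act ?A f c) = act (germ_module \<Omega>\<^sub>1 ?X) (h f) c" for c
      using times[OF f, of c] by (simp add: h f germ_module_act analytic_module_def)
    fix g assume "g \<in> carrier ?A"
    then have g: "g \<in> ?T" by (simp add: analytic_module_def)
    show "h (f \<otimes>\<^bsub>?A\<^esub> g) = h f \<otimes>\<^bsub>germ_module \<Omega>\<^sub>1 ?X\<^esub> h g"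
      using plus[OF f g] by (simp add: h f g germ_module_mult) (simp add: analytic_module_def h)
  next
    have "germ \<Omega>\<^sub>1 (E (\<lambda>t. 0)) = germ \<Omega>\<^sub>1 (\<lambda>p. 0)"
      using times[OF zero, of 0] by simp
    then show "h \<one>\<^bsub>?A\<^esub> = \<one>\<^bsub>germ_module \<Omega>\<^sub>1 ?X\<^esub>"
      by (simp add: analytic_module_def germ_module_def h zero)
  qed
qed

section \<open>The three isomorphisms\<close>

text \<open>
  The points \<open>(u, \<langle>x, \<omega>\<rangle> \<omega>)\<close> in the integral at \<open>(u, x)\<close> are not farther from the axis than \<open>(u, x)\<close>, so
  the transform is a map of germs.
\<close>
lemma near_dual_radon:
  fixes f g :: "'n::{finite,linorder} pvec \<Rightarrow> 'n clifford"
  assumes "near \<Omega>\<^sub>1 (\<lambda>p. f p = g p)"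
  shows "near \<Omega>\<^sub>1 (\<lambda>p. dual_radon f p = dual_radon g p)"
proof -
  obtain U where U: "open U" "\<And>t. t \<in> \<Omega>\<^sub>1 \<Longrightarrow> (t, 0) \<in> U" "\<And>p. p \<in> U \<Longrightarrow> f p = g p"
    using assms unfolding near_def by blast
  have "\<exists>r>0. \<forall>u x. \<bar>u - t\<bar> < r \<longrightarrow> norm x < r \<longrightarrow> (u, x) \<in> U" if "t \<in> \<Omega>\<^sub>1" for t
    using open_axis_box[OF U(1) U(2)[OF that]] by metis
  then obtain r where r: "\<And>t. t \<in> \<Omega>\<^sub>1 \<Longrightarrow> r t > 0"
      "\<And>t u x. t \<in> \<Omega>\<^sub>1 \<Longrightarrow> \<bar>u - t\<bar> < r t \<Longrightarrow> norm x < r t \<Longrightarrow> (u, x) \<in> U" by metis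
  show ?thesis
    unfolding near_def
  proof (intro exI[of _ "boxes \<Omega>\<^sub>1 r"] conjI ballI open_boxes)
    show "(t, 0) \<in> boxes \<Omega>\<^sub>1 r" if "t \<in> \<Omega>\<^sub>1" for t
      using that r(1)[OF that] by (auto simp: boxes_def intro!: bexI[of _ t])
    fix p :: "'n pvec" assume "p \<in> boxes \<Omega>\<^sub>1 r"
    then obtain u x t where p: "p = (u, x)" and t: "t \<in> \<Omega>\<^sub>1" "\<bar>u - t\<bar> < r t" "norm x < r t"
      by (auto simp: boxes_def)
    have "f (u, (x \<bullet> \<omega>) *\<^sub>R \<omega>) = g (u, (x \<bullet> \<omega>) *\<^sub>R \<omega>)" if "norm \<omega> = 1" for \<omega>
      using Cauchy_Schwarz_ineq2[of x \<omega>] that t by (intro U(3) r(2)[OF t(1)]) auto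
    then show "dual_radon f p = dual_radon g p"
      unfolding p dual_radon_def prod.case
      by (intro arg_cong[where f = "(*\<^sub>R) _"] integral_sphere_cong)
  qed
qed

lemma R_map_germ: "R_map \<Omega>\<^sub>1 (germ \<Omega>\<^sub>1 f) = germ \<Omega>\<^sub>1 (dual_radon f)"
  unfolding R_map_def by (rule germ_UN_lift) (simp add: germ_eq_iff near_dual_radon)

text \<open>
  The radius is halved since the boxes need holomorphic extensions to disks of twice their size.
\<close>
lemma analytic_tensor_radii:
  fixes f :: "real \<Rightarrow> 'n::{finite,linorder} clifford"
  assumes f: "f \<in> analytic_tensor \<Omega>\<^sub>1" and "open \<Omega>\<^sub>1"
  obtains r H where "\<And>t. t \<in> \<Omega>\<^sub>1 \<Longrightarrow> r t > 0" "\<And>t u. t \<in> \<Omega>\<^sub>1 \<Longrightarrow> \<bar>u - t\<bar> < r t \<Longrightarrow> u \<in> \<Omega>\<^sub>1"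
    "\<And>t. t \<in> \<Omega>\<^sub>1 \<Longrightarrow> hol_ext f t (2 * r t) (H t)"
proof -
  have "\<exists>r H. r > 0 \<and> (\<forall>u. \<bar>u - t\<bar> < r \<longrightarrow> u \<in> \<Omega>\<^sub>1) \<and> hol_ext f t (2 * r) H" if t: "t \<in> \<Omega>\<^sub>1" for t
  proof -
    obtain R H where R: "R > 0" "hol_ext f t R H" using analytic_tensor_hol_ext[OF f t] .
    obtain s where s: "s > 0" "ball t s \<subseteq> \<Omega>\<^sub>1" using \<open>open \<Omega>\<^sub>1\<close> t by (meson openE)
    have "hol_ext f t (2 * min (R / 2) s) H"
      unfolding hol_ext_def
    proof (intro allI conjI ballI)
      show "H A holomorphic_on ball (complex_of_real t) (2 * min (R / 2) s)" for A
        by (rule holomorphic_on_subset[of _ "ball (of_real t) R"]) (use R in \<open>auto simp: hol_ext_def\<close>)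
    qed (use R in \<open>auto simp: hol_ext_def\<close>)
    then show ?thesis
      using R s by (intro exI[of _ "min (R / 2) s"] exI[of _ H])
        (auto simp: subset_iff dist_real_def abs_minus_commute)
  qed
  then show ?thesis using that by metis
qed

text \<open>
  The average of the slice extension is one generalized Cauchy-Kovalevskaya extension, and any other
  has the same values on the real axis, hence the same germ.
\<close>
lemma GCK_eq:
  fixes f :: "real \<Rightarrow> 'n::{finite,linorder} clifford"
  assumes f: "f \<in> analytic_tensor \<Omega>\<^sub>1" and \<Omega>\<^sub>1: "open \<Omega>\<^sub>1" "connected \<Omega>\<^sub>1" "\<Omega>\<^sub>1 \<noteq> {}"
  shows "GCK \<Omega>\<^sub>1 f = germ \<Omega>\<^sub>1 (dual_radon (slice_ext f))"
  unfolding GCK_def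
proof (rule the_equality)
  obtain r H where "\<And>t. t \<in> \<Omega>\<^sub>1 \<Longrightarrow> r t > 0" "\<And>t u. t \<in> \<Omega>\<^sub>1 \<Longrightarrow> \<bar>u - t\<bar> < r t \<Longrightarrow> u \<in> \<Omega>\<^sub>1"
    "\<And>t. t \<in> \<Omega>\<^sub>1 \<Longrightarrow> hol_ext f t (2 * r t) (H t)"
    using analytic_tensor_radii[OF f \<Omega>\<^sub>1(1)] by metis
  from is_GCK_dual_radon[OF f \<Omega>\<^sub>1 this] have G: "is_GCK \<Omega>\<^sub>1 f (dual_radon (slice_ext f))" .
  then show "\<exists>F. is_GCK \<Omega>\<^sub>1 f F \<and> germ \<Omega>\<^sub>1 (dual_radon (slice_ext f)) = germ \<Omega>\<^sub>1 F" by blast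
  fix \<phi> assume "\<exists>F. is_GCK \<Omega>\<^sub>1 f F \<and> \<phi> = germ \<Omega>\<^sub>1 F"
  then obtain F where F: "is_GCK \<Omega>\<^sub>1 f F" and \<phi>: "\<phi> = germ \<Omega>\<^sub>1 F" by blast
  obtain \<Omega> \<Omega>' where "axial_slice_nbhd \<Omega>\<^sub>1 \<Omega>" "axially_monogenic \<Omega> F"
      "axial_slice_nbhd \<Omega>\<^sub>1 \<Omega>'" "axially_monogenic \<Omega>' (dual_radon (slice_ext f))"
    using F G unfolding is_GCK_def by blast
  moreover have "F (t, 0) = dual_radon (slice_ext f) (t, 0)" if "t \<in> \<Omega>\<^sub>1" for t
    using F G that unfolding is_GCK_def by simp
  ultimately show "\<phi> = germ \<Omega>\<^sub>1 (dual_radon (slice_ext f))"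
    unfolding \<phi> germ_eq_iff using \<Omega>\<^sub>1(1)
    by (intro axially_monogenic_unique[of \<Omega> F \<Omega>']) (auto dest: axial_slice_nbhd_open)
qed

lemma exp_op_eq_slice_ext: "exp_op \<omega> x f x\<^sub>0 = slice_ext f (x\<^sub>0, (x \<bullet> \<omega>) *\<^sub>R \<omega>)"
  unfolding exp_op_def slice_ext_def slice_term_sphere
  by (simp add: inner_commute[of x] divide_inverse mult.commute)

theorem theorem5p2:
  fixes \<Omega>\<^sub>1 :: "real set"
    and A :: "(real \<Rightarrow> 'n::{finite,linorder} clifford, 'n clifford) rmodule"
  defines "A \<equiv> analytic_module \<Omega>\<^sub>1"
  assumes "open \<Omega>\<^sub>1" and "connected \<Omega>\<^sub>1" and "\<Omega>\<^sub>1 \<noteq> {}"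
  shows "(\<forall>f\<^sub>0\<in>carrier A.
      (\<exists>\<Omega> F. axial_slice_nbhd \<Omega>\<^sub>1 \<Omega> \<and>
        axially_monogenic \<Omega> F \<and> GCK \<Omega>\<^sub>1 f\<^sub>0 = germ \<Omega>\<^sub>1 F \<and>
        (\<forall>p\<in>\<Omega>. summable (slice_term f\<^sub>0 p)) \<and>
        slice_monogenic \<Omega> (slice_ext f\<^sub>0) \<and> (\<forall>t\<in>\<Omega>\<^sub>1. slice_ext f\<^sub>0 (t, 0) = f\<^sub>0 t) \<and>
        (\<forall>(x\<^sub>0, x)\<in>\<Omega>.
          F (x\<^sub>0, x) = (1 / sphere_area CARD('n)) *\<^sub>R
            (\<integral>\<omega>. exp_op \<omega> x f\<^sub>0 x\<^sub>0 \<partial>sphere_measure) \<and>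
          (1 / sphere_area CARD('n)) *\<^sub>R (\<integral>\<omega>. exp_op \<omega> x f\<^sub>0 x\<^sub>0 \<partial>sphere_measure) =
            (1 / sphere_area CARD('n)) *\<^sub>R
              (\<integral>\<omega>. slice_ext f\<^sub>0 (x\<^sub>0, (x \<bullet> \<omega>) *\<^sub>R \<omega>) \<partial>sphere_measure))) \<and>
      GCK \<Omega>\<^sub>1 f\<^sub>0 = R_map \<Omega>\<^sub>1 (S_map \<Omega>\<^sub>1 f\<^sub>0)) \<and>
    right_module_iso A (AM \<Omega>\<^sub>1) (GCK \<Omega>\<^sub>1) \<and>
    right_module_iso A (SM \<Omega>\<^sub>1) (S_map \<Omega>\<^sub>1) \<and>
    right_module_iso (SM \<Omega>\<^sub>1) (AM \<Omega>\<^sub>1) (R_map \<Omega>\<^sub>1 ::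
      ('n pvec \<Rightarrow> 'n clifford) set \<Rightarrow> ('n pvec \<Rightarrow> 'n clifford) set) \<and>
    (\<forall>\<phi>\<in>carrier (SM \<Omega>\<^sub>1). R_map \<Omega>\<^sub>1 \<phi> = GCK \<Omega>\<^sub>1 (inv_into (carrier A) (S_map \<Omega>\<^sub>1) \<phi>)) \<and>
    (\<forall>\<phi>\<in>carrier (AM \<Omega>\<^sub>1). inv_into (carrier (SM \<Omega>\<^sub>1)) (R_map \<Omega>\<^sub>1) \<phi> =
      S_map \<Omega>\<^sub>1 (inv_into (carrier A) (GCK \<Omega>\<^sub>1) \<phi>))"
proof (intro conjI ballI)
  have carrier_A: "carrier A = analytic_tensor \<Omega>\<^sub>1" by (simp add: A_def analytic_module_def)
  note \<Omega>\<^sub>1 = assms(2-4)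
  have GCK: "GCK \<Omega>\<^sub>1 f = germ \<Omega>\<^sub>1 (dual_radon (slice_ext f))" if "f \<in> carrier A" for f
    using GCK_eq[OF _ \<Omega>\<^sub>1] that by (simp add: carrier_A)
  have nbhd: "\<exists>\<Omega>. axial_slice_nbhd \<Omega>\<^sub>1 \<Omega> \<and> axially_monogenic \<Omega> (dual_radon (slice_ext f)) \<and>
      slice_monogenic \<Omega> (slice_ext f) \<and> (\<forall>p\<in>\<Omega>. summable (slice_term f p))"
    if f: "f \<in> analytic_tensor \<Omega>\<^sub>1" for f :: "real \<Rightarrow> 'n clifford"
  proof -
    obtain r H where r: "\<And>t. t \<in> \<Omega>\<^sub>1 \<Longrightarrow> r t > 0" "\<And>t u. t \<in> \<Omega>\<^sub>1 \<Longrightarrow> \<bar>u - t\<bar> < r t \<Longrightarrow> u \<in> \<Omega>\<^sub>1"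
      and H: "\<And>t. t \<in> \<Omega>\<^sub>1 \<Longrightarrow> hol_ext f t (2 * r t) (H t)"
      using analytic_tensor_radii[OF f \<Omega>\<^sub>1(1)] by metis
    show ?thesis
    proof (intro exI[of _ "boxes \<Omega>\<^sub>1 r"] conjI ballI)
      show "axial_slice_nbhd \<Omega>\<^sub>1 (boxes \<Omega>\<^sub>1 r :: 'n pvec set)"
        by (rule axial_slice_nbhd_boxes[OF \<Omega>\<^sub>1(2,3)]) (fact r)+
      show "axially_monogenic (boxes \<Omega>\<^sub>1 r) (dual_radon (slice_ext f))"
        by (rule axially_monogenic_dual_radon) (fact H)
      show "slice_monogenic (boxes \<Omega>\<^sub>1 r) (slice_ext f)"
        by (rule slice_monogenic_slice_ext) (fact H)
      fix p :: "'n pvec" assume "p \<in> boxes \<Omega>\<^sub>1 r"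
      then obtain u x t where p: "p = (u, x)" and t: "t \<in> \<Omega>\<^sub>1" "\<bar>u - t\<bar> < r t" "norm x < r t"
        by (auto simp: boxes_def)
      obtain \<omega> where \<omega>: "norm \<omega> = 1" "x = norm x *\<^sub>R \<omega>"
        by (rule obtain_direction[of x])
      have "slice_term f (u, norm x *\<^sub>R \<omega>) sums plane_wave (H t) \<omega> (Complex u (norm x))"
        by (rule slice_term_sums[OF H[OF t(1)] \<omega>(1)]) (use t in simp)
      then show "summable (slice_term f p)"
        using \<omega>(2) by (simp add: p sums_iff)
    qed
  qed
  have R_S: "R_map \<Omega>\<^sub>1 (S_map \<Omega>\<^sub>1 f) = GCK \<Omega>\<^sub>1 f" if "f \<in> carrier A" for f
    by (simp add: S_map_def R_map_germ GCK that)
  show iso_GCK: "right_module_iso A (AM \<Omega>\<^sub>1) (GCK \<Omega>\<^sub>1)"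
    unfolding A_def AM_def
  proof (rule germ_extension_iso[where E = "\<lambda>f. dual_radon (slice_ext f)"])
    show "near \<Omega>\<^sub>1 (\<lambda>p. f p = g p)" if "axially_monogenic \<Omega> f" "axially_monogenic \<Omega>' g" "open \<Omega>"
      "\<And>t. t \<in> \<Omega>\<^sub>1 \<Longrightarrow> (t, 0) \<in> \<Omega>" "open \<Omega>'" "\<And>t. t \<in> \<Omega>\<^sub>1 \<Longrightarrow> (t, 0) \<in> \<Omega>'"
      "\<And>t. t \<in> \<Omega>\<^sub>1 \<Longrightarrow> f (t, 0) = g (t, 0)" for \<Omega> \<Omega>' and f g :: "'n pvec \<Rightarrow> 'n clifford"
      by (rule axially_monogenic_unique[OF that(1-6) \<Omega>\<^sub>1(1) that(7)])
    show "dual_radon (slice_ext f) (t, 0) = f t" for f :: "real \<Rightarrow> 'n clifford" and t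
      by (rule dual_radon_axis) (rule slice_ext_axis)
  qed (use nbhd GCK carrier_A \<Omega>\<^sub>1(1) in \<open>blast intro: axially_monogenic_add_mult_right
      axially_monogenic_restriction_analytic\<close>)+
  show iso_S: "right_module_iso A (SM \<Omega>\<^sub>1) (S_map \<Omega>\<^sub>1)"
    unfolding A_def SM_def
  proof (rule germ_extension_iso[where E = slice_ext])
    show "near \<Omega>\<^sub>1 (\<lambda>p. f p = g p)" if "slice_monogenic \<Omega> f" "slice_monogenic \<Omega>' g" "open \<Omega>"
      "\<And>t. t \<in> \<Omega>\<^sub>1 \<Longrightarrow> (t, 0) \<in> \<Omega>" "open \<Omega>'" "\<And>t. t \<in> \<Omega>\<^sub>1 \<Longrightarrow> (t, 0) \<in> \<Omega>'"
      "\<And>t. t \<in> \<Omega>\<^sub>1 \<Longrightarrow> f (t, 0) = g (t, 0)" for \<Omega> \<Omega>' and f g :: "'n pvec \<Rightarrow> 'n clifford"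
      by (rule slice_monogenic_unique[OF that(1-6) \<Omega>\<^sub>1(1) that(7)])
    show "S_map \<Omega>\<^sub>1 f = germ \<Omega>\<^sub>1 (slice_ext f)" for f :: "real \<Rightarrow> 'n clifford" by (rule S_map_def)
    show "slice_ext f (t, 0) = f t" for f :: "real \<Rightarrow> 'n clifford" and t by (rule slice_ext_axis)
  qed (use nbhd \<Omega>\<^sub>1(1) in \<open>blast intro: slice_monogenic_add_mult_right
      slice_monogenic_restriction_analytic\<close>)+
  show iso_R: "right_module_iso (SM \<Omega>\<^sub>1) (AM \<Omega>\<^sub>1) (R_map \<Omega>\<^sub>1 ::
      ('n pvec \<Rightarrow> 'n clifford) set \<Rightarrow> ('n pvec \<Rightarrow> 'n clifford) set)"
    by (rule right_module_iso_factor[OF iso_S iso_GCK R_S])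
  have bij: "bij_betw (S_map \<Omega>\<^sub>1) (carrier A) (carrier (SM \<Omega>\<^sub>1))"
      "bij_betw (GCK \<Omega>\<^sub>1) (carrier A) (carrier (AM \<Omega>\<^sub>1))"
      "bij_betw (R_map \<Omega>\<^sub>1) (carrier (SM \<Omega>\<^sub>1)) (carrier (AM \<Omega>\<^sub>1) :: ('n pvec \<Rightarrow> 'n clifford) set set)"
    using iso_S iso_GCK iso_R by (auto simp: right_module_iso_def iso_def)
  show "R_map \<Omega>\<^sub>1 \<phi> = GCK \<Omega>\<^sub>1 (inv_into (carrier A) (S_map \<Omega>\<^sub>1) \<phi>)" if "\<phi> \<in> carrier (SM \<Omega>\<^sub>1)" for \<phi>
  proof -
    have "inv_into (carrier A) (S_map \<Omega>\<^sub>1) \<phi> \<in> carrier A"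
      "S_map \<Omega>\<^sub>1 (inv_into (carrier A) (S_map \<Omega>\<^sub>1) \<phi>) = \<phi>"
      using bij(1) that by (auto simp: bij_betw_def inv_into_into f_inv_into_f)
    then show ?thesis using R_S by metis
  qed
  show "inv_into (carrier (SM \<Omega>\<^sub>1)) (R_map \<Omega>\<^sub>1) \<phi> = S_map \<Omega>\<^sub>1 (inv_into (carrier A) (GCK \<Omega>\<^sub>1) \<phi>)"
    if "\<phi> \<in> carrier (AM \<Omega>\<^sub>1)" for \<phi>
  proof -
    define f where "f = inv_into (carrier A) (GCK \<Omega>\<^sub>1) \<phi>"
    have f: "f \<in> carrier A" "GCK \<Omega>\<^sub>1 f = \<phi>"
      using bij(2) that by (auto simp: bij_betw_def inv_into_into f_inv_into_f f_def)
    have "inv_into (carrier (SM \<Omega>\<^sub>1)) (R_map \<Omega>\<^sub>1) (R_map \<Omega>\<^sub>1 (S_map \<Omega>\<^sub>1 f)) = S_map \<Omega>\<^sub>1 f"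
      using bij(1,3) f(1) by (intro inv_into_f_f) (auto simp: bij_betw_def)
    then show ?thesis by (simp add: R_S f f_def[symmetric])
  qed
  fix f\<^sub>0 assume f\<^sub>0: "f\<^sub>0 \<in> carrier A"
  show "GCK \<Omega>\<^sub>1 f\<^sub>0 = R_map \<Omega>\<^sub>1 (S_map \<Omega>\<^sub>1 f\<^sub>0)" using R_S[OF f\<^sub>0] ..
  obtain \<Omega> where \<Omega>: "axial_slice_nbhd \<Omega>\<^sub>1 \<Omega>" "axially_monogenic \<Omega> (dual_radon (slice_ext f\<^sub>0))"
      "slice_monogenic \<Omega> (slice_ext f\<^sub>0)" "\<forall>p\<in>\<Omega>. summable (slice_term f\<^sub>0 p)"
    using nbhd f\<^sub>0 by (auto simp: carrier_A)
  show "\<exists>\<Omega> F. axial_slice_nbhd \<Omega>\<^sub>1 \<Omega> \<and>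
        axially_monogenic \<Omega> F \<and> GCK \<Omega>\<^sub>1 f\<^sub>0 = germ \<Omega>\<^sub>1 F \<and>
        (\<forall>p\<in>\<Omega>. summable (slice_term f\<^sub>0 p)) \<and>
        slice_monogenic \<Omega> (slice_ext f\<^sub>0) \<and> (\<forall>t\<in>\<Omega>\<^sub>1. slice_ext f\<^sub>0 (t, 0) = f\<^sub>0 t) \<and>
        (\<forall>(x\<^sub>0, x)\<in>\<Omega>.
          F (x\<^sub>0, x) = (1 / sphere_area CARD('n)) *\<^sub>R
            (\<integral>\<omega>. exp_op \<omega> x f\<^sub>0 x\<^sub>0 \<partial>sphere_measure) \<and>
          (1 / sphere_area CARD('n)) *\<^sub>R (\<integral>\<omega>. exp_op \<omega> x f\<^sub>0 x\<^sub>0 \<partial>sphere_measure) =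
            (1 / sphere_area CARD('n)) *\<^sub>R
              (\<integral>\<omega>. slice_ext f\<^sub>0 (x\<^sub>0, (x \<bullet> \<omega>) *\<^sub>R \<omega>) \<partial>sphere_measure))"
    using \<Omega> by (intro exI[of _ \<Omega>] exI[of _ "dual_radon (slice_ext f\<^sub>0)"])
      (auto simp: GCK[OF f\<^sub>0] slice_ext_axis exp_op_eq_slice_ext dual_radon_def)
qed

end
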